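(* We have $\mathcal{B}\left(22,5;\left(0,\frac13\right)\right)=\mathcal{B}\left(22,5;\left(-\frac13,0\right)\right)=2816$. Consequently, the code $C_{2816}$ is a tight $\left(0,\frac13\right)$-avoiding spherical $5$-design and a tight $\left(-\frac13,0\right)$-avoiding spherical $5$-design.
   Context: A spherical code is a finite set $C\subset\mathbb{S}^{n-1}$; $I(C)=\{x\cdot y: x,y\in C,\ x\ne y\}$. For $T\subset[-1,1)$, $C$ is $T$-avoiding if $I(C)\cap T=\varnothing$. A spherical $\tau$-design is a spherical code $C$ such that the average over $C$ of every polynomial in $n$ variables of total degree at most $\tau$ equals its average over $\mathbb{S}^{n-1}$ with respect to normalized surface measure. $\mathcal{B}(n,\tau;T)$ is the minimum of $|C|$ over all $T$-avoiding spherical $\tau$-designs $C\subset\mathbb{S}^{n-1}$. Let $P_i^{(n)}$ be the Gegenbauer polynomials: orthogonal on $[-1,1]$ with weight $(1-t^2)^{(n-3)/2}$, $\deg P_i^{(n)}=i$, $P_i^{(n)}(1)=1$; write a real polynomial as $f=\sum_i f_iP_i^{(n)}$. Linear programming gives $\mathcal{B}(n,\tau;T)\ge f(1)/f_0$ for every real polynomial $f$ with $f\ge0$ on $[-1,1]\setminus T$, $f_0>0$, and $f_i\le0$ for all $i\ge\tau+1$. A $T$-avoiding spherical $\tau$-design $C\subset\mathbb{S}^{n-1}$ is called tight if $|C|=f(1)/f_0$ for some such $f$. The code $C_{2816}$: let $L\subset\mathbb{S}^{23}$ be the set of the $196560$ minimal vectors of the Leech lattice rescaled to unit length. Fix $x\in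 L$; let $C_{1/2}\subset\mathbb{S}^{22}$ be the set of vectors $(y-\frac12x)/\sqrt{1-\frac14}$ with $y\in L$, $x\cdot y=\frac12$ (in the unit sphere of $x^\perp\cong\mathbb{R}^{23}$); this is the tight spherical $7$-design with $4600$ points and inner products $-1,\pm\frac13,0$. Fix $z\in C_{1/2}$; $C_{2816}=\{y\in C_{1/2}: y\cdot z=0\}$, regarded as a subset of the unit sphere $\mathbb{S}^{21}$ of the orthogonal complement of $z$ in $\mathbb{R}^{23}$. It is an antipodal spherical $5$-design with $2816$ points and inner products $-1,-\frac13,0,\frac13$. *)

theory Defs
  imports "HOL-Analysis.Analysis" "HOL-Computational_Algebra.Polynomial"
begin

section \<open>Spherical codes and designs\<close>

definition spherical_code :: "(real ^ 'n) set \<Rightarrow> bool" where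
  "spherical_code C \<longleftrightarrow> finite C \<and> C \<subseteq> sphere 0 1"

definition inner_products :: "(real ^ 'n) set \<Rightarrow> real set" where
  "inner_products C = {x \<bullet> y | x y. x \<in> C \<and> y \<in> C \<and> x \<noteq> y}"

definition avoiding :: "real set \<Rightarrow> (real ^ 'n) set \<Rightarrow> bool" where
  "avoiding T C \<longleftrightarrow> inner_products C \<inter> T = {}"

text \<open>
  Normalized surface measure on the unit sphere, as a Borel measure on the ambient space
  concentrated on the sphere: the measure of \<open>A\<close> is the proportion of the volume of the unit ball
  occupied by the cone over \<open>A\<close> (recall \<open>sgn x = x /\<^sub>R norm x\<close>).
\<close>

definition sphere_measure :: "'a::euclidean_space measure" where
  "sphere_measure = distr (uniform_measure lborel (cball 0 1)) borel sgn"

text \<open>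
  Polynomial functions in the coordinates of total degree at most \<open>d\<close>; \<open>\<alpha>\<close> ranges over exponent
  vectors. The index set of the sum is finite by the lemma following the definition.
\<close>

definition poly_fun_le :: "nat \<Rightarrow> (real ^ 'n \<Rightarrow> real) \<Rightarrow> bool" where
  "poly_fun_le d p \<longleftrightarrow>
     (\<exists>c :: ('n \<Rightarrow> nat) \<Rightarrow> real.
        p = (\<lambda>x. \<Sum>\<alpha> | (\<Sum>i\<in>UNIV. \<alpha> i) \<le> d. c \<alpha> * (\<Prod>i\<in>UNIV. (x $ i) ^ \<alpha> i)))"

lemma finite_exponents: "finite {\<alpha> :: 'n::finite \<Rightarrow> nat. (\<Sum>i\<in>UNIV. \<alpha> i) \<le> d}"
proof (rule finite_subset)
  show "{\<alpha> :: 'n \<Rightarrow> nat. (\<Sum>i\<in>UNIV. \<alpha> i) \<le> d} \<subseteq> (UNIV \<rightarrow>\<^sub>E {..d})"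
  proof
    fix \<alpha> :: "'n \<Rightarrow> nat" assume "\<alpha> \<in> {\<alpha>. (\<Sum>i\<in>UNIV. \<alpha> i) \<le> d}"
    then have "\<alpha> i \<le> d" for i
      using member_le_sum[of i UNIV \<alpha>] by simp
    then show "\<alpha> \<in> UNIV \<rightarrow>\<^sub>E {..d}" by auto
  qed
  show "finite ((UNIV :: 'n set) \<rightarrow>\<^sub>E {..d})"
    by (intro finite_PiE) auto
qed

definition spherical_design :: "nat \<Rightarrow> (real ^ 'n) set \<Rightarrow> bool" where
  "spherical_design \<tau> C \<longleftrightarrow> spherical_code C \<and> C \<noteq> {} \<and>
     (\<forall>p. poly_fun_le \<tau> p \<longrightarrow> (\<Sum>x\<in>C. p x) / real (card C) = (LINT x|sphere_measure. p x))"

text \<open>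
  The quantity \<open>\<B>(n, \<tau>; T)\<close> with \<open>n = CARD('n)\<close>. The infimum of a nonempty set of natural numbers is
  its minimum; the infimum of the empty set is \<open>0\<close>, which is not the size of any design, so a
  positive value of \<open>design_min\<close> is always attained.
\<close>

definition design_min :: "'n::finite itself \<Rightarrow> nat \<Rightarrow> real set \<Rightarrow> nat" where
  "design_min _ \<tau> T = Inf {card C | C :: (real ^ 'n) set. spherical_design \<tau> C \<and> avoiding T C}"

section \<open>Gegenbauer polynomials and tightness\<close>

text \<open>Only meant for \<open>n \<ge> 2\<close>, where the weight is integrable.\<close>

definition gegenbauer :: "nat \<Rightarrow> nat \<Rightarrow> real poly" where
  "gegenbauer n = (THE P.
     (\<forall>i. degree (P i) = i \<and> poly (P i) 1 = 1) \<and>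
     (\<forall>i j. i \<noteq> j \<longrightarrow>
        integral {-1..1} (\<lambda>t. poly (P i) t * poly (P j) t * (1 - t\<^sup>2) powr ((real n - 3) / 2)) = 0))"

definition gegenbauer_expansion :: "nat \<Rightarrow> real poly \<Rightarrow> (nat \<Rightarrow> real) \<Rightarrow> bool" where
  "gegenbauer_expansion n f c \<longleftrightarrow>
     finite {i. c i \<noteq> 0} \<and> f = (\<Sum>i | c i \<noteq> 0. smult (c i) (gegenbauer n i))"

definition tight :: "nat \<Rightarrow> real set \<Rightarrow> (real ^ 'n) set \<Rightarrow> bool" where
  "tight \<tau> T C \<longleftrightarrow> spherical_design \<tau> C \<and> avoiding T C \<and>
     (\<exists>f c. gegenbauer_expansion CARD('n) f c \<and>
        (\<forall>t \<in> {-1..1} - T. poly f t \<ge> 0) \<and> c 0 > 0 \<and> (\<forall>i \<ge> \<tau> + 1. c i \<le> 0) \<and>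
        real (card C) = poly f 1 / c 0)"

section \<open>The Leech lattice\<close>

text \<open>
  The 24 coordinates are indexed by the projective line over the field with 23 elements:
  \<open>None\<close> is the point at infinity, and arithmetic on the type \<open>23\<close> is modulo 23. The extended binary
  Golay code (as a set of supports) is the extended quadratic residue code: it is spanned over
  GF(2) by the twelve-element sets consisting of infinity and the translates by \<open>c\<close> of the eleven
  non-squares.
\<close>

type_synonym point = "23 option"

definition golay_generator :: "23 \<Rightarrow> point set" where
  "golay_generator c = insert None (Some ` {y. \<not> (\<exists>a. y - c = a\<^sup>2)})"

inductive_set golay :: "point set set" where
  empty: "{} \<in> golay"
| add: "A \<in> golay \<Longrightarrow> sym_diff A (golay_generator c) \<in> golay"

text \<open>
  Standard coordinates of the Leech lattice, in the normalization with minimal norm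
  \<open>x \<bullet> x = 4\<close>.
\<close>

definition leech_lattice :: "(real ^ point) set" where
  "leech_lattice = {(1 / sqrt 8) *\<^sub>R (\<chi> i. real_of_int (v i)) | v.
     \<exists>m. (\<forall>i. v i mod 2 = m mod 2) \<and> (\<Sum>i\<in>UNIV. v i) mod 8 = (4 * m) mod 8 \<and>
         (\<forall>k. {i. v i mod 4 = k} \<in> golay)}"

definition leech_code :: "(real ^ point) set" where
  "leech_code = sgn ` {x \<in> leech_lattice. x \<noteq> 0 \<and>
     (\<forall>y \<in> leech_lattice. y \<noteq> 0 \<longrightarrow> norm x \<le> norm y)}"

section \<open>The codes with 4600 and 2816 points\<close>

definition code_half :: "real ^ point \<Rightarrow> (real ^ point) set" where
  "code_half x = {(1 / sqrt (1 - 1 / 4)) *\<^sub>R (y - (1 / 2) *\<^sub>R x) | y. y \<in> leech_code \<and> x \<bullet> y = 1 / 2}"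

definition code_2816 :: "real ^ point \<Rightarrow> real ^ point \<Rightarrow> (real ^ point) set" where
  "code_2816 x z = {y \<in> code_half x. y \<bullet> z = 0}"

text \<open>
  \<open>code_2816 x z\<close> is a set of vectors in 24-space, lying in the 22-dimensional orthogonal complement of
  \<open>x\<close> and \<open>z\<close>. Regarding it as a code in 22-space means pulling it back along a linear isometry
  onto that complement; such isometries exist.
\<close>

definition isometry_onto :: "(real ^ 'm \<Rightarrow> real ^ 'n) \<Rightarrow> (real ^ 'n) set \<Rightarrow> bool" where
  "isometry_onto \<phi> V \<longleftrightarrow> linear \<phi> \<and> (\<forall>u. norm (\<phi> u) = norm u) \<and> range \<phi> = V"

lemma code_half_orthogonal:
  assumes "x \<in> leech_code" "z \<in> code_half x"
  shows "x \<bullet> z = 0" "norm x = 1" "norm z = 1"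
proof -
  have unit: "norm y = 1" if "y \<in> leech_code" for y
    using that by (auto simp: leech_code_def norm_sgn)
  show nx: "norm x = 1" by (rule unit[OF assms(1)])
  then have xx: "x \<bullet> x = 1" by (simp add: norm_eq_1)
  from assms(2) obtain y where y: "y \<in> leech_code" "x \<bullet> y = 1 / 2"
    and z: "z = (1 / sqrt (1 - 1 / 4)) *\<^sub>R (y - (1 / 2) *\<^sub>R x)"
    by (auto simp: code_half_def)
  have yy: "y \<bullet> y = 1" using unit[OF y(1)] by (simp add: norm_eq_1)
  show "x \<bullet> z = 0" using y xx by (simp add: z inner_diff_right)
  have "(y - (1 / 2) *\<^sub>R x) \<bullet> (y - (1 / 2) *\<^sub>R x) = 3 / 4"
    using y xx yy by (simp add: inner_diff_right inner_diff_left inner_commute)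
  then have "z \<bullet> z = 1"
    by (simp add: z real_sqrt_divide)
  then show "norm z = 1" by (simp add: norm_eq_1)
qed

lemma ex_isometry_onto_complement:
  assumes "x \<in> leech_code" "z \<in> code_half x"
  shows "\<exists>\<phi> :: real ^ 22 \<Rightarrow> real ^ point. isometry_onto \<phi> {v. v \<bullet> x = 0 \<and> v \<bullet> z = 0}"
proof -
  let ?V = "{v. v \<bullet> x = 0 \<and> v \<bullet> z = 0}"
  note o = code_half_orthogonal[OF assms]
  have ne: "x \<noteq> z" "x \<noteq> 0" "z \<noteq> 0" using o by (auto simp: norm_eq_1)
  have "pairwise orthogonal {x, z}"
    using o by (auto simp: pairwise_def orthogonal_def inner_commute)
  then have "independent {x, z}"
    using ne by (intro pairwise_orthogonal_independent) auto
  then have d2: "dim {x, z} = 2"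
    using ne by (simp add: dim_eq_card_independent)
  have V: "?V = {y \<in> UNIV. \<forall>w \<in> span {x, z}. orthogonal w y}"
  proof (intro set_eqI iffI)
    fix v assume v: "v \<in> ?V"
    have "orthogonal w v" if "w \<in> span {x, z}" for w
    proof -
      have "orthogonal v w"
        by (rule orthogonal_to_span[OF that]) (use v in \<open>auto simp: orthogonal_def\<close>)
      then show ?thesis by (simp only: orthogonal_commute)
    qed
    then show "v \<in> {y \<in> UNIV. \<forall>w \<in> span {x, z}. orthogonal w y}" by blast
  next
    fix v assume "v \<in> {y \<in> UNIV. \<forall>w \<in> span {x, z}. orthogonal w y}"
    then have "orthogonal x v" "orthogonal z v"
      using span_base[of x "{x, z}"] span_base[of z "{x, z}"] by blast+
    then show "v \<in> ?V"
      by (simp add: orthogonal_def inner_commute)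
  qed
  have "dim ?V + dim (span {x, z}) = dim (UNIV :: (real ^ point) set)"
    unfolding V by (rule dim_subspace_orthogonal_to_vectors) auto
  then have "dim (UNIV :: (real ^ 22) set) = dim ?V"
    using d2 by simp
  moreover have "subspace ?V"
    by (auto simp: subspace_def inner_add_left)
  ultimately obtain f :: "real ^ 22 \<Rightarrow> real ^ point"
    where "linear f" "f ` UNIV = ?V" "\<And>u. u \<in> UNIV \<Longrightarrow> norm (f u) = norm u"
    using isometry_subspaces[of "UNIV :: (real ^ 22) set" ?V] by auto
  then show ?thesis unfolding isometry_onto_def by blast
qed

end

theory Submission
  imports Defs "HOL-Library.Option_ord"
begin

text \<open>
  Lower bound: a design contains some point \<open>x\<close>; summing over \<open>y\<close> a quintic \<open>f\<close> with \<open>f \<ge> 0\<close> outside the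
  forbidden interval gives \<open>f 1 \<le> \<Sum>y. f (x \<bullet> y) = card C * f\<^sub>0\<close>. The quintics are
  \<open>(t + 1) (t + 1/3)\<^sup>2 t (t - 1/3)\<close> and \<open>(t + 1) (t - 1/3)\<^sup>2 t (t + 1/3)\<close>.

  The code: if \<open>\<Sum>x\<in>C. \<Sum>y\<in>C. (x \<bullet> y) ^ k\<close> equals \<open>(card C)\<^sup>2\<close> times the \<open>k\<close>-th moment of the sphere, then a
  sum of squares vanishes and \<open>C\<close> averages all degree \<open>k\<close> monomials correctly. The extended Golay code has
  dual distance greater than 4, so its power moments determine its size and the number of octads through one
  or two points, and the sign changes by codewords reduce the second and fourth moments of the minimal
  vectors of the Leech lattice to these counts. As the inner products of distinct non-antipodal minimal
  vectors are \<open>0, \<plusminus>1/4, \<plusminus>1/2\<close>, the even power sums of inner products satisfy a linear recurrence, which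
  yields the moments of degree 6, 8 and 10. Comparing coefficients in the moments at \<open>u + s x\<close> with \<open>u\<close>
  orthogonal to \<open>x\<close> passes from the minimal vectors to the 4600-point code and then to the 2816-point code,
  with two degrees lost for each nonzero inner product (up to sign) that has to be separated. No
  transitivity of the automorphism group is needed.
\<close>

text \<open>The degrees are dictated by the end of the chain. By antipodality a 5-design in
  dimension 22 comes down to the moments of degree 2 and 4. On the 4600-point code the weight
  \<open>1 - 9 t^2\<close> singles out t = 0 among the inner products 0, -1/3, 1/3 with
  \<open>z\<close>, which calls for degree 6 there. On the minimal vectors the weight
  \<open>t^4 - t^2 / 16\<close> singles out |t| = 1/2 among 0, 1/4, 1/2, which calls for degree 10.
  The Golay code controls characters of at most four points, so direct computation stops at degree
  4. The recurrence then produces power sums at the minimal vectors themselves; that they agree with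
  the sphere is a numerical coincidence in dimension 24, and the equality case extends them to every
  vector \<open>u\<close>. Both weights are also nonzero at inner products 1 and -1. Hence the
  summed functions have to vanish at the centre and its antipode, and the cardinalities 4600 and
  2816 come from the constant function with these two points cut out.\<close>

section \<open>Moments of the sphere\<close>

text \<open>
  The sort \<open>wellorder\<close> of the index type is inherited from the invariance of Lebesgue measure under
  orthogonal maps in the library; \<open>Option_ord\<close> provides it for \<open>point\<close>.
\<close>

lemma distr_lborel_orthogonal:
  fixes g :: "real ^ 'n::{finite,wellorder} \<Rightarrow> real ^ 'n::_"
  assumes g: "orthogonal_transformation g"
  shows "distr lborel borel g = lborel"
proof (rule lborel_eqI[symmetric])
  have lin: "linear g" using g by (rule orthogonal_transformation_linear)
  then have [measurable]: "g \<in> borel_measurable borel"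
    by (intro borel_measurable_continuous_onI linear_continuous_on linear_linear[THEN iffD2])
  have bij: "bij g" using g by (rule orthogonal_transformation_bij)
  have inv: "orthogonal_transformation (inv g)" using g by (rule orthogonal_transformation_inv)
  fix l u :: "real ^ 'n::_" assume le: "\<And>b. b \<in> Basis \<Longrightarrow> l \<bullet> b \<le> u \<bullet> b"
  have eq: "g -` box l u = inv g ` box l u" by (simp add: bij bij_vimage_eq_inv_image)
  have lm: "box l u \<in> lmeasurable" by simp
  have "g -` box l u \<in> sets borel"
    by (metis measurable_sets_borel \<open>g \<in> borel_measurable borel\<close> borel_open open_box)
  then have "emeasure (distr lborel borel g) (box l u) = emeasure lborel (inv g ` box l u)"
    by (simp add: emeasure_distr eq)
  also have "\<dots> = emeasure lebesgue (inv g ` box l u)"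
    using \<open>g -` box l u \<in> sets borel\<close> eq by (simp add: emeasure_completion)
  also have "\<dots> = measure lebesgue (inv g ` box l u)"
    by (intro emeasure_eq_measure2 measurable_orthogonal_image[OF inv lm])
  also have "\<dots> = measure lebesgue (box l u)"
    using measure_orthogonal_image[OF inv lm] by simp
  also have "\<dots> = emeasure lebesgue (box l u)"
    by (intro emeasure_eq_measure2[symmetric] lm)
  also have "\<dots> = (\<Prod>b\<in>Basis. (u - l) \<bullet> b)"
    using le by (simp add: emeasure_lborel_box)
  finally show "emeasure (distr lborel borel g) (box l u) = (\<Prod>b\<in>Basis. (u - l) \<bullet> b)" .
qed simp

lemma sphere_measure_sets [simp]: "sets (sphere_measure :: 'a::euclidean_space measure) = sets borel"
  by (simp add: sphere_measure_def)

lemma sphere_measure_space [simp]: "space (sphere_measure :: 'a::euclidean_space measure) = UNIV"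
  by (simp add: sphere_measure_def)

lemma emeasure_cball_pos_finite:
  "emeasure lborel (cball (0::'a::euclidean_space) 1) \<noteq> 0" "emeasure lborel (cball (0::'a) 1) \<noteq> \<infinity>"
proof -
  show "emeasure lborel (cball (0::'a) 1) \<noteq> \<infinity>"
    using emeasure_bounded_finite[of "cball (0::'a) 1"] by simp
  have "0 < measure lborel (cball (0::'a) 1)" by (rule content_cball_pos) simp
  then show "emeasure lborel (cball (0::'a::euclidean_space) 1) \<noteq> 0"
    by (auto simp: measure_def)
qed

lemma emeasure_sphere_measure_UNIV:
  "emeasure (sphere_measure :: 'a::euclidean_space measure) UNIV = 1"
proof -
  have "emeasure (uniform_measure lborel (cball (0::'a) 1)) UNIV = 1"
    using emeasure_cball_pos_finite[where 'a='a]
    by (simp add: ennreal_divide_self top.not_eq_extremum)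
  then show ?thesis
    by (simp add: sphere_measure_def emeasure_distr)
qed

interpretation sphere_measure: finite_measure "sphere_measure :: 'a::euclidean_space measure"
  by standard (simp add: emeasure_sphere_measure_UNIV)

text \<open>As \<open>sgn 0 = 0\<close>, the centre of the ball is the only point not sent to the
  unit sphere, and it is a null set.\<close>

lemma AE_sphere_measure_norm: "AE w in (sphere_measure :: 'a::euclidean_space measure). norm w = 1"
proof -
  have "AE w in lborel. w \<noteq> (0::'a)"
    by (rule AE_I[of _ _ "{0}"]) auto
  then have "AE w in uniform_measure lborel (cball (0::'a) 1). norm (sgn w) = 1"
    by (intro AE_uniform_measureI) (auto simp: norm_sgn)
  then show ?thesis
    unfolding sphere_measure_def by (subst AE_distr_iff) auto
qed

lemma integrable_sphere_measure:
  fixes h :: "'a::euclidean_space \<Rightarrow> real"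
  assumes "continuous_on UNIV h"
  shows "integrable sphere_measure h"
proof -
  have "compact (h ` sphere 0 1)"
    by (intro compact_continuous_image continuous_on_subset[OF assms]) auto
  then obtain B where "\<And>x. x \<in> sphere 0 1 \<Longrightarrow> norm (h x) \<le> B"
    unfolding compact_eq_bounded_closed bounded_iff by (metis image_eqI)
  then have "AE w in sphere_measure. norm (h w) \<le> B"
    using AE_sphere_measure_norm by (auto elim!: eventually_mono)
  moreover have "h \<in> borel_measurable sphere_measure"
    using borel_measurable_continuous_onI[OF assms] by (simp cong: measurable_cong_sets)
  ultimately show ?thesis
    by (intro sphere_measure.integrable_const_bound[of _ B])
qed

text \<open>An orthogonal map preserves the ball and commutes with \<open>sgn\<close>, so the
  invariance of Lebesgue measure descends to its image on the sphere.\<close>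

lemma distr_sphere_measure_orthogonal:
  fixes g :: "real ^ 'n::{finite,wellorder} \<Rightarrow> real ^ 'n::_"
  assumes g: "orthogonal_transformation g"
  shows "distr sphere_measure borel g = sphere_measure"
proof -
  have [measurable]: "g \<in> borel_measurable borel"
    using g orthogonal_transformation_linear
    by (intro borel_measurable_continuous_onI linear_continuous_on linear_linear[THEN iffD2]) auto
  have gs: "sgn (g x) = g (sgn x)" for x
    using g by (simp add: sgn_div_norm orthogonal_transformation_norm
        linear_cmul[OF orthogonal_transformation_linear])
  have U: "distr (uniform_measure lborel (cball 0 1)) borel g = uniform_measure lborel (cball 0 1)"
    (is "distr ?U _ _ = _")
  proof (rule measure_eqI)
    fix A assume "A \<in> sets (distr ?U borel g)"
    then have [measurable]: "A \<in> sets borel" by simp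
    have gA: "g -` A \<in> sets borel"
      by (metis measurable_sets_borel \<open>A \<in> sets borel\<close> \<open>g \<in> borel_measurable borel\<close>)
    have "cball 0 1 \<inter> g -` A = g -` (cball 0 1 \<inter> A)"
      using g by (auto simp: orthogonal_transformation_norm)
    moreover have "emeasure lborel (g -` (cball 0 1 \<inter> A)) = emeasure (distr lborel borel g) (cball 0 1 \<inter> A)"
      by (subst emeasure_distr) auto
    ultimately show "emeasure (distr ?U borel g) A = emeasure ?U A"
      using gA by (simp add: emeasure_distr distr_lborel_orthogonal[OF g])
  qed simp
  have "distr sphere_measure borel g = distr ?U borel (g \<circ> sgn)"
    unfolding sphere_measure_def by (subst distr_distr) auto
  also have "g \<circ> sgn = sgn \<circ> g" by (auto simp: gs)
  also have "distr ?U borel (sgn \<circ> g) = distr (distr ?U borel g) borel sgn"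
    by (subst distr_distr) auto
  also have "\<dots> = sphere_measure" by (simp add: U sphere_measure_def)
  finally show ?thesis .
qed

lemma integral_sphere_measure_orthogonal:
  fixes g :: "real ^ 'n::{finite,wellorder} \<Rightarrow> real ^ 'n::_" and h :: "real ^ 'n::_ \<Rightarrow> real"
  assumes g: "orthogonal_transformation g" and h: "continuous_on UNIV h"
  shows "(LINT w|sphere_measure. h (g w)) = (LINT w|sphere_measure. h w)"
proof -
  have "g \<in> borel_measurable borel"
    using g orthogonal_transformation_linear
    by (intro borel_measurable_continuous_onI linear_continuous_on linear_linear[THEN iffD2]) auto
  then have "(LINT w|distr sphere_measure borel g. h w) = (LINT w|sphere_measure. h (g w))"
    using borel_measurable_continuous_onI[OF h]
    by (intro integral_distr) (auto cong: measurable_cong_sets)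
  then show ?thesis by (simp add: distr_sphere_measure_orthogonal[OF g])
qed

text \<open>By rotation invariance the choice of the coordinate \<open>undefined\<close> is immaterial.\<close>

definition sphere_moment :: "'n::finite itself \<Rightarrow> nat \<Rightarrow> real" where
  "sphere_moment _ k = (LINT w|(sphere_measure :: (real ^ 'n) measure). (w $ undefined) ^ k)"

text \<open>A rotation carries a multiple of a coordinate axis to \<open>u\<close>, so the integral
  sees only the norm of \<open>u\<close>. All moment information in degree \<open>k\<close> is thus
  one number.\<close>

lemma sphere_moment_inner:
  fixes u :: "real ^ 'n::{finite,wellorder}"
  shows "(LINT w|sphere_measure. (u \<bullet> w) ^ k) = sphere_moment TYPE('n) k * norm u ^ k"
proof -
  obtain g :: "real ^ 'n::_ \<Rightarrow> real ^ 'n::_" where g: "orthogonal_transformation g" "g (norm u *\<^sub>R axis undefined 1) = u"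
    by (rule orthogonal_transformation_exists[of "norm u *\<^sub>R axis undefined 1" u]) simp
  have "(LINT w|sphere_measure. (u \<bullet> w) ^ k) = (LINT w|sphere_measure. (u \<bullet> g w) ^ k)"
    by (rule integral_sphere_measure_orthogonal[OF g(1), symmetric]) (intro continuous_intros)
  also have "\<dots> = (LINT w|sphere_measure. ((norm u *\<^sub>R axis undefined 1) \<bullet> (w :: real ^ 'n::_)) ^ k)"
    using g by (metis orthogonal_transformation_def)
  also have "\<dots> = (LINT w|sphere_measure. norm u ^ k * ((w :: real ^ 'n::_) $ undefined) ^ k)"
    by (simp add: inner_axis' power_mult_distrib)
  finally show ?thesis by (simp add: sphere_moment_def)
qed

lemma sphere_moment_0 [simp]: "sphere_moment TYPE('n::finite) 0 = 1"
  using emeasure_sphere_measure_UNIV[where 'a="real ^ 'n"]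
  by (simp add: sphere_moment_def measure_def)

lemma sphere_moment_odd:
  assumes "odd k" shows "sphere_moment TYPE('n::{finite,wellorder}) k = 0"
proof -
  let ?u = "axis undefined 1 :: real ^ 'n::_"
  have "(LINT w|sphere_measure. (?u \<bullet> w) ^ k) = (LINT w|sphere_measure. ((- ?u) \<bullet> w) ^ k)"
    by (simp only: sphere_moment_inner norm_minus_cancel)
  also have "\<dots> = - (LINT w|sphere_measure. (?u \<bullet> w) ^ k)"
    using assms by (simp add: power_minus_odd)
  finally have "(LINT w|sphere_measure. (?u \<bullet> w) ^ k) = 0" by simp
  then show ?thesis by (simp only: sphere_moment_inner norm_axis_1) simp
qed

text \<open>Two polynomials in \<open>s\<close> that agree for every real \<open>s\<close> have the
  same coefficients. The sequence \<open>a\<close> is left abstract so that the lemma serves both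
  sums over a code and integrals over the sphere.\<close>

lemma even_power_form_coeffs:
  fixes a :: "nat \<Rightarrow> real"
  assumes eq: "\<And>s. (\<Sum>j\<le>2*m. real (2*m choose j) * a j * s ^ j) = c * (p + q * s\<^sup>2) ^ m"
    and "j \<le> m"
  shows "real (2*m choose (2*j)) * a (2*j) = c * real (m choose j) * p ^ (m - j) * q ^ j"
proof -
  let ?d = "\<lambda>i. if even i then c * real (m choose (i div 2)) * p ^ (m - i div 2) * q ^ (i div 2) else 0"
  have "(\<Sum>i\<le>2*m. ?d i * s ^ i) = c * (p + q * s\<^sup>2) ^ m" for s
  proof -
    have "(\<Sum>i\<le>2*m. ?d i * s ^ i) = (\<Sum>i | i \<le> 2*m \<and> even i. ?d i * s ^ i)"
      by (rule sum.mono_neutral_right) auto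
    also have "\<dots> = (\<Sum>j\<le>m. ?d (2*j) * s ^ (2*j))"
      by (rule sum.reindex_bij_witness[of _ "\<lambda>j. 2*j" "\<lambda>i. i div 2"]) auto
    also have "\<dots> = c * (\<Sum>j\<le>m. real (m choose j) * (q * s\<^sup>2) ^ j * p ^ (m - j))"
      by (simp add: sum_distrib_left power_mult_distrib mult_ac flip: power_mult)
    also have "\<dots> = c * (p + q * s\<^sup>2) ^ m"
      by (simp add: binomial_ring[of "q * s\<^sup>2" p] add.commute[of p])
    finally show ?thesis .
  qed
  then have "\<forall>s. (\<Sum>j\<le>2*m. (real (2*m choose j) * a j) * s ^ j) = (\<Sum>i\<le>2*m. ?d i * s ^ i)"
    using eq by simp
  then have "\<forall>i\<le>2*m. real (2*m choose i) * a i = ?d i"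
    by (simp only: polyfun_eq_coeffs)
  from this[rule_format, of "2*j"] show ?thesis using assms(2) by simp
qed

text \<open>Polarisation: orthogonality turns the squared norm of \<open>u + s *\<^sub>R v\<close>
  into a quadratic without linear term, and the coefficient of \<open>s ^ (2*j)\<close> is the mixed
  moment. The moment formula is assumed along this one line only, so the lemma also applies to a
  code whose moments are known just on a subspace.\<close>

lemma mixed_moment_sum:
  fixes u v :: "'a::real_inner"
  assumes "\<And>s. (\<Sum>y\<in>C. ((u + s *\<^sub>R v) \<bullet> y) ^ (2*m)) = c * norm (u + s *\<^sub>R v) ^ (2*m)"
    and uv: "u \<bullet> v = 0" and "j \<le> m"
  shows "real (2*m choose (2*j)) * (\<Sum>y\<in>C. (u \<bullet> y) ^ (2*m - 2*j) * (v \<bullet> y) ^ (2*j)) =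
         c * real (m choose j) * norm u ^ (2*(m - j)) * norm v ^ (2*j)"
proof -
  have "real (2*m choose (2*j)) * (\<Sum>y\<in>C. (u \<bullet> y) ^ (2*m - 2*j) * (v \<bullet> y) ^ (2*j)) =
         c * real (m choose j) * ((norm u)\<^sup>2) ^ (m - j) * ((norm v)\<^sup>2) ^ j"
  proof (rule even_power_form_coeffs[OF _ \<open>j \<le> m\<close>])
    fix s
    have "(\<Sum>y\<in>C. ((u + s *\<^sub>R v) \<bullet> y) ^ (2*m)) =
      (\<Sum>y\<in>C. \<Sum>j\<le>2*m. real (2*m choose j) * (s * (v \<bullet> y)) ^ j * (u \<bullet> y) ^ (2*m - j))"
      by (simp add: inner_add_left add.commute[of "u \<bullet> _"] binomial_ring)
    also have "\<dots> = (\<Sum>j\<le>2*m. real (2*m choose j) * (\<Sum>y\<in>C. (u \<bullet> y) ^ (2*m - j) * (v \<bullet> y) ^ j) * s ^ j)"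
      by (subst sum.swap) (simp add: sum_distrib_left sum_distrib_right power_mult_distrib mult_ac)
    finally have "(\<Sum>j\<le>2*m. real (2*m choose j) * (\<Sum>y\<in>C. (u \<bullet> y) ^ (2*m - j) * (v \<bullet> y) ^ j) * s ^ j) =
      c * ((norm (u + s *\<^sub>R v))\<^sup>2) ^ m"
      using assms(1)[of s] by (simp add: power_mult)
    also have "(norm (u + s *\<^sub>R v))\<^sup>2 = (norm u)\<^sup>2 + (norm v)\<^sup>2 * s\<^sup>2"
      unfolding power2_norm_eq_inner
      using uv by (simp add: inner_add_left inner_add_right inner_commute power2_eq_square)
    finally show "(\<Sum>j\<le>2*m. real (2*m choose j) * (\<Sum>y\<in>C. (u \<bullet> y) ^ (2*m - j) * (v \<bullet> y) ^ j) * s ^ j) =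
      c * ((norm u)\<^sup>2 + (norm v)\<^sup>2 * s\<^sup>2) ^ m" .
  qed
  then show ?thesis by (simp add: power_mult)
qed

text \<open>Insert the sum of the squared coordinates, which is 1 almost everywhere, into the moment
  of degree \<open>2*m\<close>. The distinguished coordinate gives the moment of degree
  \<open>2*m + 2\<close>, and by polarisation each of the other \<open>CARD('n) - 1\<close>
  coordinates gives that moment divided by \<open>2*m + 1\<close>.\<close>

lemma sphere_moment_Suc_Suc:
  "(real CARD('n) + 2 * real m) * sphere_moment TYPE('n::{finite,wellorder}) (2*m + 2) =
   (2 * real m + 1) * sphere_moment TYPE('n) (2*m)"
proof -
  define e :: "'n \<Rightarrow> real ^ 'n::_" where "e i = axis i 1" for i
  let ?M = "sphere_moment TYPE('n)" and ?o = "undefined :: 'n"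
  have mixed: "real (2*(m+1) choose 2) * (LINT w|sphere_measure. (e ?o \<bullet> w) ^ (2*(m+1) - 2) * (e i \<bullet> w) ^ 2) =
      ?M (2*(m+1)) * real ((m+1) choose 1) * 1 ^ (m+1-1) * 1 ^ 1" if "i \<noteq> ?o" for i
  proof (rule even_power_form_coeffs[where j=1 and m="m+1" and
      a="\<lambda>j. LINT w|sphere_measure. (e ?o \<bullet> w) ^ (2*(m+1) - j) * (e i \<bullet> w) ^ j", simplified mult_1_right])
    fix s
    have "(norm (e ?o + s *\<^sub>R e i))\<^sup>2 = 1 + 1 * s\<^sup>2"
      unfolding power2_norm_eq_inner
      using that by (simp add: e_def inner_add_left inner_add_right inner_axis_axis power2_eq_square)
    then have "?M (2*(m+1)) * (1 + 1 * s\<^sup>2) ^ (m+1) = (LINT w|sphere_measure. ((e ?o + s *\<^sub>R e i) \<bullet> w) ^ (2*(m+1)))"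
      by (simp only: sphere_moment_inner power_mult[of "norm (e ?o + s *\<^sub>R e i)"])
    also have "\<dots> = (LINT w|sphere_measure. (\<Sum>j\<le>2*(m+1). real (2*(m+1) choose j) * s ^ j * ((e ?o \<bullet> w) ^ (2*(m+1) - j) * (e i \<bullet> w) ^ j)))"
      by (simp only: inner_add_left inner_scaleR_left add.commute[of "e ?o \<bullet> _"] binomial_ring power_mult_distrib mult_ac)
    also have "\<dots> = (\<Sum>j\<le>2*(m+1). real (2*(m+1) choose j) * s ^ j * (LINT w|sphere_measure. (e ?o \<bullet> w) ^ (2*(m+1) - j) * (e i \<bullet> w) ^ j))"
      by (subst Bochner_Integration.integral_sum)
         (auto intro!: integrable_sphere_measure continuous_intros)
    finally show "(\<Sum>j\<le>2 * (m + 1). real (2 * (m + 1) choose j) *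
          (LINT w|sphere_measure. (e ?o \<bullet> w) ^ (2 * (m + 1) - j) * (e i \<bullet> w) ^ j) * s ^ j) =
         ?M (2 * (m + 1)) * (1 + 1 * s\<^sup>2) ^ (m + 1)"
      by (simp add: mult_ac)
  qed simp
  have ch: "real (2*(m+1) choose 2) = (real m + 1) * (2 * real m + 1)"
    by (simp add: choose_two algebra_simps)
  have I: "(2 * real m + 1) * (LINT w|sphere_measure. (e ?o \<bullet> w) ^ (2*m) * (w $ i) ^ 2) = ?M (2*m+2)" if "i \<noteq> ?o" for i
  proof -
    have "(real m + 1) * ((2 * real m + 1) * (LINT w|sphere_measure. (e ?o \<bullet> w) ^ (2*m) * (w $ i) ^ 2)) = (real m + 1) * ?M (2*m+2)"
      using mixed[OF that] unfolding ch by (simp add: e_def inner_axis' algebra_simps)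
    then show ?thesis by simp
  qed
  have "?M (2*m) = (LINT w|sphere_measure. (e ?o \<bullet> w) ^ (2*m))"
    by (simp add: sphere_moment_inner e_def)
  also have "\<dots> = (LINT w|sphere_measure. (\<Sum>i\<in>UNIV. (e ?o \<bullet> w) ^ (2*m) * (w $ i) ^ 2))"
  proof (rule integral_cong_AE)
    show "AE w in sphere_measure. (e ?o \<bullet> w) ^ (2*m) = (\<Sum>i\<in>UNIV. (e ?o \<bullet> w) ^ (2*m) * (w $ i) ^ 2)"
      using AE_sphere_measure_norm
    proof eventually_elim
      case (elim w)
      have "(\<Sum>i\<in>UNIV. (w $ i) ^ 2) = w \<bullet> w" by (simp add: inner_vec_def power2_eq_square)
      then show ?case using elim by (simp flip: sum_distrib_left power2_norm_eq_inner)
    qed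
  qed (auto intro!: borel_measurable_integrable integrable_sphere_measure continuous_intros)
  also have "\<dots> = (\<Sum>i\<in>UNIV. LINT w|sphere_measure. (e ?o \<bullet> w) ^ (2*m) * (w $ i) ^ 2)"
    by (intro Bochner_Integration.integral_sum integrable_sphere_measure continuous_intros)
  finally have "(2 * real m + 1) * ?M (2*m) = (\<Sum>i\<in>UNIV. (2 * real m + 1) * (LINT w|sphere_measure. (e ?o \<bullet> w) ^ (2*m) * (w $ i) ^ 2))"
    by (simp add: sum_distrib_left)
  also have "\<dots> = (2 * real m + 1) * (LINT w|sphere_measure. (e ?o \<bullet> w) ^ (2*m) * (w $ ?o) ^ 2) + (\<Sum>i\<in>UNIV - {?o}. ?M (2*m+2))"
    by (subst sum.remove[of UNIV ?o]) (auto simp: I)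
  also have "(LINT w|sphere_measure. (e ?o \<bullet> w) ^ (2*m) * (w $ ?o) ^ 2) = ?M (2*m+2)"
    by (simp only: sphere_moment_def e_def inner_axis' inner_real_def mult_1_left power_add)
  finally show ?thesis by (simp add: card_Diff_singleton of_nat_diff algebra_simps)
qed

text \<open>Monomials of degree \<open>k\<close> are indexed by words \<open>f\<close> of
  coordinates. A monomial then occurs once for each of its orderings, and the multinomial
  coefficients never have to be written.\<close>

lemma inner_power_expand:
  fixes u y :: "real ^ 'n"
  shows "(u \<bullet> y) ^ k = (\<Sum>f\<in>{..<k} \<rightarrow>\<^sub>E UNIV. (\<Prod>j<k. u $ f j) * (\<Prod>j<k. y $ f j))"
proof -
  have "(u \<bullet> y) ^ k = (\<Prod>j<k. \<Sum>i\<in>UNIV. u $ i * y $ i)"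
    by (simp add: inner_vec_def)
  also have "\<dots> = (\<Sum>f\<in>{..<k} \<rightarrow>\<^sub>E UNIV. \<Prod>j<k. u $ f j * y $ f j)"
    by (rule prod_sum_PiE) auto
  finally show ?thesis by (simp add: prod.distrib)
qed

text \<open>
  The sum of the squares of the defects of all degree \<open>k\<close> monomials is
  \<open>(\<Sum>x\<in>C. \<Sum>y\<in>C. (x \<bullet> y) ^ k) - (card C)\<^sup>2 * sphere_moment k\<close>.
\<close>

lemma sidelnikov_equality:
  fixes C :: "(real ^ 'n::{finite,wellorder}) set"
  assumes C: "C \<subseteq> sphere 0 1"
    and eq: "(\<Sum>x\<in>C. \<Sum>y\<in>C. (x \<bullet> y) ^ k) = (real (card C))\<^sup>2 * sphere_moment TYPE('n) k"
    and f: "f \<in> {..<k} \<rightarrow>\<^sub>E UNIV"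
  shows "(\<Sum>y\<in>C. \<Prod>j<k. y $ f j) = real (card C) * (LINT w|sphere_measure. (\<Prod>j<k. w $ f j))"
proof -
  let ?F = "{..<k} \<rightarrow>\<^sub>E (UNIV :: 'n set)" and ?N = "real (card C)" and ?M = "sphere_moment TYPE('n) k"
  define A where "A f = (\<Sum>y\<in>C. \<Prod>j<k. y $ f j)" for f :: "nat \<Rightarrow> 'n"
  define B where "B f = (LINT w|sphere_measure. (\<Prod>j<k. (w :: real ^ 'n::_) $ f j))" for f :: "nat \<Rightarrow> 'n"
  have fin: "finite ?F" by (intro finite_PiE) auto
  have AA: "(\<Sum>f\<in>?F. A f * A f) = (\<Sum>x\<in>C. \<Sum>y\<in>C. (x \<bullet> y) ^ k)"
    unfolding A_def inner_power_expand sum_product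
    by (simp only: sum.swap[of _ C ?F])
  have intB: "(\<Sum>f\<in>?F. (\<Prod>j<k. u $ f j) * B f) = ?M * norm u ^ k" for u :: "real ^ 'n::_"
  proof -
    have "(\<Sum>f\<in>?F. (\<Prod>j<k. u $ f j) * B f) = (LINT w|sphere_measure. (\<Sum>f\<in>?F. (\<Prod>j<k. u $ f j) * (\<Prod>j<k. w $ f j)))"
      unfolding B_def
      by (subst Bochner_Integration.integral_sum)
         (auto intro!: integrable_sphere_measure continuous_intros)
    then show ?thesis by (simp only: inner_power_expand[symmetric] sphere_moment_inner)
  qed
  have AB: "(\<Sum>f\<in>?F. A f * B f) = ?N * ?M"
  proof -
    have "(\<Sum>f\<in>?F. A f * B f) = (\<Sum>y\<in>C. \<Sum>f\<in>?F. (\<Prod>j<k. y $ f j) * B f)"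
      unfolding A_def sum_distrib_right by (rule sum.swap)
    also have "\<dots> = (\<Sum>y\<in>C. ?M)"
      using C by (intro sum.cong) (auto simp: intB)
    finally show ?thesis by simp
  qed
  have BB: "(\<Sum>f\<in>?F. B f * B f) = ?M"
  proof -
    have "(\<Sum>f\<in>?F. B f * B f) = (LINT w|sphere_measure. (\<Sum>f\<in>?F. (\<Prod>j<k. w $ f j) * B f))"
      by (subst Bochner_Integration.integral_sum)
         (auto simp: B_def[symmetric] intro!: integrable_sphere_measure continuous_intros)
    also have "\<dots> = (LINT w|(sphere_measure :: (real ^ 'n::_) measure). ?M)"
    proof (rule integral_cong_AE)
      show "AE w in sphere_measure. (\<Sum>f\<in>?F. (\<Prod>j<k. w $ f j) * B f) = ?M"
        using AE_sphere_measure_norm by eventually_elim (simp add: intB)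
    qed (auto intro!: borel_measurable_integrable integrable_sphere_measure continuous_intros)
    finally show ?thesis
      using emeasure_sphere_measure_UNIV[where 'a="real ^ 'n::_"] by (simp add: measure_def)
  qed
  \<comment> \<open>With \<open>AA\<close>, \<open>AB\<close>, \<open>BB\<close> the three terms are
    N^2 M, -2 N (N M) and N^2 M.\<close>
  have "(\<Sum>f\<in>?F. (A f - ?N * B f)\<^sup>2) = (\<Sum>f\<in>?F. A f * A f) - 2 * ?N * (\<Sum>f\<in>?F. A f * B f) + ?N\<^sup>2 * (\<Sum>f\<in>?F. B f * B f)"
    by (simp add: power2_eq_square algebra_simps sum.distrib sum_subtractf sum_distrib_left)
  also have "\<dots> = 0"
    unfolding AA AB BB eq by (simp add: power2_eq_square)
  finally have "\<forall>f\<in>?F. (A f - ?N * B f)\<^sup>2 = 0"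
    using fin by (subst (asm) sum_nonneg_eq_0_iff) auto
  then show ?thesis using f by (simp add: A_def B_def)
qed

corollary sidelnikov_equality_moments:
  fixes C :: "(real ^ 'n::{finite,wellorder}) set"
  assumes "C \<subseteq> sphere 0 1"
    and "(\<Sum>x\<in>C. \<Sum>y\<in>C. (x \<bullet> y) ^ k) = (real (card C))\<^sup>2 * sphere_moment TYPE('n) k"
  shows "(\<Sum>y\<in>C. (u \<bullet> y) ^ k) = real (card C) * sphere_moment TYPE('n) k * norm u ^ k"
proof -
  let ?F = "{..<k} \<rightarrow>\<^sub>E (UNIV :: 'n set)"
  have "(\<Sum>y\<in>C. (u \<bullet> y) ^ k) = (\<Sum>f\<in>?F. (\<Prod>j<k. u $ f j) * (\<Sum>y\<in>C. \<Prod>j<k. y $ f j))"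
    unfolding inner_power_expand sum_distrib_left by (rule sum.swap)
  also have "\<dots> = (\<Sum>f\<in>?F. (\<Prod>j<k. u $ f j) * (real (card C) * (LINT w|sphere_measure. (\<Prod>j<k. w $ f j))))"
    by (intro sum.cong refl arg_cong2[where f="(*)"] sidelnikov_equality assms)
  also have "\<dots> = real (card C) * (LINT w|sphere_measure. (\<Sum>f\<in>?F. (\<Prod>j<k. u $ f j) * (\<Prod>j<k. w $ f j)))"
    by (subst Bochner_Integration.integral_sum)
       (auto simp: sum_distrib_left mult_ac intro!: integrable_sphere_measure continuous_intros)
  also have "\<dots> = real (card C) * sphere_moment TYPE('n) k * norm u ^ k"
    by (simp only: inner_power_expand[symmetric] sphere_moment_inner mult.assoc)
  finally show ?thesis .
qed

section \<open>Squares modulo 23\<close>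

text \<open>Zero counts as a square, as it does in \<open>golay_generator\<close>. The explicit list
  makes the predicate executable on integers.\<close>

definition square_mod_23 :: "int \<Rightarrow> bool" where
  "square_mod_23 i \<longleftrightarrow> i mod 23 \<in> {0, 1, 2, 3, 4, 6, 8, 9, 12, 13, 16, 18}"

lemma of_int_23_eq_iff: "(of_int i :: 23) = of_int j \<longleftrightarrow> i mod 23 = j mod 23"
proof -
  have "of_int i = (Abs_bit1' i :: 23)" for i
    by (simp add: bit1.of_int_eq Abs_bit1'_def)
  moreover have "(Abs_bit1' i :: 23) = Abs_bit1' j \<longleftrightarrow> i mod 23 = j mod 23"
    unfolding Abs_bit1'_def by (subst Abs_bit1_inject) auto
  ultimately show ?thesis by simp
qed

lemma ex_of_int_23:
  obtains i where "(t::23) = of_int i" "0 \<le> i" "i < 23"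
  by (cases t rule: bit1_cases) auto

lemma square_mod_23_iff: "(\<exists>a::23. of_int i = a\<^sup>2) \<longleftrightarrow> square_mod_23 i"
proof -
  have "(\<exists>a::23. of_int i = a\<^sup>2) \<longleftrightarrow> (\<exists>j\<in>set [0..22]. of_int i = (of_int j :: 23)\<^sup>2)"
  proof
    assume "\<exists>a::23. of_int i = a\<^sup>2"
    then obtain a :: 23 where a: "of_int i = a\<^sup>2" ..
    obtain j where "a = of_int j" "0 \<le> j" "j < 23" by (rule ex_of_int_23)
    with a show "\<exists>j\<in>set [0..22]. of_int i = (of_int j :: 23)\<^sup>2" by auto
  qed blast
  also have "\<dots> \<longleftrightarrow> (\<exists>j\<in>set [0..22]. i mod 23 = j\<^sup>2 mod 23)"
    by (simp only: of_int_power[symmetric] of_int_23_eq_iff)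
  also have "\<dots> \<longleftrightarrow> i mod 23 \<in> (\<lambda>j. j\<^sup>2 mod 23) ` set [0..22]" by blast
  also have "(\<lambda>j. j\<^sup>2 mod 23) ` set [0..22] = {0, 1, 2, 3, 4, 6, 8, 9, 12, 13, 16, 18 :: int}"
    by code_simp
  also have "i mod 23 \<in> \<dots> \<longleftrightarrow> square_mod_23 i" by (simp only: square_mod_23_def)
  finally show ?thesis .
qed

section \<open>Parity of the number of squares in translates of small sets\<close>

definition square_row :: "int \<Rightarrow> bool list" where
  "square_row t = map (\<lambda>k. square_mod_23 (t + k)) [0..22]"

text \<open>Looks for a column in which an odd number of the four rows is true: the nested
  inequalities are exclusive or. Sets with fewer than four elements are padded with constantly false
  rows.\<close>

fun some_odd :: "bool list \<Rightarrow> bool list \<Rightarrow> bool list \<Rightarrow> bool list \<Rightarrow> bool" where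
  "some_odd (a # as) (b # bs) (c # cs) (d # ds) =
     (if (a \<noteq> b) \<noteq> (c \<noteq> d) then True else some_odd as bs cs ds)"
| "some_odd _ _ _ _ = False"

fun odd_triples :: "bool list \<Rightarrow> bool list \<Rightarrow> bool list list \<Rightarrow> bool" where
  "odd_triples r a (b # rs) = (if list_all (some_odd r a b) rs then odd_triples r a rs else False)"
| "odd_triples r a [] = True"

fun odd_quads :: "bool list \<Rightarrow> bool list list \<Rightarrow> bool" where
  "odd_quads r (a # rs) = (if odd_triples r a rs then odd_quads r rs else False)"
| "odd_quads r [] = True"

lemma some_odd_map_iff:
  "some_odd (map f xs) (map g xs) (map h xs) (map l xs) \<longleftrightarrow>
     (\<exists>x\<in>set xs. (f x \<noteq> g x) \<noteq> (h x \<noteq> l x))"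
proof (induction xs)
  case (Cons x xs)
  show ?case
    unfolding list.map some_odd.simps list.set bex_simps(5) Cons.IH by (rule if_bool_eq_disj[THEN trans]) blast
qed simp

lemma odd_triplesD:
  assumes "odd_triples r a (map f xs)" "sorted_wrt (<) xs" "b \<in> set xs" "d \<in> set xs" "b < d"
  shows "some_odd r a (f b) (f (d :: int))"
  using assms
proof (induction xs)
  case (Cons x xs)
  have h: "list_all (some_odd r a (f x)) (map f xs)" "odd_triples r a (map f xs)"
    using Cons.prems(1) by (simp_all split: if_splits)
  have "d \<in> set xs" using Cons.prems by (metis less_asym set_ConsD sorted_wrt.simps(2) less_irrefl)
  show ?case
  proof (cases "b = x")
    case True
    then show ?thesis using h(1) \<open>d \<in> set xs\<close> by (simp add: list_all_iff)
  next
    case False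
    then show ?thesis using Cons.IH[OF h(2)] Cons.prems \<open>d \<in> set xs\<close> by simp
  qed
qed simp

lemma odd_quadsD:
  assumes "odd_quads r (map f xs)" "sorted_wrt (<) xs"
    "a \<in> set xs" "b \<in> set xs" "d \<in> set xs" "a < b" "b < d"
  shows "some_odd r (f a) (f b) (f (d :: int))"
  using assms
proof (induction xs)
  case (Cons x xs)
  have h: "odd_triples r (f x) (map f xs)" "odd_quads r (map f xs)"
    using Cons.prems(1) by (simp_all split: if_splits)
  have mem: "b \<in> set xs" "d \<in> set xs"
    using Cons.prems by (metis less_asym set_ConsD sorted_wrt.simps(2) less_irrefl less_trans)+
  show ?case
  proof (cases "a = x")
    case True
    then show ?thesis using odd_triplesD[OF h(1)] Cons.prems mem by simp
  next
    case False
    then show ?thesis using Cons.IH[OF h(2)] Cons.prems mem by simp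
  qed
qed simp

text \<open>
  After a translation by one of its elements, a set of one to four residues consists of 0 and at most three
  elements of \<open>{1..22}\<close>. The evaluations say that some further translate contains an odd number of
  squares; this is what gives the Golay code its dual distance.
\<close>

lemma square_rows:
  defines "F \<equiv> map (\<lambda>_. False) [0..22]"
  shows "some_odd (square_row 0) F F F"
    and "list_all (\<lambda>r. some_odd (square_row 0) F F r) (map square_row [1..22])"
    and "odd_triples (square_row 0) F (map square_row [1..22])"
    and "odd_quads (square_row 0) (map square_row [1..22])"
  unfolding F_def by code_simp+

text \<open>The residue 0 is counted on the right-hand side: after translation by \<open>k\<close>
  it contributes \<open>square_mod_23 k\<close>. The equation says that 0 and \<open>U\<close>
  together contain an odd number of squares after this translation.\<close>

lemma ex_odd_square_shifts_int:
  assumes U: "U \<subseteq> {1..22}" "card U \<le> 3"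
  shows "\<exists>k. even (card {u \<in> U. square_mod_23 (u + k)}) = square_mod_23 k"
proof -
  define xs where "xs = sorted_list_of_set U"
  have "finite U" using U(1) finite_subset by blast
  then have xs: "set xs = U" "sorted_wrt (<) xs" "length xs = card U"
    by (simp_all add: xs_def strict_sorted_iff)
  then have "distinct xs" by (simp add: strict_sorted_iff)
  then have len: "card {u \<in> U. square_mod_23 (u + k)} = length (filter (\<lambda>u. square_mod_23 (u + k)) xs)" for k
    by (subst distinct_length_filter) (auto simp: xs(1) intro: arg_cong[of _ _ card])
  have sorted: "sorted_wrt (<) [1..22::int]" by simp
  have cases: "xs = [] \<or> (\<exists>a. xs = [a]) \<or> (\<exists>a b. xs = [a, b]) \<or> (\<exists>a b d. xs = [a, b, d])"
    using U(2) xs(3) by (auto simp: length_Suc_conv numeral_3_eq_3 le_Suc_eq)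
  \<comment> \<open>Each length of \<open>xs\<close> is settled by one of the four evaluations in
    \<open>square_rows\<close>, with false rows in the empty places.\<close>
  consider "xs = []" | a where "xs = [a]" | a b where "xs = [a, b]" | a b d where "xs = [a, b, d]"
    using cases by blast
  then show ?thesis
  proof cases
    case 1
    then show ?thesis using square_rows(1)
      unfolding len square_row_def some_odd_map_iff by auto
  next
    case 2
    then have "some_odd (square_row 0) (map (\<lambda>_. False) [0..22]) (map (\<lambda>_. False) [0..22]) (square_row a)"
      using square_rows(2) xs(1) U(1) by (auto simp: list_all_iff)
    then show ?thesis
      unfolding len square_row_def some_odd_map_iff using 2 by auto
  next
    case 3
    then have "some_odd (square_row 0) (map (\<lambda>_. False) [0..22]) (square_row a) (square_row b)"
      using xs(1,2) U(1) by (intro odd_triplesD[OF square_rows(3) sorted]) auto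
    then show ?thesis
      unfolding len square_row_def some_odd_map_iff using 3 by auto
  next
    case 4
    then have "some_odd (square_row 0) (square_row a) (square_row b) (square_row d)"
      using xs(1,2) U(1) by (intro odd_quadsD[OF square_rows(4) sorted]) auto
    then show ?thesis
      unfolding len square_row_def some_odd_map_iff using 4 by auto
  qed
qed

lemma of_int_23_bij: "bij_betw (\<lambda>i. of_int i + c :: 23) {0..22} UNIV"
proof (rule bij_betw_imageI)
  show "inj_on (\<lambda>i. of_int i + c :: 23) {0..22}"
    by (auto simp: inj_on_def of_int_23_eq_iff)
  show "(\<lambda>i. of_int i + c :: 23) ` {0..22} = UNIV"
  proof (intro set_eqI iffI UNIV_I)
    fix t :: 23
    obtain i where "t - c = of_int i" "0 \<le> i" "i < 23" by (rule ex_of_int_23)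
    then show "t \<in> (\<lambda>i. of_int i + c) ` {0..22}"
      by (intro image_eqI[of _ _ i]) (auto simp: algebra_simps)
  qed
qed

text \<open>The offset \<open>c\<close> is free, so a caller can centre the enumeration where its
  predicate becomes one on plain integers.\<close>

lemma card_23_filter: "card {y::23. P y} = length (filter (\<lambda>i. P (of_int i + c)) [0..22])"
proof -
  let ?f = "\<lambda>i. of_int i + c :: 23"
  have f: "inj_on ?f {0..22}" "?f ` {0..22} = UNIV" using of_int_23_bij[of c] by (auto simp: bij_betw_def)
  have "{y. P y} = ?f ` {i \<in> {0..22}. P (?f i)}"
  proof (intro set_eqI iffI)
    fix y assume "y \<in> {y. P y}"
    moreover obtain i where "i \<in> {0..22}" "y = ?f i" using f(2) by blast
    ultimately show "y \<in> ?f ` {i \<in> {0..22}. P (?f i)}" by blast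
  qed blast
  moreover have "inj_on ?f {i \<in> {0..22}. P (?f i)}" by (rule inj_on_subset[OF f(1)]) auto
  ultimately have "card {i \<in> {0..22}. P (of_int i + c)} = card {y::23. P y}"
    by (simp add: card_image)
  moreover have "{i \<in> {0..22}. P (of_int i + c)} = {i. P (of_int i + c)} \<inter> set [0..22]" by auto
  ultimately show ?thesis
    by (subst distinct_length_filter) auto
qed

lemma ex_odd_square_shifts:
  assumes "T \<noteq> ({} :: 23 set)" "card T \<le> 4"
  shows "\<exists>c. odd (card {t \<in> T. \<exists>a. t - c = a\<^sup>2})"
proof -
  obtain s where s: "s \<in> T" using assms by blast
  define U where "U = {u \<in> {1..22::int}. of_int u + s \<in> T}"
  have inj: "inj_on (\<lambda>u. of_int u + s) U"
    using of_int_23_bij[of s] unfolding bij_betw_def by (rule inj_on_subset[OF conjunct1]) (auto simp: U_def)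
  have TU: "T = insert s ((\<lambda>u. of_int u + s) ` U)"
  proof (intro set_eqI iffI)
    fix t assume t: "t \<in> T"
    obtain i where i: "t - s = of_int i" "0 \<le> i" "i < 23" by (rule ex_of_int_23)
    then have ti: "t = of_int i + s" by (simp add: algebra_simps)
    show "t \<in> insert s ((\<lambda>u. of_int u + s) ` U)"
    proof (cases "i = 0")
      case False
      then have "i \<in> U" using i t ti by (auto simp: U_def)
      then show ?thesis using ti by blast
    qed (use ti in auto)
  qed (use s in \<open>auto simp: U_def\<close>)
  have sU: "s \<notin> (\<lambda>u. of_int u + s) ` U"
  proof
    assume "s \<in> (\<lambda>u. of_int u + s) ` U"
    then obtain u where u: "u \<in> U" "(of_int u :: 23) = of_int 0" by auto
    then show False unfolding of_int_23_eq_iff by (auto simp: U_def)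
  qed
  have "finite U" by (rule finite_subset[of _ "{1..22}"]) (auto simp: U_def)
  then have "card T = Suc (card U)"
    by (subst TU) (simp add: sU card_image[OF inj])
  then have "card U \<le> 3" using assms by simp
  moreover have "U \<subseteq> {1..22}" by (auto simp: U_def)
  ultimately obtain k where k: "even (card {u \<in> U. square_mod_23 (u + k)}) = square_mod_23 k"
    using ex_odd_square_shifts_int by blast
  \<comment> \<open>With this choice \<open>s - c\<close> is \<open>k\<close> and
    \<open>of_int u + s - c\<close> is \<open>u + k\<close>, the residues tested by the integer
    lemma.\<close>
  define c where "c = s - of_int k"
  have sq: "(\<exists>a. of_int u + s - c = a\<^sup>2) \<longleftrightarrow> square_mod_23 (u + k)" for u
    using square_mod_23_iff[of "u + k"] by (simp add: c_def)
  have "{t \<in> (\<lambda>u. of_int u + s) ` U. \<exists>a. t - c = a\<^sup>2} =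
      (\<lambda>u. of_int u + s) ` {u \<in> U. \<exists>a. of_int u + s - c = a\<^sup>2}" by auto
  then have "{t \<in> (\<lambda>u. of_int u + s) ` U. \<exists>a. t - c = a\<^sup>2} = (\<lambda>u. of_int u + s) ` {u \<in> U. square_mod_23 (u + k)}"
    by (simp only: sq)
  then have card1: "card {t \<in> (\<lambda>u. of_int u + s) ` U. \<exists>a. t - c = a\<^sup>2} = card {u \<in> U. square_mod_23 (u + k)}"
    by (metis (no_types, lifting) card_image inj inj_on_subset mem_Collect_eq subsetI)
  have sq0: "(\<exists>a. s - c = a\<^sup>2) \<longleftrightarrow> square_mod_23 k" using sq[of 0] by simp
  have split: "{t \<in> T. \<exists>a. t - c = a\<^sup>2} =
    (if square_mod_23 k then {s} else {}) \<union> {t \<in> (\<lambda>u. of_int u + s) ` U. \<exists>a. t - c = a\<^sup>2}"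
    using sq0 by (subst TU) auto
  have "card {t \<in> T. \<exists>a. t - c = a\<^sup>2} = (if square_mod_23 k then 1 else 0) + card {u \<in> U. square_mod_23 (u + k)}"
    unfolding split using sU by (subst card_Un_disjoint) (auto simp: card1)
  then have "odd (card {t \<in> T. \<exists>a. t - c = a\<^sup>2})"
    using k by (auto split: if_splits)
  then show ?thesis ..
qed

section \<open>The extended Golay code\<close>

lemma card_sym_diff:
  fixes A B :: "'a::finite set"
  shows "card (sym_diff A B) + 2 * card (A \<inter> B) = card A + card B"
proof -
  have "card A = card (A - B) + card (A \<inter> B)" "card B = card (B - A) + card (A \<inter> B)"
    by (subst card_Un_disjoint[symmetric]; force intro: arg_cong[of _ _ card])+
  moreover have "card (sym_diff A B) = card (A - B) + card (B - A)"
    by (intro card_Un_disjoint) auto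
  ultimately show ?thesis by simp
qed

lemma even_card_sym_diff_Int:
  fixes A B C :: "'a::finite set"
  shows "even (card (sym_diff A B \<inter> C)) \<longleftrightarrow> (even (card (A \<inter> C)) \<longleftrightarrow> even (card (B \<inter> C)))"
proof -
  have "sym_diff A B \<inter> C = sym_diff (A \<inter> C) (B \<inter> C)" by auto
  then show ?thesis using card_sym_diff[of "A \<inter> C" "B \<inter> C"] by presburger
qed

lemma golay_sym_diff: "A \<in> golay \<Longrightarrow> B \<in> golay \<Longrightarrow> sym_diff A B \<in> golay"
proof (induction A rule: golay.induct)
  case (add A c)
  have "sym_diff (sym_diff A (golay_generator c)) B = sym_diff (sym_diff A B) (golay_generator c)" by auto
  then show ?case using golay.add[OF add.IH[OF add.prems], of c] by simp
qed simp

lemma golay_generator_in_golay: "golay_generator c \<in> golay"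
  using golay.add[OF golay.empty, of c] by simp

text \<open>The non-squares modulo 23 form a Paley difference set with parameters (23, 11, 5); only
  the difference of \<open>c\<close> and \<open>d\<close> matters, and its 23 values are
  evaluated.\<close>

lemma card_non_square_pairs:
  "card {y::23. \<not> (\<exists>a. y - c = a\<^sup>2) \<and> \<not> (\<exists>a. y - d = a\<^sup>2)} = (if c = d then 11 else 5)"
proof -
  obtain e where e: "d - c = of_int e" "0 \<le> e" "e < 23" by (rule ex_of_int_23)
  have "card {y::23. \<not> (\<exists>a. y - c = a\<^sup>2) \<and> \<not> (\<exists>a. y - d = a\<^sup>2)} =
      length (filter (\<lambda>i. \<not> (\<exists>a. of_int i + c - c = (a::23)\<^sup>2) \<and> \<not> (\<exists>a. of_int i + c - d = (a::23)\<^sup>2)) [0..22])"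
    by (rule card_23_filter)
  also have "(\<lambda>i. \<not> (\<exists>a. of_int i + c - c = (a::23)\<^sup>2) \<and> \<not> (\<exists>a. of_int i + c - d = (a::23)\<^sup>2)) =
      (\<lambda>i. \<not> square_mod_23 i \<and> \<not> square_mod_23 (i - e))"
  proof
    fix i
    have "of_int i + c - d = (of_int (i - e) :: 23)" using e(1) by (simp add: algebra_simps)
    then show "(\<not> (\<exists>a. of_int i + c - c = (a::23)\<^sup>2) \<and> \<not> (\<exists>a. of_int i + c - d = (a::23)\<^sup>2)) =
      (\<not> square_mod_23 i \<and> \<not> square_mod_23 (i - e))"
      by (simp only: square_mod_23_iff add_diff_cancel_right')
  qed
  also have "length (filter \<dots> [0..22]) = (if e = 0 then 11 else 5)"
  proof -
    have "list_all (\<lambda>e. length (filter (\<lambda>i. \<not> square_mod_23 i \<and> \<not> square_mod_23 (i - e)) [0..22]) =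
        (if e = 0 then 11 else 5)) [0..22]"
      unfolding square_mod_23_def by code_simp
    then show ?thesis using e by (auto simp: list_all_iff)
  qed
  also have "e = 0 \<longleftrightarrow> c = d"
  proof
    assume "c = d"
    then have "(of_int e :: 23) = of_int 0" using e(1) by simp
    then show "e = 0" unfolding of_int_23_eq_iff using e by simp
  qed (use e in auto)
  finally show ?thesis .
qed

lemma card_golay_generator_Int: "card (golay_generator c \<inter> golay_generator d) = (if c = d then 12 else 6)"
proof -
  have "golay_generator c \<inter> golay_generator d =
      insert None (Some ` {y::23. \<not> (\<exists>a. y - c = a\<^sup>2) \<and> \<not> (\<exists>a. y - d = a\<^sup>2)})"
    unfolding golay_generator_def by auto
  then show ?thesis
    using card_non_square_pairs[of c d] by (simp add: card_image)
qed

text \<open>The parity of an intersection is bilinear for symmetric difference, so it suffices to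
  look at two generators, which meet in 12 or 6 points.\<close>

lemma golay_even_Int: "A \<in> golay \<Longrightarrow> B \<in> golay \<Longrightarrow> even (card (A \<inter> B))"
proof (induction A rule: golay.induct)
  case (add A c)
  have "even (card (B \<inter> golay_generator c))"
    using \<open>B \<in> golay\<close>
    by (induction B rule: golay.induct)
       (auto simp: even_card_sym_diff_Int card_golay_generator_Int simp del: Int_Un_distrib2)
  then show ?case
    using add by (simp only: even_card_sym_diff_Int Int_commute[of _ "golay_generator c"] Int_commute[of B])
qed simp

text \<open>Adding a generator changes the size by 12 minus twice an intersection that is even by
  self-orthogonality.\<close>

lemma golay_doubly_even: "A \<in> golay \<Longrightarrow> 4 dvd card A"
proof (induction A rule: golay.induct)
  case (add A c)
  have "even (card (A \<inter> golay_generator c))"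
    using golay_even_Int add golay_generator_in_golay by blast
  moreover have "card (golay_generator c) = 12"
    using card_golay_generator_Int[of c c] by simp
  ultimately show ?case
    using card_sym_diff[of A "golay_generator c"] add by presburger
qed simp

text \<open>The full set is the sum of all 23 generators: infinity lies in all of them and every
  other point in exactly 11, and both numbers are odd.\<close>

lemma UNIV_in_golay: "UNIV \<in> golay"
proof -
  have "{p. odd (card {c \<in> I. p \<in> golay_generator c})} \<in> golay" if "finite I" for I
    using that
  proof (induction I rule: finite_induct)
    case (insert d I)
    have *: "{c. (c = d \<or> c \<in> I) \<and> p \<in> golay_generator c} =
      (if p \<in> golay_generator d then insert d {c \<in> I. p \<in> golay_generator c}
       else {c \<in> I. p \<in> golay_generator c})" for p by auto
    have "{p. odd (card {c \<in> insert d I. p \<in> golay_generator c})} =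
       sym_diff {p. odd (card {c \<in> I. p \<in> golay_generator c})} (golay_generator d)"
      using insert by (auto simp: *)
    then show ?case using golay.add[OF insert.IH, of d] by (simp only:)
  qed (simp add: golay.empty)
  from this[of UNIV] have "{p. odd (card {c. p \<in> golay_generator c})} \<in> golay" by simp
  moreover have "odd (card {c. p \<in> golay_generator c})" for p
  proof (cases p)
    case None
    then show ?thesis by (simp add: golay_generator_def)
  next
    case (Some y)
    have "card {c. p \<in> golay_generator c} = card {c::23. \<not> (\<exists>a. y - c = a\<^sup>2)}"
      using Some by (simp add: golay_generator_def image_iff)
    also have "\<dots> = length (filter (\<lambda>i. \<not> (\<exists>a. y - (of_int i + y) = (a::23)\<^sup>2)) [0..22])"
      by (rule card_23_filter)
    also have "(\<lambda>i. \<not> (\<exists>a. y - (of_int i + y) = (a::23)\<^sup>2)) = (\<lambda>i. \<not> square_mod_23 (- i))"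
      using square_mod_23_iff[of "- _"] by simp
    also have "length (filter \<dots> [0..22]) = 11"
      unfolding square_mod_23_def by code_simp
    finally show ?thesis by simp
  qed
  ultimately show ?thesis by simp
qed

lemma golay_Compl: "A \<in> golay \<Longrightarrow> - A \<in> golay"
  using golay_sym_diff[OF UNIV_in_golay, of A] by (simp add: Compl_eq_Diff_UNIV)

text \<open>For odd \<open>card S\<close> the full word will do. For even \<open>card S\<close>, the
  points of \<open>S\<close> split into translated squares and points of
  \<open>golay_generator c\<close>, so an odd number of the former leaves an odd number of the
  latter.\<close>

lemma golay_dual_distance:
  assumes "S \<noteq> {}" "card S \<le> 4"
  shows "\<exists>g\<in>golay. odd (card (S \<inter> g))"
proof (cases "even (card S)")
  case True
  define T where "T = {y. Some y \<in> S}"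
  have ST: "S \<subseteq> insert None (Some ` T)"
  proof
    fix p assume "p \<in> S" then show "p \<in> insert None (Some ` T)" by (cases p) (auto simp: T_def)
  qed
  have "T \<noteq> {}"
  proof
    assume "T = {}"
    then have "S = {None}" using ST assms(1) by auto
    then show False using True by simp
  qed
  moreover have "card T \<le> card S"
    by (rule card_inj_on_le[of Some]) (auto simp: T_def)
  ultimately obtain c where c: "odd (card {t \<in> T. \<exists>a. t - c = a\<^sup>2})"
    using ex_odd_square_shifts[of T] assms by auto
  have "S = Some ` {t \<in> T. \<exists>a. t - c = a\<^sup>2} \<union> (S \<inter> golay_generator c)"
  proof (intro set_eqI)
    fix p show "p \<in> S \<longleftrightarrow> p \<in> Some ` {t \<in> T. \<exists>a. t - c = a\<^sup>2} \<union> (S \<inter> golay_generator c)"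
      by (cases p) (auto simp: golay_generator_def T_def image_iff)
  qed
  moreover have "Some ` {t \<in> T. \<exists>a. t - c = a\<^sup>2} \<inter> (S \<inter> golay_generator c) = {}"
    by (auto simp: golay_generator_def)
  ultimately have "card S = card {t \<in> T. \<exists>a. t - c = a\<^sup>2} + card (S \<inter> golay_generator c)"
    by (metis (no_types, lifting) card_Un_disjoint card_image finite inj_Some inj_on_subset subset_UNIV)
  then have "odd (card (S \<inter> golay_generator c))" using c True by presburger
  then show ?thesis using golay_generator_in_golay by blast
qed (auto intro!: bexI[OF _ UNIV_in_golay])

text \<open>Sizes are multiples of 4. A word of size 4 would meet some codeword in an odd number of
  points, against self-orthogonality; complementation then excludes size 20.\<close>

lemma golay_weights:
  assumes "A \<in> golay" shows "card A \<in> {0, 8, 12, 16, 24}"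
proof -
  have no4: "card B \<noteq> 4" if "B \<in> golay" for B
  proof
    assume "card B = 4"
    then obtain g where "g \<in> golay" "odd (card (B \<inter> g))" using golay_dual_distance[of B] by fastforce
    then show False using golay_even_Int[OF that] by blast
  qed
  have "card (- A) = 24 - card A"
    by (simp add: Compl_eq_Diff_UNIV card_Diff_subset)
  moreover have "card A \<le> 24" using card_mono[of "UNIV :: point set" A] by simp
  ultimately have "card A \<noteq> 20" using no4[OF golay_Compl[OF assms]] by auto
  then show ?thesis
    using no4[OF assms] golay_doubly_even[OF assms] \<open>card A \<le> 24\<close>
    unfolding insert_iff empty_iff by presburger
qed

text \<open>Words become vectors of signs: symmetric difference turns into the pointwise product,
  and the product of the signs over a fixed set of points is a character of the code.\<close>

definition support_sign :: "'a set \<Rightarrow> 'a \<Rightarrow> real" where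
  "support_sign c i = (if i \<in> c then - 1 else 1)"

lemma support_sign_square [simp]: "support_sign c i * support_sign c i = 1"
  "support_sign c i * (support_sign c i * x) = x"
  by (auto simp: support_sign_def)

lemma support_sign_sym_diff: "support_sign (sym_diff c g) i = support_sign c i * support_sign g i"
  by (auto simp: support_sign_def)

lemma support_sign_Compl: "support_sign (- c) i = - support_sign c i"
  by (auto simp: support_sign_def)

lemma prod_support_sign: "finite S \<Longrightarrow> (\<Prod>i\<in>S. support_sign g i) = (- 1) ^ card (S \<inter> g)"
proof -
  assume "finite S"
  then have "(\<Prod>i\<in>S. support_sign g i) = (\<Prod>i\<in>S \<inter> g. - 1)"
    by (intro prod.mono_neutral_cong_right) (auto simp: support_sign_def)
  then show ?thesis by simp
qed

lemma sum_support_sign: "(\<Sum>i\<in>UNIV. support_sign c (i::point)) = 24 - 2 * real (card c)"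
proof -
  have "(\<Sum>i\<in>UNIV. support_sign c (i::point)) = (\<Sum>i\<in>UNIV. 1 - 2 * indicator c i)"
    by (intro sum.cong) (auto simp: support_sign_def indicator_def)
  then show ?thesis by (simp add: sum_subtractf sum_distrib_left[symmetric] indicator_def)
qed

text \<open>Translation by a codeword that meets \<open>S\<close> in an odd number of points
  permutes the code and negates the character.\<close>

lemma golay_character_sum_0:
  assumes "S \<noteq> {}" "card S \<le> 4"
  shows "(\<Sum>c\<in>golay. \<Prod>i\<in>S. support_sign c i) = 0"
proof -
  obtain g where g: "g \<in> golay" "odd (card (S \<inter> g))" using golay_dual_distance[OF assms] by blast
  have "(\<Sum>c\<in>golay. \<Prod>i\<in>S. support_sign c i) = (\<Sum>c\<in>golay. \<Prod>i\<in>S. support_sign (sym_diff c g) i)"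
    by (rule sum.reindex_bij_witness[of _ "\<lambda>c. sym_diff c g" "\<lambda>c. sym_diff c g"])
       (auto intro: golay_sym_diff g arg_cong[of _ _ "\<lambda>c. \<Prod>i\<in>S. support_sign c i"])
  also have "\<dots> = (\<Sum>c\<in>golay. - (\<Prod>i\<in>S. support_sign c i))"
    using g(2) by (simp add: support_sign_sym_diff prod.distrib prod_support_sign)
  finally show ?thesis by (simp add: sum_negf)
qed

lemma golay_character_sum_2:
  "(\<Sum>c\<in>golay. support_sign c i * support_sign c j) = (if i = j then real (card golay) else 0)"
  using golay_character_sum_0[of "{i, j}"] by (cases "i = j") simp_all

text \<open>The character is trivial exactly when the four indices can be paired off into equal
  ones. The three pairings are counted separately, and if all indices coincide the count 3 is
  corrected to 1. Any coincidence cancels two signs and leaves a character of two points.\<close>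

lemma golay_character_sum_4:
  "(\<Sum>c\<in>golay. support_sign c i * support_sign c j * (support_sign c k * support_sign c l)) =
   real (card golay) * (of_bool (i = j \<and> k = l) + of_bool (i = k \<and> j = l) + of_bool (i = l \<and> j = k)
     - 2 * of_bool (i = j \<and> j = k \<and> k = l))"
proof (cases "distinct [i, j, k, l]")
  case True
  then have "card {i, j, k, l} = 4" by simp
  then show ?thesis using golay_character_sum_0[of "{i, j, k, l}"] True by (simp add: mult_ac)
next
  case False
  then consider "i = j" | "i = k" | "i = l" | "j = k" | "j = l" | "k = l" by auto
  then obtain a b where eq: "\<And>c. support_sign c i * support_sign c j * (support_sign c k * support_sign c l) =
      support_sign c a * support_sign c b" and
    ab: "of_bool (i = j \<and> k = l) + of_bool (i = k \<and> j = l) + of_bool (i = l \<and> j = k)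
     - 2 * of_bool (i = j \<and> j = k \<and> k = l) = (if a = b then 1 else 0 :: real)"
  proof cases
    case 1
    show ?thesis
    proof (rule that[of k l])
      show "support_sign c i * support_sign c j * (support_sign c k * support_sign c l) =
        support_sign c k * support_sign c l" for c using 1 by (simp add: support_sign_def)
    qed (use 1 in \<open>cases "j = k"; cases "k = l"; cases "j = l"; simp\<close>)
  next
    case 2
    show ?thesis
    proof (rule that[of j l])
      show "support_sign c i * support_sign c j * (support_sign c k * support_sign c l) =
        support_sign c j * support_sign c l" for c using 2 by (simp add: support_sign_def)
    qed (use 2 in \<open>cases "j = k"; cases "k = l"; cases "j = l"; simp\<close>)
  next
    case 3
    show ?thesis
    proof (rule that[of j k])
      show "support_sign c i * support_sign c j * (support_sign c k * support_sign c l) =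
        support_sign c j * support_sign c k" for c using 3 by (simp add: support_sign_def)
    qed (use 3 in \<open>cases "j = k"; cases "k = l"; cases "j = l"; simp\<close>)
  next
    case 4
    show ?thesis
    proof (rule that[of i l])
      show "support_sign c i * support_sign c j * (support_sign c k * support_sign c l) =
        support_sign c i * support_sign c l" for c using 4 by (simp add: support_sign_def)
    qed (use 4 in \<open>cases "j = k"; cases "k = l"; cases "j = l"; simp\<close>)
  next
    case 5
    show ?thesis
    proof (rule that[of i k])
      show "support_sign c i * support_sign c j * (support_sign c k * support_sign c l) =
        support_sign c i * support_sign c k" for c using 5 by (simp add: support_sign_def)
    qed (use 5 in \<open>cases "j = k"; cases "k = l"; cases "j = l"; simp\<close>)
  next
    case 6
    show ?thesis
    proof (rule that[of i j])
      show "support_sign c i * support_sign c j * (support_sign c k * support_sign c l) =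
        support_sign c i * support_sign c j" for c using 6 by (simp add: support_sign_def)
    qed (use 6 in \<open>cases "j = k"; cases "k = l"; cases "j = l"; simp\<close>)
  qed
  then show ?thesis unfolding eq ab golay_character_sum_2 by simp
qed

section \<open>Power moments of the weight distribution and the size of the code\<close>

abbreviation golay_weight_sum :: "point set \<Rightarrow> real" where
  "golay_weight_sum c \<equiv> (\<Sum>i\<in>UNIV. support_sign c i)"

lemma golay_weight_moment_1:
  "(\<Sum>c\<in>golay. support_sign c i * golay_weight_sum c) = real (card golay)"
proof -
  have "(\<Sum>c\<in>golay. support_sign c i * golay_weight_sum c) =
    (\<Sum>j\<in>UNIV. \<Sum>c\<in>golay. support_sign c i * support_sign c j)"
    unfolding sum_distrib_left by (rule sum.swap)
  then show ?thesis by (simp add: golay_character_sum_2)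
qed

text \<open>For \<open>i = j\<close> the pairing \<open>k = l\<close> gives 24, while the other two
  pairings cancel the correction -2. For \<open>i\<close> different from \<open>j\<close> just those
  two pairings survive.\<close>

lemma golay_weight_moment_2:
  "(\<Sum>c\<in>golay. support_sign c i * support_sign c j * (golay_weight_sum c)\<^sup>2) =
     real (card golay) * (if i = j then 24 else 2)"
proof -
  have "(\<Sum>c\<in>golay. support_sign c i * support_sign c j * (golay_weight_sum c)\<^sup>2) =
    (\<Sum>c\<in>golay. \<Sum>k\<in>UNIV. \<Sum>l\<in>UNIV. support_sign c i * support_sign c j * (support_sign c k * support_sign c l))"
    by (simp only: power2_eq_square sum_product) (simp only: sum_distrib_left)
  also have "\<dots> = (\<Sum>k\<in>UNIV. \<Sum>l\<in>UNIV. \<Sum>c\<in>golay. support_sign c i * support_sign c j * (support_sign c k * support_sign c l))"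
    by (subst sum.swap, rule sum.cong[OF refl], rule sum.swap)
  also have "\<dots> = real (card golay) * (\<Sum>k\<in>UNIV. \<Sum>l\<in>UNIV. of_bool (i = j \<and> k = l) + of_bool (i = k \<and> j = l) + of_bool (i = l \<and> j = k)
     - 2 * of_bool (i = j \<and> j = k \<and> k = l))"
    by (simp only: golay_character_sum_4 sum_distrib_left)
  also have "(\<Sum>k\<in>UNIV. \<Sum>l\<in>UNIV. of_bool (i = j \<and> k = l) + of_bool (i = k \<and> j = l) + of_bool (i = l \<and> j = k)
     - 2 * of_bool (i = j \<and> j = k \<and> k = l)) = (if i = j then 24 else 2 :: real)"
  proof -
    have delta: "(\<Sum>k\<in>UNIV. \<Sum>l\<in>UNIV. of_bool (a = k \<and> b = l)) = (1 :: real)" for a b :: point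
    proof -
      have "(\<Sum>l\<in>UNIV. of_bool (a = k \<and> b = l)) = (if a = k then 1 else 0 :: real)" for k
        by (simp add: of_bool_def)
      then show ?thesis by simp
    qed
    have 1: "(\<Sum>k\<in>UNIV. \<Sum>l\<in>UNIV. of_bool (i = j \<and> k = (l :: point))) = (if i = j then 24 else 0 :: real)"
      by (simp add: of_bool_def)
    have 3: "(\<Sum>k\<in>UNIV. \<Sum>l\<in>UNIV. of_bool (i = l \<and> j = k)) = (1 :: real)"
      by (subst sum.swap) (rule delta)
    have "(\<Sum>k\<in>UNIV. \<Sum>l\<in>UNIV. of_bool (i = j \<and> j = k \<and> k = l)) =
        (\<Sum>k\<in>UNIV. \<Sum>l\<in>UNIV. of_bool (i = j) * of_bool (j = k \<and> j = l) :: real)"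
      by (intro sum.cong) auto
    then have 4: "(\<Sum>k\<in>UNIV. \<Sum>l\<in>UNIV. of_bool (i = j \<and> j = k \<and> k = l)) = (of_bool (i = j) :: real)"
      by (simp only: sum_distrib_left[symmetric] delta mult_1_right)
    show ?thesis
      unfolding sum.distrib sum_subtractf sum_distrib_left[symmetric] 1 3 4 delta by simp
  qed
  finally show ?thesis .
qed

lemma golay_weight_moment_4: "(\<Sum>c\<in>golay. (golay_weight_sum c) ^ 4) = real (card golay) * 1680"
proof -
  have "(\<Sum>c\<in>golay. (golay_weight_sum c) ^ 4) =
    (\<Sum>c\<in>golay. \<Sum>i\<in>UNIV. \<Sum>j\<in>UNIV. support_sign c i * support_sign c j * (golay_weight_sum c)\<^sup>2)"
    by (simp add: power4_eq_xxxx power2_eq_square sum_product[symmetric] sum_distrib_right[symmetric] mult.assoc)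
  also have "\<dots> = (\<Sum>i\<in>UNIV. \<Sum>j\<in>UNIV. \<Sum>c\<in>golay. support_sign c i * support_sign c j * (golay_weight_sum c)\<^sup>2)"
    by (subst sum.swap, rule sum.cong[OF refl], rule sum.swap)
  also have "\<dots> = real (card golay) * (\<Sum>i\<in>UNIV. \<Sum>j\<in>UNIV. if i = (j::point) then 24 else 2)"
    by (simp only: golay_weight_moment_2 sum_distrib_left)
  also have "(\<Sum>i\<in>UNIV. \<Sum>j\<in>UNIV. if i = (j::point) then 24 else 2) = (\<Sum>i\<in>(UNIV :: point set). \<Sum>j\<in>UNIV. (if i = j then 22 else 0) + 2 :: real)"
    by (intro sum.cong) auto
  also have "\<dots> = 1680" by (simp add: sum.distrib)
  finally show ?thesis .
qed

text \<open>Among the possible values \<open>\<plusminus>24, \<plusminus>8, 0\<close> of the weight sum \<open>W\<close>, only \<open>\<plusminus>24\<close> contribute to \<open>W\<^sup>2 (W\<^sup>2 - 64)\<close>.\<close>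

lemma card_golay: "card golay = 4096"
proof -
  let ?F = "\<lambda>c. (golay_weight_sum c)\<^sup>2 * ((golay_weight_sum c)\<^sup>2 - 64)"
  have "(\<Sum>c\<in>golay. ?F c) = (\<Sum>c\<in>{{}, UNIV}. ?F c)"
  proof (rule sum.mono_neutral_right)
    show "\<forall>c\<in>golay - {{}, UNIV}. ?F c = 0"
    proof
      fix c assume c: "c \<in> golay - {{}, UNIV}"
      then have "card c \<noteq> 24"
        using card_seteq[of UNIV c] by auto
      moreover have "card c \<noteq> 0" using c by simp
      ultimately have "card c = 8 \<or> card c = 12 \<or> card c = 16" using c golay_weights[of c] by auto
      then show "?F c = 0" by (auto simp: sum_support_sign)
    qed
  qed (auto intro: golay.empty UNIV_in_golay)
  also have "\<dots> = 589824" by (simp add: sum_support_sign)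
  finally have "(\<Sum>c\<in>golay. (golay_weight_sum c) ^ 4) - 64 * (\<Sum>c\<in>golay. (golay_weight_sum c)\<^sup>2) = 589824"
    by (simp add: algebra_simps power4_eq_xxxx power2_eq_square sum_subtractf sum_distrib_left)
  moreover have "(\<Sum>c\<in>golay. (golay_weight_sum c)\<^sup>2) = real (card golay) * 24"
    using golay_weight_moment_2[of None None] by simp
  \<comment> \<open>The size is 589824 / (1680 - 64 * 24) = 589824 / 144.\<close>
  ultimately show ?thesis unfolding golay_weight_moment_4 by simp
qed

section \<open>Octads through one or two points\<close>

definition octads :: "point set set" where
  "octads = {c \<in> golay. card c = 8}"

text \<open>Words of size 16 are the complements of octads. The functions summed below contain a
  power of the weight sum, which vanishes on words of size 12.\<close>

lemma sum_golay_octads: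
  fixes F :: "point set \<Rightarrow> real"
  assumes "\<And>c. card c = 12 \<Longrightarrow> F c = 0"
  shows "(\<Sum>c\<in>golay. F c) = F {} + F UNIV + (\<Sum>c\<in>octads. F c + F (- c))"
proof -
  have compl: "card (- c) = 24 - card c" for c :: "point set" by (simp add: Compl_eq_Diff_UNIV card_Diff_subset)
  have U: "card c = 24 \<Longrightarrow> c = UNIV" for c :: "point set"
    using card_seteq[of UNIV c] by auto
  have O: "octads \<subseteq> golay" "uminus ` octads \<subseteq> golay"
    by (auto simp: octads_def golay_Compl)
  have "(\<Sum>c\<in>golay. F c) = (\<Sum>c\<in>{{}, UNIV} \<union> (octads \<union> uminus ` octads). F c)"
  proof (rule sum.mono_neutral_right)
    show "\<forall>c\<in>golay - ({{}, UNIV} \<union> (octads \<union> uminus ` octads)). F c = 0"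
    proof
      fix c assume c: "c \<in> golay - ({{}, UNIV} \<union> (octads \<union> uminus ` octads))"
      have "card c \<noteq> 16"
      proof
        assume "card c = 16"
        then have "- c \<in> octads" using c golay_Compl[of c] compl[of c] by (auto simp: octads_def)
        then have "c \<in> uminus ` octads" by (intro image_eqI[of _ _ "- c"]) auto
        then show False using c by simp
      qed
      moreover have "card c \<noteq> 24" "card c \<noteq> 0" "card c \<noteq> 8" using c U[of c] by (auto simp: octads_def)
      ultimately have "card c = 12" using c golay_weights[of c] by auto
      then show "F c = 0" by (rule assms)
    qed
  qed (use O golay.empty UNIV_in_golay in auto)
  also have "\<dots> = (\<Sum>c\<in>{{}, UNIV}. F c) + (\<Sum>c\<in>octads \<union> uminus ` octads. F c)"
  proof (rule sum.union_disjoint)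
    have "card c \<in> {8, 16}" if "c \<in> octads \<union> uminus ` octads" for c
      using that compl by (auto simp: octads_def)
    from this[of "{}"] this[of UNIV] show "{{}, UNIV} \<inter> (octads \<union> uminus ` octads) = {}" by auto
  qed auto
  also have "(\<Sum>c\<in>{{}, UNIV}. F c) = F {} + F UNIV" by simp
  also have "(\<Sum>c\<in>octads \<union> uminus ` octads. F c) = (\<Sum>c\<in>octads. F c) + (\<Sum>c\<in>uminus ` octads. F c)"
  proof (rule sum.union_disjoint)
    have "card c = 8" if "c \<in> octads" for c using that by (simp add: octads_def)
    moreover have "card c = 16" if "c \<in> uminus ` octads" for c using that compl by (auto simp: octads_def)
    ultimately show "octads \<inter> uminus ` octads = {}" by fastforce
  qed auto
  also have "(\<Sum>c\<in>uminus ` octads. F c) = (\<Sum>c\<in>octads. F (- c))"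
    by (subst sum.reindex) (auto simp: inj_on_def)
  finally show ?thesis by (simp add: sum.distrib)
qed

text \<open>The empty and the full word contribute 2 * 24^2 = 1152, and an octad and its complement
  contribute 8^2 each. For \<open>i = j\<close> the sum is the number of octads, 759.\<close>

lemma octads_sign_sum_2:
  "(\<Sum>c\<in>octads. support_sign c i * support_sign c j) = (if i = j then 759 else 55)"
proof -
  let ?F = "\<lambda>c. support_sign c i * support_sign c j * (golay_weight_sum c)\<^sup>2"
  have "real (card golay) * (if i = j then 24 else 2) = ?F {} + ?F UNIV + (\<Sum>c\<in>octads. ?F c + ?F (- c))"
    unfolding golay_weight_moment_2[symmetric] by (rule sum_golay_octads) (simp add: sum_support_sign)
  also have "?F {} + ?F UNIV = 1152" by (simp add: support_sign_def)
  also have "(\<Sum>c\<in>octads. ?F c + ?F (- c)) = (\<Sum>c\<in>octads. 128 * (support_sign c i * support_sign c j))"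
    by (intro sum.cong) (auto simp: support_sign_Compl sum_negf octads_def sum_support_sign power2_eq_square)
  finally have "4096 * (if i = j then 24 else 2) = 1152 + 128 * (\<Sum>c\<in>octads. support_sign c i * support_sign c j)"
    by (simp add: card_golay flip: sum_distrib_left)
  then show ?thesis by (cases "i = j") simp_all
qed

lemma octads_sign_sum_1: "(\<Sum>c\<in>octads. support_sign c i) = 253"
proof -
  let ?F = "\<lambda>c. support_sign c i * golay_weight_sum c"
  have "real (card golay) = ?F {} + ?F UNIV + (\<Sum>c\<in>octads. ?F c + ?F (- c))"
    unfolding golay_weight_moment_1[of i, symmetric] by (rule sum_golay_octads) (simp add: sum_support_sign)
  also have "?F {} + ?F UNIV = 48" by (simp add: support_sign_def)
  also have "(\<Sum>c\<in>octads. ?F c + ?F (- c)) = (\<Sum>c\<in>octads. 16 * support_sign c i)"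
    by (intro sum.cong) (auto simp: support_sign_Compl sum_negf octads_def sum_support_sign)
  finally have "4096 = 48 + 16 * (\<Sum>c\<in>octads. support_sign c i)"
    by (simp add: card_golay flip: sum_distrib_left)
  then show ?thesis by simp
qed

lemma card_octads_containing:
  "card {c \<in> octads. i \<in> c \<and> j \<in> c} = (if i = j then 253 else 77)"
proof -
  have "real (card {c \<in> octads. i \<in> c \<and> j \<in> c}) = (\<Sum>c\<in>octads. if i \<in> c \<and> j \<in> c then 1 else 0)"
    by (simp add: sum.If_cases Int_def)
  \<comment> \<open>The indicator of both points is (1 - s_i) (1 - s_j) / 4. Its constant 1 is
    written as s_i * s_i so that \<open>octads_sign_sum_2\<close> also evaluates this term.\<close>
  also have "\<dots> = (\<Sum>c\<in>octads. (support_sign c i * support_sign c i - support_sign c i - support_sign c j +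
      support_sign c i * support_sign c j) / 4)"
    by (intro sum.cong) (auto simp: support_sign_def)
  also have "\<dots> = (759 - 253 - 253 + (if i = j then 759 else 55)) / 4"
    unfolding sum_divide_distrib[symmetric] sum.distrib sum_subtractf octads_sign_sum_2 octads_sign_sum_1
    by simp
  finally have "real (card {c \<in> octads. i \<in> c \<and> j \<in> c}) = (if i = j then 253 else 77)"
    by (auto split: if_splits)
  then show ?thesis by (auto split: if_splits)
qed

section \<open>The Leech lattice in integer coordinates\<close>

definition leech_int :: "(point \<Rightarrow> int) set" where
  "leech_int = {v. \<exists>m. (\<forall>i. v i mod 2 = m mod 2) \<and> (\<Sum>i\<in>UNIV. v i) mod 8 = (4 * m) mod 8 \<and>
     (\<forall>k. {i. v i mod 4 = k} \<in> golay)}"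

text \<open>Normal form of a lattice vector by binary digits: constant parity, a codeword in the
  second digit, then a multiple of 4. The residues modulo 4 that occur are those of \<open>m\<close>
  and \<open>m + 2\<close>, on the complement of \<open>c\<close> and on \<open>c\<close>. Here
  \<open>m\<close> is any integer, since differences can produce -1; \<open>leech_intD\<close>
  returns 0 or 1.\<close>

lemma leech_intI:
  assumes v: "\<And>i. v i = m + 2 * of_bool (i \<in> c) + 4 * w i" and c: "c \<in> golay"
    and sum: "(\<Sum>i\<in>UNIV. v i) mod 8 = (4 * m) mod 8"
  shows "v \<in> leech_int"
proof -
  have "v i mod 2 = m mod 2" for i unfolding v by (cases "i \<in> c"; simp; presburger)
  moreover have "{i. v i mod 4 = k} \<in> golay" for k
  proof -
    have "{i. v i mod 4 = k} = (if k = m mod 4 then - c else if k = (m + 2) mod 4 then c else {})"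
    proof (intro set_eqI)
      fix i
      have "v i mod 4 = (if i \<in> c then (m + 2) mod 4 else m mod 4)" unfolding v by (simp add: mod_simps)
      moreover have "(m + 2) mod 4 \<noteq> m mod 4" by presburger
      ultimately show "i \<in> {i. v i mod 4 = k} \<longleftrightarrow> i \<in> (if k = m mod 4 then - c else if k = (m + 2) mod 4 then c else {})"
        by auto
    qed
    then show ?thesis using c golay_Compl golay.empty by simp
  qed
  ultimately show ?thesis using sum unfolding leech_int_def by blast
qed

lemma leech_intD:
  assumes "v \<in> leech_int"
  shows "\<exists>m c w. (m = 0 \<or> m = 1) \<and> c \<in> golay \<and> (\<forall>i. v i = m + 2 * of_bool (i \<in> c) + 4 * w i) \<and>
    (\<Sum>i\<in>UNIV. v i) mod 8 = 4 * m"
proof -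
  obtain m where m: "\<And>i. v i mod 2 = m mod 2" "(\<Sum>i\<in>UNIV. v i) mod 8 = (4 * m) mod 8"
    "\<And>k. {i. v i mod 4 = k} \<in> golay"
    using assms unfolding leech_int_def by blast
  define c where "c = {i. v i mod 4 = m mod 2 + 2}"
  define w where "w i = (v i - m mod 2 - 2 * of_bool (i \<in> c)) div 4" for i
  have "v i = m mod 2 + 2 * of_bool (i \<in> c) + 4 * w i" for i
  proof (cases "i \<in> c")
    case True
    then show ?thesis unfolding w_def c_def by simp presburger
  next
    case False
    have "a = r + 4 * ((a - r) div 4)" if "a mod 2 = r" "a mod 4 \<noteq> r + 2" for a r :: int
    proof -
      have "a mod 4 = r" using that by presburger
      then have "4 dvd a - r" by presburger
      then show ?thesis by simp
    qed
    from this[OF m(1)[of i]] show ?thesis using False unfolding w_def c_def by simp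
  qed
  moreover have "m mod 2 = 0 \<or> m mod 2 = 1" by presburger
  moreover have "c \<in> golay" unfolding c_def by (rule m(3))
  moreover have "(4 * m) mod 8 = 4 * (m mod 2)" by presburger
  then have "(\<Sum>i\<in>UNIV. v i) mod 8 = 4 * (m mod 2)" using m(2) by simp
  ultimately show ?thesis
    by (intro exI[of _ "m mod 2"] exI[of _ c] exI[of _ w] conjI allI)
qed

lemma leech_int_diff:
  assumes "u \<in> leech_int" "v \<in> leech_int"
  shows "(\<lambda>i. u i - v i) \<in> leech_int"
proof -
  obtain m c w where u: "c \<in> golay" "\<And>i. u i = m + 2 * of_bool (i \<in> c) + 4 * w i"
      "(\<Sum>i\<in>UNIV. u i) mod 8 = 4 * m"
    using leech_intD[OF assms(1)] by blast
  obtain m' c' w' where v: "c' \<in> golay" "\<And>i. v i = m' + 2 * of_bool (i \<in> c') + 4 * w' i"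
      "(\<Sum>i\<in>UNIV. v i) mod 8 = 4 * m'"
    using leech_intD[OF assms(2)] by blast
  show ?thesis
  proof (rule leech_intI)
    \<comment> \<open>The carry of subtraction: the difference of two indicators is the indicator of
      the symmetric difference, minus twice that of \<open>c' - c\<close>.\<close>
    show "u i - v i = m - m' + 2 * of_bool (i \<in> sym_diff c c') + 4 * (w i - w' i - of_bool (i \<in> c' - c))" for i
      unfolding u(2) v(2) by (cases "i \<in> c"; cases "i \<in> c'") auto
    show "(\<Sum>i\<in>UNIV. u i - v i) mod 8 = (4 * (m - m')) mod 8"
      unfolding sum_subtractf using mod_diff_eq[of "sum u UNIV" 8 "sum v UNIV"] u(3) v(3)
      by (simp add: right_diff_distrib)
  qed (intro golay_sym_diff u v)
qed

lemma zero_leech_int: "(\<lambda>i. 0) \<in> leech_int"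
  by (rule leech_intI[of _ 0 "{}" "\<lambda>_. 0"]) (auto intro: golay.empty)

lemma leech_int_uminus: "v \<in> leech_int \<Longrightarrow> (\<lambda>i. - v i) \<in> leech_int"
  using leech_int_diff[OF zero_leech_int, of v] by simp

lemma sum_of_bool_mem: "(\<Sum>i\<in>(UNIV :: 'a::finite set). of_bool (i \<in> c)) = (of_nat (card c) :: 'b::semiring_1)"
  by (simp add: of_bool_def sum.If_cases)

text \<open>The coordinate sum changes by twice the sum over \<open>c\<close>. The latter is a
  multiple of 4 because \<open>c\<close> is doubly even and meets the codeword \<open>d\<close> of
  \<open>v\<close> evenly. Negation fixes the residues 0 and 2 modulo 4 and exchanges 1 and 3, so
  \<open>d\<close> stays for even vectors and becomes \<open>sym_diff d c\<close> for odd
  ones.\<close>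

lemma leech_int_sign_change:
  assumes v: "v \<in> leech_int" and c: "c \<in> golay"
  shows "(\<lambda>i. if i \<in> c then - v i else v i) \<in> leech_int"
proof -
  obtain m d w where m: "m = 0 \<or> m = 1" and d: "d \<in> golay"
    and v: "\<And>i. v i = m + 2 * of_bool (i \<in> d) + 4 * w i" and sum: "(\<Sum>i\<in>UNIV. v i) mod 8 = 4 * m"
    using leech_intD[OF v] by blast
  have "(\<Sum>i\<in>c. v i) = m * int (card c) + 2 * int (card (c \<inter> d)) + 4 * (\<Sum>i\<in>c. w i)"
    unfolding v by (simp add: sum.distrib of_bool_def sum.If_cases flip: sum_distrib_left)
  moreover have "4 dvd int (card c)" using golay_doubly_even[OF c] int_dvd_int_iff[of 4 "card c"] by simp
  moreover have "2 dvd int (card (c \<inter> d))" using golay_even_Int[OF c d] by (subst even_of_nat)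
  then have "2 * 2 dvd 2 * int (card (c \<inter> d))" by (rule mult_dvd_mono[OF dvd_refl])
  ultimately have "4 dvd (\<Sum>i\<in>c. v i)" by simp
  moreover have "(\<Sum>i\<in>UNIV. if i \<in> c then - v i else v i) = (\<Sum>i\<in>UNIV. v i) - 2 * (\<Sum>i\<in>c. v i)"
  proof -
    have "(\<Sum>i\<in>UNIV. if i \<in> c then - v i else v i) = (\<Sum>i\<in>UNIV. v i - 2 * (if i \<in> c then v i else 0))"
      by (intro sum.cong) auto
    then show ?thesis by (simp add: sum_subtractf sum.If_cases flip: sum_distrib_left)
  qed
  moreover have "(a - 2 * b) mod 8 = (4 * m) mod 8" if "4 dvd b" "a mod 8 = 4 * m" for a b :: int
  proof -
    obtain k where "b = 4 * k" using \<open>4 dvd b\<close> by (rule dvdE)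
    then have "(a - 2 * b) mod 8 = (a - 8 * k) mod 8" by simp
    also have "\<dots> = a mod 8" by presburger
    also have "\<dots> = (a mod 8) mod 8" by simp
    finally show ?thesis using that by simp
  qed
  ultimately have sum': "(\<Sum>i\<in>UNIV. if i \<in> c then - v i else v i) mod 8 = (4 * m) mod 8"
    using sum by simp
  show ?thesis
  proof (cases "m = 0")
    case True
    show ?thesis
    proof (rule leech_intI[OF _ d sum'])
      show "(if i \<in> c then - v i else v i) = m + 2 * of_bool (i \<in> d) +
        4 * (if i \<in> c then - w i - of_bool (i \<in> d) else w i)" for i
        using True by (simp add: v)
    qed
  next
    case False
    show ?thesis
    proof (rule leech_intI[OF _ golay_sym_diff[OF d c] sum'])
      show "(if i \<in> c then - v i else v i) = m + 2 * of_bool (i \<in> sym_diff d c) +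
        4 * (if i \<in> c then - w i - 1 else w i)" for i
        using False m by (cases "i \<in> d"; cases "i \<in> c") (auto simp: v)
    qed
  qed
qed

text \<open>For even vectors the norm is 4 * \<open>card c\<close> modulo 16. For odd vectors it is
  8 * (3 + sum of \<open>w\<close>) modulo 16, and the condition on the coordinate sum modulo 8
  makes the sum of \<open>w\<close> odd.\<close>

lemma leech_int_norm_dvd:
  assumes "v \<in> leech_int"
  shows "16 dvd (\<Sum>i\<in>UNIV. (v i)\<^sup>2)"
proof -
  obtain m c w where m: "m = 0 \<or> m = 1" and c: "c \<in> golay"
    and v: "\<And>i. v i = m + 2 * of_bool (i \<in> c) + 4 * w i" and sum: "(\<Sum>i\<in>UNIV. v i) mod 8 = 4 * m"
    using leech_intD[OF assms] by blast
  obtain q where q: "card c = 4 * q" using golay_doubly_even[OF c] by (auto elim: dvdE)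
  have sq: "(v i)\<^sup>2 = m + (4 + 4 * m) * of_bool (i \<in> c) + 8 * m * w i + 16 * (of_bool (i \<in> c) * w i + (w i)\<^sup>2)" for i
    using m unfolding v by (cases "i \<in> c") (auto simp: power2_eq_square algebra_simps)
  have "(\<Sum>i\<in>UNIV. (v i)\<^sup>2) = 24 * m + (4 + 4 * m) * (4 * int q) + 8 * m * (\<Sum>i\<in>UNIV. w i) +
      16 * (\<Sum>i\<in>UNIV. of_bool (i \<in> c) * w i + (w i)\<^sup>2)"
    unfolding sq sum.distrib sum_distrib_left[symmetric] sum_of_bool_mem q by simp
  moreover have "(\<Sum>i\<in>UNIV. v i) = 24 * m + 2 * (4 * int q) + 4 * (\<Sum>i\<in>UNIV. w i)"
    unfolding v sum.distrib sum_distrib_left[symmetric] sum_of_bool_mem q by simp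
  moreover have "16 dvd 24 * m + (4 + 4 * m) * (4 * q) + 8 * m * t + 16 * r"
    if "(24 * m + 2 * (4 * q) + 4 * t) mod 8 = 4 * m" for q r t :: int
    using m
  proof
    assume "m = 1"
    then have "odd t" using that by simp presburger
    then show ?thesis using \<open>m = 1\<close> by simp presburger
  qed simp
  ultimately show ?thesis using sum by simp
qed

text \<open>Twice the inner product is a combination of the norms of \<open>u\<close>,
  \<open>v\<close> and \<open>u - v\<close>, which are multiples of 16.\<close>

lemma leech_int_inner_dvd:
  assumes "u \<in> leech_int" "v \<in> leech_int"
  shows "8 dvd (\<Sum>i\<in>UNIV. u i * v i)"
proof -
  have "(\<Sum>i\<in>UNIV. (u i - v i)\<^sup>2) = (\<Sum>i\<in>UNIV. (u i)\<^sup>2) + (\<Sum>i\<in>UNIV. (v i)\<^sup>2) - 2 * (\<Sum>i\<in>UNIV. u i * v i)"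
    by (simp add: power2_diff sum.distrib sum_subtractf sum_distrib_left mult.assoc)
  moreover have "8 dvd c" if "d = a + b - 2 * c" "16 dvd a" "16 dvd b" "16 dvd d" for a b c d :: int
    using that by presburger
  ultimately show ?thesis
    using leech_int_norm_dvd[OF assms(1)] leech_int_norm_dvd[OF assms(2)]
      leech_int_norm_dvd[OF leech_int_diff[OF assms]] by blast
qed

text \<open>Norm 16 has to be excluded. An odd vector has 24 nonzero entries. An even vector with
  nonempty codeword has at least eight entries of absolute value at least 2. With empty codeword
  exactly one entry of \<open>w\<close> would be nonzero, and the coordinate sum would be 4 modulo
  8.\<close>

lemma leech_int_norm_ge:
  assumes "v \<in> leech_int" "v \<noteq> (\<lambda>i. 0)"
  shows "32 \<le> (\<Sum>i\<in>UNIV. (v i)\<^sup>2)"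
proof -
  have "(\<Sum>i\<in>UNIV. (v i)\<^sup>2) \<noteq> 16"
  proof
    assume 16: "(\<Sum>i\<in>UNIV. (v i)\<^sup>2) = 16"
    obtain m c w where m: "m = 0 \<or> m = 1" and c: "c \<in> golay"
      and v: "\<And>i. v i = m + 2 * of_bool (i \<in> c) + 4 * w i" and sum: "(\<Sum>i\<in>UNIV. v i) mod 8 = 4 * m"
      using leech_intD[OF assms(1)] by blast
    show False
    proof (cases "m = 1")
      case True
      have "1 \<le> (v i)\<^sup>2" for i
      proof -
        have "v i \<noteq> 0" using True unfolding v by (cases "i \<in> c"; simp; presburger)
        then show ?thesis using zero_less_power2[of "v i"] by linarith
      qed
      then have "(\<Sum>i\<in>(UNIV :: point set). 1) \<le> (\<Sum>i\<in>UNIV. (v i)\<^sup>2)" by (intro sum_mono)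
      then show False using 16 by simp
    next
      case False
      then have m0: "m = 0" using m by simp
      show False
      proof (cases "c = {}")
        case True
        have "(\<Sum>i\<in>UNIV. (v i)\<^sup>2) = 16 * (\<Sum>i\<in>UNIV. (w i)\<^sup>2)"
          unfolding v m0 True by (simp add: power_mult_distrib sum_distrib_left)
        then have "(\<Sum>i\<in>UNIV. (w i)\<^sup>2) = 1" using 16 by simp
        moreover have "even ((\<Sum>i\<in>UNIV. (w i)\<^sup>2) + (\<Sum>i\<in>UNIV. w i))"
          unfolding sum.distrib[symmetric] by (intro dvd_sum) simp
        moreover have "(\<Sum>i\<in>UNIV. v i) = 4 * (\<Sum>i\<in>UNIV. w i)"
          unfolding v m0 True by (simp add: sum_distrib_left)
        moreover have False if "a = 1" "even (a + b)" "(4 * b) mod 8 = 0" for a b :: int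
          using that by presburger
        ultimately show False using sum m0 by simp
      next
        case False
        then have "card c \<noteq> 0" by simp
        then have "8 \<le> card c" using golay_weights[OF c] by auto
        have "4 \<le> (v i)\<^sup>2" if "i \<in> c" for i
        proof -
          have "2 \<le> \<bar>v i\<bar>" using that unfolding v m0 by simp presburger
          then show ?thesis using power_mono[of 2 "\<bar>v i\<bar>" 2] by simp
        qed
        then have "(\<Sum>i\<in>c. 4) \<le> (\<Sum>i\<in>c. (v i)\<^sup>2)" by (intro sum_mono)
        also have "\<dots> \<le> (\<Sum>i\<in>UNIV. (v i)\<^sup>2)" by (intro sum_mono2) auto
        finally show False using 16 \<open>8 \<le> card c\<close> by simp
      qed
    qed
  qed
  moreover obtain j where "v j \<noteq> 0" using assms(2) by (auto simp: fun_eq_iff)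
  then have "0 < (\<Sum>i\<in>UNIV. (v i)\<^sup>2)"
    by (intro sum_pos2[of _ j]) auto
  moreover have "32 \<le> a" if "a \<noteq> 16" "0 < a" "16 dvd a" for a :: int
    using that by presburger
  ultimately show ?thesis using leech_int_norm_dvd[OF assms(1)] by blast
qed

section \<open>The three shapes of minimal vectors\<close>

definition signed_vec :: "int \<Rightarrow> point set \<Rightarrow> point set \<Rightarrow> point \<Rightarrow> int" where
  "signed_vec a U A = (\<lambda>i. if i \<in> U then (if i \<in> A then - a else a) else 0)"

text \<open>The large entry has the sign opposite to the other entries of its kind, because -3
  agrees with 1, and 3 with -1, modulo 4.\<close>

definition odd_vec :: "point set \<Rightarrow> point \<Rightarrow> point \<Rightarrow> int" where
  "odd_vec c p = (\<lambda>i. (if i \<in> c then - 1 else 1) * (if i = p then - 3 else 1))"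

definition leech_min :: "(point \<Rightarrow> int) set" where
  "leech_min = {v \<in> leech_int. (\<Sum>i\<in>UNIV. (v i)\<^sup>2) = 32}"

definition leech_min_4 :: "(point \<Rightarrow> int) set" where
  "leech_min_4 = (\<lambda>(U, A). signed_vec 4 U A) ` (SIGMA U:{U. card U = 2}. {A. A \<subseteq> U})"

definition leech_min_2 :: "(point \<Rightarrow> int) set" where
  "leech_min_2 = (\<lambda>(U, A). signed_vec 2 U A) ` (SIGMA U:octads. {A. A \<subseteq> U \<and> even (card A)})"

definition leech_min_odd :: "(point \<Rightarrow> int) set" where
  "leech_min_odd = (\<lambda>(c, p). odd_vec c p) ` (golay \<times> UNIV)"

lemma sum_signed_vec:
  assumes "A \<subseteq> U"
  shows "(\<Sum>i\<in>UNIV. signed_vec a U A i) = a * int (card U) - 2 * a * int (card A)"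
proof -
  have "(\<Sum>i\<in>UNIV. signed_vec a U A i) = (\<Sum>i\<in>UNIV. a * of_bool (i \<in> U) - 2 * a * of_bool (i \<in> A))"
    using assms by (intro sum.cong) (auto simp: signed_vec_def)
  then show ?thesis
    unfolding sum_subtractf sum_distrib_left[symmetric] sum_of_bool_mem by simp
qed

lemma sum_signed_vec_square: "(\<Sum>i\<in>UNIV. (signed_vec a U A i)\<^sup>2) = a\<^sup>2 * int (card U)"
proof -
  have "(\<Sum>i\<in>UNIV. (signed_vec a U A i)\<^sup>2) = (\<Sum>i\<in>UNIV. a\<^sup>2 * of_bool (i \<in> U))"
    by (intro sum.cong) (auto simp: signed_vec_def)
  then show ?thesis unfolding sum_distrib_left[symmetric] sum_of_bool_mem by simp
qed

lemma signed_vec_inj: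
  assumes "a \<noteq> 0" "A \<subseteq> U" "B \<subseteq> V" "signed_vec a U A = signed_vec a V B"
  shows "U = V \<and> A = B"
proof -
  have eq: "signed_vec a U A i = signed_vec a V B i" for i using assms(4) by simp
  have "i \<in> U \<longleftrightarrow> i \<in> V" for i
    using eq[of i] \<open>a \<noteq> 0\<close> by (auto simp: signed_vec_def split: if_splits)
  then have UV: "U = V" by blast
  moreover have "i \<in> A \<longleftrightarrow> i \<in> B" for i
    using eq[of i] \<open>a \<noteq> 0\<close> assms(2,3) UV by (cases "i \<in> U") (auto simp: signed_vec_def split: if_splits)
  ultimately show ?thesis by blast
qed

lemma leech_min_4_subset: "leech_min_4 \<subseteq> leech_min"
proof
  fix v assume "v \<in> leech_min_4"
  then obtain U A where U: "card U = 2" "A \<subseteq> U" and v: "v = signed_vec 4 U A"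
    by (auto simp: leech_min_4_def)
  have "v \<in> leech_int"
  proof (rule leech_intI[of _ 0 "{}" "signed_vec 1 U A"])
    have "(\<Sum>i\<in>UNIV. v i) = 8 * (1 - int (card A))"
      unfolding v sum_signed_vec[OF U(2)] U(1) by simp
    then show "(\<Sum>i\<in>UNIV. v i) mod 8 = (4 * 0) mod 8" by simp
  qed (auto simp: v signed_vec_def golay.empty)
  then show "v \<in> leech_min" by (simp add: leech_min_def v sum_signed_vec_square U)
qed

lemma leech_min_2_subset: "leech_min_2 \<subseteq> leech_min"
proof
  fix v assume "v \<in> leech_min_2"
  then obtain U A where U: "U \<in> golay" "card U = 8" "A \<subseteq> U" "even (card A)" and v: "v = signed_vec 2 U A"
    by (auto simp: leech_min_2_def octads_def)
  have "v \<in> leech_int"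
  proof (rule leech_intI[of _ 0 U "\<lambda>i. - of_bool (i \<in> A)"])
    obtain k where "card A = 2 * k" using U(4) by (rule evenE)
    then have "(\<Sum>i\<in>UNIV. v i) = 8 * (2 - int k)"
      unfolding v sum_signed_vec[OF U(3)] U(2) by simp
    then show "(\<Sum>i\<in>UNIV. v i) mod 8 = (4 * 0) mod 8" by simp
  qed (use U in \<open>auto simp: v signed_vec_def\<close>)
  then show "v \<in> leech_min" by (simp add: leech_min_def v sum_signed_vec_square U)
qed

lemma leech_min_odd_subset: "leech_min_odd \<subseteq> leech_min"
proof
  fix v assume "v \<in> leech_min_odd"
  then obtain c p where c: "c \<in> golay" and v: "v = odd_vec c p"
    by (auto simp: leech_min_odd_def)
  obtain q where q: "card c = 4 * q" using golay_doubly_even[OF c] by (rule dvdE)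
  have "v \<in> leech_int"
  proof (rule leech_intI[of _ 1 c "\<lambda>i. - of_bool (i \<in> c) + (if i = p then (if i \<in> c then 1 else - 1) else 0)"])
    show "v i = 1 + 2 * of_bool (i \<in> c) + 4 * (- of_bool (i \<in> c) + (if i = p then (if i \<in> c then 1 else - 1) else 0))" for i
      by (simp add: v odd_vec_def)
    have "(\<Sum>i\<in>UNIV. v i) = (\<Sum>i\<in>UNIV. 1 - 2 * of_bool (i \<in> c) + (if i = p then (if p \<in> c then 4 else - 4) else 0))"
      by (intro sum.cong) (auto simp: v odd_vec_def)
    also have "\<dots> = 24 - 8 * int q + (if p \<in> c then 4 else - 4)"
      unfolding sum.distrib sum_subtractf sum_distrib_left[symmetric] sum_of_bool_mem q by simp
    also have "\<dots> = 4 + (if p \<in> c then 3 - int q else 2 - int q) * 8" by simp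
    finally show "(\<Sum>i\<in>UNIV. v i) mod 8 = (4 * 1) mod 8" by (simp only: mod_mult_self1) simp
  qed (rule c)
  moreover have "(\<Sum>i\<in>UNIV. (v i)\<^sup>2) = (\<Sum>i\<in>UNIV. 1 + (if i = p then 8 else 0))"
    by (intro sum.cong) (auto simp: v odd_vec_def power2_eq_square)
  ultimately show "v \<in> leech_min" by (simp add: leech_min_def sum.distrib)
qed

lemma sum_nonneg_zero_outside:
  fixes f :: "'a::finite \<Rightarrow> int"
  assumes "\<And>i. 0 \<le> f i" "(\<Sum>i\<in>UNIV. f i) = (\<Sum>i\<in>S. f i)" "i \<notin> S"
  shows "f i = 0"
proof -
  have "(\<Sum>i\<in>UNIV. f i) = (\<Sum>i\<in>UNIV - S. f i) + (\<Sum>i\<in>S. f i)" by (rule sum.subset_diff) auto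
  then have "(\<Sum>i\<in>UNIV - S. f i) = 0" using assms(2) by simp
  then have "\<forall>i\<in>UNIV - S. f i = 0" using assms(1) by (subst (asm) sum_nonneg_eq_0_iff) auto
  then show ?thesis using assms(3) by simp
qed

lemma leech_min_even_empty:
  assumes norm: "(\<Sum>i\<in>UNIV. (v i)\<^sup>2) = 32" and v: "\<And>i. v i = 4 * w i"
  shows "v \<in> leech_min_4"
proof -
  have "(\<Sum>i\<in>UNIV. (v i)\<^sup>2) = 16 * (\<Sum>i\<in>UNIV. (w i)\<^sup>2)"
    unfolding v by (simp add: power_mult_distrib sum_distrib_left)
  then have w2: "(\<Sum>i\<in>UNIV. (w i)\<^sup>2) = 2" using norm by simp
  have w: "w i = - 1 \<or> w i = 0 \<or> w i = 1" for i
  proof -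
    have "(w i)\<^sup>2 \<le> 2" using w2 member_le_sum[of i UNIV "\<lambda>i. (w i)\<^sup>2"] by simp
    then have "\<bar>w i\<bar>\<^sup>2 < 2\<^sup>2" by simp
    then have "\<bar>w i\<bar> < 2" by (rule power_less_imp_less_base) simp
    then show ?thesis by arith
  qed
  define U where "U = {i. w i \<noteq> 0}"
  have "(\<Sum>i\<in>UNIV. (w i)\<^sup>2) = (\<Sum>i\<in>UNIV. of_bool (i \<in> U))"
  proof (rule sum.cong)
    fix i show "(w i)\<^sup>2 = of_bool (i \<in> U)" using w[of i] by (auto simp: U_def)
  qed simp
  then have "card U = 2" using w2 unfolding sum_of_bool_mem by simp
  moreover have "v = signed_vec 4 U {i. w i = - 1}"
  proof
    fix i show "v i = signed_vec 4 U {i. w i = - 1} i"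
      using w[of i] by (auto simp: v signed_vec_def U_def)
  qed
  moreover have "{i. w i = - 1} \<subseteq> U" by (auto simp: U_def)
  ultimately show ?thesis unfolding leech_min_4_def by (intro image_eqI[of _ _ "(U, {i. w i = - 1})"]) auto
qed

text \<open>At least eight entries are 2 modulo 4, and each contributes at least 4. This exhausts
  the norm 32, so \<open>c\<close> is an octad, its entries are 2 or -2, and all others
  vanish.\<close>

lemma leech_min_even_nonempty:
  assumes norm: "(\<Sum>i\<in>UNIV. (v i)\<^sup>2) = 32" and v: "\<And>i. v i = 2 * of_bool (i \<in> c) + 4 * w i"
    and c: "c \<in> golay" "c \<noteq> {}" and sum: "(\<Sum>i\<in>UNIV. v i) mod 8 = 0"
  shows "v \<in> leech_min_2"
proof -
  have "card c \<noteq> 0" using c by simp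
  then have c8: "8 \<le> card c" using golay_weights[OF c(1)] by auto
  have odd: "v i = 2 * (1 + 2 * w i)" if "i \<in> c" for i using that by (simp add: v)
  have ge4: "4 \<le> (v i)\<^sup>2" if "i \<in> c" for i
  proof -
    have "1 + 2 * w i \<noteq> 0" by presburger
    then have "0 < (1 + 2 * w i)\<^sup>2" by simp
    then have "1 \<le> (1 + 2 * w i)\<^sup>2" by linarith
    then show ?thesis unfolding odd[OF that] power_mult_distrib by simp
  qed
  have "int (card c) * 4 = (\<Sum>i\<in>c. 4)" by simp
  also have "\<dots> \<le> (\<Sum>i\<in>c. (v i)\<^sup>2)" using ge4 by (intro sum_mono) auto
  finally have 1: "int (card c) * 4 \<le> (\<Sum>i\<in>c. (v i)\<^sup>2)" .
  have 2: "(\<Sum>i\<in>c. (v i)\<^sup>2) \<le> (\<Sum>i\<in>UNIV. (v i)\<^sup>2)" by (intro sum_mono2) auto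
  have card: "card c = 8" using 1 2 norm c8 by linarith
  then have sc: "(\<Sum>i\<in>c. (v i)\<^sup>2) = 32" using 1 2 norm by linarith
  have off: "v i = 0" if "i \<notin> c" for i
    using sum_nonneg_zero_outside[of "\<lambda>i. (v i)\<^sup>2" c i] that sc norm by simp
  have "(\<Sum>i\<in>c. (v i)\<^sup>2 - 4) = 0" using sc card by (simp add: sum_subtractf)
  then have "\<forall>i\<in>c. (v i)\<^sup>2 - 4 = 0" using ge4 by (subst (asm) sum_nonneg_eq_0_iff) auto
  then have on: "v i = 2 \<or> v i = - 2" if "i \<in> c" for i
    using that power2_eq_iff[of "v i" 2] by auto
  define A where "A = {i. v i = - 2}"
  have "A \<subseteq> c" using off by (force simp: A_def)
  have eq: "v = signed_vec 2 c A"
  proof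
    fix i show "v i = signed_vec 2 c A i"
      using on[of i] off[of i] by (auto simp: signed_vec_def A_def)
  qed
  have "(\<Sum>i\<in>UNIV. v i) = 16 - 4 * int (card A)"
    unfolding eq sum_signed_vec[OF \<open>A \<subseteq> c\<close>] card by simp
  then have "(16 - 4 * int (card A)) mod 8 = 0" using sum by simp
  moreover have "even a" if "(16 - 4 * int a) mod 8 = 0" for a :: nat
    using that by presburger
  ultimately have "even (card A)" by simp
  then show ?thesis
    using card c \<open>A \<subseteq> c\<close> unfolding leech_min_2_def
    by (intro image_eqI[of _ _ "(c, A)"]) (auto simp: octads_def eq)
qed

text \<open>If all entries were 1 or -1 the norm would be 24, so some entry has absolute value at
  least 3; then 9 + 23 = 32 fixes all absolute values, and the residues modulo 4 fix the
  signs.\<close>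

lemma leech_min_odd_case:
  assumes norm: "(\<Sum>i\<in>UNIV. (v i)\<^sup>2) = 32" and v: "\<And>i. v i = 1 + 2 * of_bool (i \<in> c) + 4 * w i"
    and c: "c \<in> golay"
  shows "v \<in> leech_min_odd"
proof -
  have odd: "odd (v i)" for i unfolding v by simp
  have vc: "v i mod 4 = (if i \<in> c then 3 else 1)" for i
    unfolding v by simp
  have "\<exists>p. 3 \<le> \<bar>v p\<bar>"
  proof (rule ccontr)
    assume not: "\<nexists>p. 3 \<le> \<bar>v p\<bar>"
    have "(v i)\<^sup>2 = 1" for i
    proof -
      have "\<bar>v i\<bar> < 3" using not by (simp add: not_le)
      moreover have "\<bar>x\<bar> = 1" if "odd x" "\<bar>x\<bar> < 3" for x :: int using that by presburger
      ultimately have "\<bar>v i\<bar> = 1" using odd by blast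
      then show ?thesis by (metis power2_abs one_power2)
    qed
    then show False using norm by simp
  qed
  then obtain p where p: "3 \<le> \<bar>v p\<bar>" ..
  have p9: "9 \<le> (v p)\<^sup>2" using power_mono[OF p, of 2] by simp
  have ge1: "1 \<le> (v i)\<^sup>2" for i
  proof -
    have "v i \<noteq> 0" using odd[of i] by auto
    then have "0 < (v i)\<^sup>2" by simp
    then show ?thesis by linarith
  qed
  define f where "f i = (v i)\<^sup>2 - (if i = p then 9 else 1)" for i
  have f0: "0 \<le> f i" for i using p9 ge1[of i] by (simp add: f_def)
  have "(\<Sum>i\<in>UNIV. (if i = p then 9 else 1 :: int)) = (\<Sum>i\<in>UNIV. 1 + (if i = p then 8 else 0))"
    by (intro sum.cong) auto
  also have "\<dots> = 32" by (simp add: sum.distrib)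
  finally have "(\<Sum>i\<in>UNIV. f i) = 0" unfolding f_def sum_subtractf norm by simp
  then have fz: "f i = 0" for i
    using sum_nonneg_zero_outside[of f "{}" i] f0 by simp
  have vp: "v p = 3 \<or> v p = - 3"
    using fz[of p] power2_eq_iff[of "v p" 3] by (simp add: f_def)
  have vi: "v i = 1 \<or> v i = - 1" if "i \<noteq> p" for i
    using fz[of i] that power2_eq_iff[of "v i" 1] by (simp add: f_def)
  have "v = odd_vec c p"
  proof
    fix i show "v i = odd_vec c p i"
      using vc[of i] vp vi[of i] by (cases "i = p"; cases "i \<in> c") (auto simp: odd_vec_def)
  qed
  then show ?thesis using c unfolding leech_min_odd_def by auto
qed

lemma leech_min_eq: "leech_min = leech_min_4 \<union> leech_min_2 \<union> leech_min_odd"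
proof
  show "leech_min \<subseteq> leech_min_4 \<union> leech_min_2 \<union> leech_min_odd"
  proof
    fix v assume "v \<in> leech_min"
    then have norm: "(\<Sum>i\<in>UNIV. (v i)\<^sup>2) = 32" and "v \<in> leech_int" by (auto simp: leech_min_def)
    obtain m c w where m: "m = 0 \<or> m = 1" and c: "c \<in> golay"
      and v: "\<And>i. v i = m + 2 * of_bool (i \<in> c) + 4 * w i" and sum: "(\<Sum>i\<in>UNIV. v i) mod 8 = 4 * m"
      using leech_intD[OF \<open>v \<in> leech_int\<close>] by blast
    consider "m = 1" | "m = 0" "c = {}" | "m = 0" "c \<noteq> {}" using m by blast
    then show "v \<in> leech_min_4 \<union> leech_min_2 \<union> leech_min_odd"
    proof cases
      case 1
      then have "v \<in> leech_min_odd" by (intro leech_min_odd_case[OF norm _ c, of w]) (simp add: v)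
      then show ?thesis by simp
    next
      case 2
      then have "v \<in> leech_min_4" by (intro leech_min_even_empty[OF norm, of w]) (simp add: v)
      then show ?thesis by simp
    next
      case 3
      then have "v \<in> leech_min_2"
        using sum by (intro leech_min_even_nonempty[OF norm _ c, of w]) (simp_all add: v)
      then show ?thesis by simp
    qed
  qed
qed (use leech_min_4_subset leech_min_2_subset leech_min_odd_subset in blast)

section \<open>Coordinate moments and the number of minimal vectors\<close>

lemma sum_signed_family:
  assumes "a \<noteq> 0" "\<And>U. U \<in> \<U> \<Longrightarrow> \<A> U \<subseteq> Pow U" "\<And>U. U \<in> \<U> \<Longrightarrow> card (\<A> U) = K"
  shows "(\<Sum>v\<in>(\<lambda>(U, A). signed_vec a U A) ` (SIGMA U:\<U>. \<A> U). (v i)\<^sup>2 * (v j)\<^sup>2) =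
    a ^ 4 * int K * int (card {U \<in> \<U>. i \<in> U \<and> j \<in> U})"
proof -
  have "inj_on (\<lambda>(U, A). signed_vec a U A) (SIGMA U:\<U>. \<A> U)"
  proof (rule inj_onI, clarify)
    fix U A V B
    assume "U \<in> \<U>" "A \<in> \<A> U" "V \<in> \<U>" "B \<in> \<A> V" and eq: "signed_vec a U A = signed_vec a V B"
    then have "A \<subseteq> U" "B \<subseteq> V" using assms(2) by blast+
    from signed_vec_inj[OF \<open>a \<noteq> 0\<close> this eq] show "U = V \<and> A = B" .
  qed
  then have "(\<Sum>v\<in>(\<lambda>(U, A). signed_vec a U A) ` (SIGMA U:\<U>. \<A> U). (v i)\<^sup>2 * (v j)\<^sup>2) =
      (\<Sum>(U, A)\<in>(SIGMA U:\<U>. \<A> U). (signed_vec a U A i)\<^sup>2 * (signed_vec a U A j)\<^sup>2)"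
    by (subst sum.reindex) (auto simp: o_def intro!: sum.cong)
  also have "\<dots> = (\<Sum>U\<in>\<U>. \<Sum>A\<in>\<A> U. (signed_vec a U A i)\<^sup>2 * (signed_vec a U A j)\<^sup>2)"
    by (subst sum.Sigma) auto
  \<comment> \<open>Squares forget signs, so every sign pattern on \<open>U\<close> contributes
    equally.\<close>
  also have "\<dots> = (\<Sum>U\<in>\<U>. \<Sum>A\<in>\<A> U. a ^ 4 * of_bool (i \<in> U \<and> j \<in> U))"
    by (intro sum.cong) (auto simp: signed_vec_def power2_eq_square power4_eq_xxxx)
  also have "\<dots> = (\<Sum>U\<in>\<U>. int K * (a ^ 4 * of_bool (i \<in> U \<and> j \<in> U)))"
    using assms(3) by (intro sum.cong) auto
  also have "\<dots> = a ^ 4 * int K * (\<Sum>U\<in>\<U>. of_bool (i \<in> U \<and> j \<in> U))"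
    by (simp only: sum_distrib_left mult_ac)
  also have "(\<Sum>U\<in>\<U>. of_bool (i \<in> U \<and> j \<in> U)) = int (card {U \<in> \<U>. i \<in> U \<and> j \<in> U})"
    by (simp add: of_bool_def sum.If_cases Int_def)
  finally show ?thesis .
qed

lemma card_pairs_containing:
  "card {U :: point set. card U = 2 \<and> i \<in> U \<and> j \<in> U} = (if i = j then 23 else 1)"
proof (cases "i = j")
  case True
  have "{U. card U = 2 \<and> i \<in> U} = (\<lambda>k. {i, k}) ` (UNIV - {i})"
  proof (intro set_eqI iffI)
    fix U assume "U \<in> {U. card U = 2 \<and> i \<in> U}"
    then obtain x y where "U = {x, y}" "x \<noteq> y" "i \<in> U" by (auto simp: card_2_iff)
    then show "U \<in> (\<lambda>k. {i, k}) ` (UNIV - {i})" by (auto simp: insert_commute)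
  qed auto
  moreover have "inj_on (\<lambda>k. {i, k}) (UNIV - {i})" by (auto simp: inj_on_def doubleton_eq_iff)
  ultimately have "card {U. card U = 2 \<and> i \<in> U} = card (UNIV - {i} :: point set)"
    by (simp add: card_image)
  then show ?thesis using True by (simp add: card_Diff_subset)
next
  case False
  have "{U. card U = 2 \<and> i \<in> U \<and> j \<in> U} = {{i, j}}"
    using False by (auto simp: card_2_iff)
  then show ?thesis using False by simp
qed

lemma card_even_subsets:
  assumes "finite U" "U \<noteq> {}"
  shows "2 * card {A. A \<subseteq> U \<and> even (card A)} = 2 ^ card U"
proof -
  have "card {A. A \<subseteq> U \<and> even (card A)} = card {A. A \<subseteq> U \<and> odd (card A)}"
    using card_subsupersets_even_odd[of U "{}"] assms by auto
  moreover have "Pow U = {A. A \<subseteq> U \<and> even (card A)} \<union> {A. A \<subseteq> U \<and> odd (card A)}" by auto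
  then have "card (Pow U) = card {A. A \<subseteq> U \<and> even (card A)} + card {A. A \<subseteq> U \<and> odd (card A)}"
    using assms by (simp only:) (subst card_Un_disjoint; auto)
  ultimately show ?thesis using assms by (simp add: card_Pow)
qed

lemma sum_leech_min_4: "(\<Sum>v\<in>leech_min_4. (v i)\<^sup>2 * (v j)\<^sup>2) = (if i = j then 23552 else 1024)"
proof -
  have "card {A. A \<subseteq> U} = 4" if "U \<in> {U :: point set. card U = 2}" for U
    using that card_Pow[of U] by (simp add: Pow_def)
  then have "(\<Sum>v\<in>leech_min_4. (v i)\<^sup>2 * (v j)\<^sup>2) = 4 ^ 4 * int 4 * int (card {U \<in> {U. card U = 2}. i \<in> U \<and> j \<in> U})"
    unfolding leech_min_4_def by (intro sum_signed_family) auto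
  then show ?thesis using card_pairs_containing[of i j] by simp
qed

lemma sum_leech_min_2: "(\<Sum>v\<in>leech_min_2. (v i)\<^sup>2 * (v j)\<^sup>2) = (if i = j then 518144 else 157696)"
proof -
  have "card {A. A \<subseteq> U \<and> even (card A)} = 128" if "U \<in> octads" for U
  proof -
    have "card U = 8" using that by (simp add: octads_def)
    moreover from this have "U \<noteq> {}" by auto
    ultimately show ?thesis using card_even_subsets[of U] by simp
  qed
  then have "(\<Sum>v\<in>leech_min_2. (v i)\<^sup>2 * (v j)\<^sup>2) = 2 ^ 4 * int 128 * int (card {U \<in> octads. i \<in> U \<and> j \<in> U})"
    unfolding leech_min_2_def by (intro sum_signed_family) auto
  then show ?thesis using card_octads_containing[of i j] by simp
qed

lemma odd_vec_inj:
  assumes "odd_vec c p = odd_vec d q"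
  shows "c = d \<and> p = q"
proof -
  have eq: "odd_vec c p i = odd_vec d q i" for i using assms by simp
  have "p = q"
    using eq[of p] by (auto simp: odd_vec_def split: if_splits)
  moreover have "i \<in> c \<longleftrightarrow> i \<in> d" for i
    using eq[of i] \<open>p = q\<close> by (auto simp: odd_vec_def split: if_splits)
  ultimately show ?thesis by blast
qed

lemma sum_leech_min_odd: "(\<Sum>v\<in>leech_min_odd. (v i)\<^sup>2 * (v j)\<^sup>2) = (if i = j then 425984 else 163840)"
proof -
  have "inj_on (\<lambda>(c, p). odd_vec c p) (golay \<times> UNIV)"
    using odd_vec_inj by (intro inj_onI) (clarify, blast)
  then have "(\<Sum>v\<in>leech_min_odd. (v i)\<^sup>2 * (v j)\<^sup>2) = (\<Sum>(c, p)\<in>golay \<times> UNIV. (odd_vec c p i)\<^sup>2 * (odd_vec c p j)\<^sup>2)"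
    unfolding leech_min_odd_def by (subst sum.reindex) (auto simp: o_def intro!: sum.cong)
  also have "\<dots> = (\<Sum>c\<in>golay. \<Sum>p\<in>UNIV. (odd_vec c p i)\<^sup>2 * (odd_vec c p j)\<^sup>2)"
    by (subst sum.cartesian_product) simp
  \<comment> \<open>The product is 1 unless \<open>p\<close> is \<open>i\<close> or
    \<open>j\<close>; the corrections are 81 - 1 = 80 when both coincide with \<open>p\<close>, and
    9 - 1 = 8 when one does.\<close>
  also have "\<dots> = (\<Sum>c\<in>golay. \<Sum>p\<in>UNIV. 1 + (if p = i then (if i = j then 80 else 8) else 0) + (if p = j then (if i = j then 0 else 8) else 0))"
    by (intro sum.cong) (auto simp: odd_vec_def)
  also have "\<dots> = (if i = j then 425984 else 163840)"
    by (simp add: sum.distrib card_golay)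
  finally show ?thesis .
qed

lemma finite_leech_min_parts: "finite leech_min_4" "finite leech_min_2" "finite leech_min_odd"
  unfolding leech_min_4_def leech_min_2_def leech_min_odd_def by (intro finite_imageI finite)+

lemma finite_leech_min: "finite leech_min"
  unfolding leech_min_eq using finite_leech_min_parts by blast

lemma leech_min_parts_disjoint:
  "leech_min_4 \<inter> leech_min_2 = {}" "(leech_min_4 \<union> leech_min_2) \<inter> leech_min_odd = {}"
proof -
  have 4: "4 dvd v i" if "v \<in> leech_min_4" for v i
    using that by (auto simp: leech_min_4_def signed_vec_def)
  have 2: "even (v i)" if "v \<in> leech_min_2" for v i
    using that by (auto simp: leech_min_2_def signed_vec_def)
  have odd: "odd (v i)" if v: "v \<in> leech_min_odd" for v i
  proof -
    obtain c p where "v = odd_vec c p" using v by (auto simp: leech_min_odd_def)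
    then show ?thesis by (cases "i \<in> c"; cases "i = p") (simp_all add: odd_vec_def)
  qed
  have not4: "\<exists>i. \<not> 4 dvd v i" if v: "v \<in> leech_min_2" for v
  proof -
    obtain U A where U: "U \<in> octads" "v = signed_vec 2 U A" using v by (auto simp: leech_min_2_def)
    then have "U \<noteq> {}" by (auto simp: octads_def)
    then obtain i where "i \<in> U" by blast
    then show ?thesis using U by (intro exI[of _ i]) (auto simp: signed_vec_def)
  qed
  show "leech_min_4 \<inter> leech_min_2 = {}" using 4 not4 by blast
  have "even (v i)" if "v \<in> leech_min_4" for v i
  proof -
    have "(2::int) dvd 4" by simp
    then show ?thesis using 4[OF that] by (rule dvd_trans)
  qed
  then show "(leech_min_4 \<union> leech_min_2) \<inter> leech_min_odd = {}" using 2 odd by blast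
qed

text \<open>The diagonal value is three times the other one, the ratio of a rotation-invariant
  fourth moment. This is what cancels the quartic remainder in
  \<open>leech_min_moment_4\<close>.\<close>

lemma sum_leech_min_squares:
  "(\<Sum>v\<in>leech_min. (v i)\<^sup>2 * (v j)\<^sup>2) = (if i = j then 967680 else 322560)"
proof -
  have "(\<Sum>v\<in>leech_min. (v i)\<^sup>2 * (v j)\<^sup>2) = (\<Sum>v\<in>leech_min_4. (v i)\<^sup>2 * (v j)\<^sup>2) +
    (\<Sum>v\<in>leech_min_2. (v i)\<^sup>2 * (v j)\<^sup>2) + (\<Sum>v\<in>leech_min_odd. (v i)\<^sup>2 * (v j)\<^sup>2)"
    unfolding leech_min_eq
    by (simp add: sum.union_disjoint finite_leech_min_parts leech_min_parts_disjoint)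
  then show ?thesis by (simp add: sum_leech_min_4 sum_leech_min_2 sum_leech_min_odd)
qed

text \<open>Summing the previous lemma over \<open>j\<close> replaces one factor by the norm 32. The
  same step again counts the minimal vectors in \<open>card_leech_min\<close>.\<close>

lemma sum_leech_min_square: "(\<Sum>v\<in>leech_min. (v i)\<^sup>2) = 262080"
proof -
  have "32 * (\<Sum>v\<in>leech_min. (v i)\<^sup>2) = (\<Sum>v\<in>leech_min. (v i)\<^sup>2 * (\<Sum>j\<in>UNIV. (v j)\<^sup>2))"
    by (simp add: sum_distrib_left leech_min_def mult.commute[of 32])
  also have "\<dots> = (\<Sum>j\<in>UNIV. \<Sum>v\<in>leech_min. (v i)\<^sup>2 * (v j)\<^sup>2)"
    unfolding sum_distrib_left by (rule sum.swap)
  also have "\<dots> = (\<Sum>j\<in>UNIV. 322560 + (if i = j then 645120 else 0))"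
    by (intro sum.cong) (auto simp: sum_leech_min_squares)
  finally show ?thesis by (simp add: sum.distrib)
qed

lemma card_leech_min: "card leech_min = 196560"
proof -
  have "32 * int (card leech_min) = (\<Sum>v\<in>leech_min. \<Sum>i\<in>UNIV. (v i)\<^sup>2)"
    by (simp add: leech_min_def)
  also have "\<dots> = (\<Sum>i\<in>UNIV. \<Sum>v\<in>leech_min. (v i)\<^sup>2)" by (rule sum.swap)
  finally show ?thesis by (simp add: sum_leech_min_square)
qed

section \<open>Moments of the Leech lattice kissing configuration\<close>

text \<open>The factor combines the lattice scaling by \<open>sqrt 8\<close> with the length 2 of
  minimal vectors.\<close>

definition leech_vec :: "(point \<Rightarrow> int) \<Rightarrow> real ^ point" where
  "leech_vec v = (1 / sqrt 32) *\<^sub>R (\<chi> i. real_of_int (v i))"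

lemma inner_scaled_int_vec:
  "(a *\<^sub>R (\<chi> i. real_of_int (u i))) \<bullet> (b *\<^sub>R (\<chi> i. real_of_int (v i))) =
     a * b * real_of_int (\<Sum>i\<in>UNIV. u i * v i)"
proof -
  have "(a *\<^sub>R (\<chi> i. real_of_int (u i))) \<bullet> (b *\<^sub>R (\<chi> i. real_of_int (v i))) =
      (\<Sum>i\<in>UNIV. a * b * (real_of_int (u i) * real_of_int (v i)))"
    unfolding inner_vec_def by (intro sum.cong) auto
  then show ?thesis by (simp add: sum_distrib_left)
qed

lemma inner_leech_vec: "leech_vec u \<bullet> leech_vec v = real_of_int (\<Sum>i\<in>UNIV. u i * v i) / 32"
  unfolding leech_vec_def inner_scaled_int_vec by simp

lemma inj_leech_vec: "inj leech_vec"
  unfolding leech_vec_def inj_def by (simp add: vec_eq_iff fun_eq_iff)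

lemma leech_code_eq: "leech_code = leech_vec ` leech_min"
proof -
  define s where "s v = (1 / sqrt 8) *\<^sub>R (\<chi> i. real_of_int (v i) :: real ^ point)" for v :: "point \<Rightarrow> int"
  have lattice: "leech_lattice = s ` leech_int"
    unfolding leech_lattice_def leech_int_def s_def by blast
  have nsq: "(norm (s v))\<^sup>2 = real_of_int (\<Sum>i\<in>UNIV. (v i)\<^sup>2) / 8" for v
    unfolding power2_norm_eq_inner s_def inner_scaled_int_vec by (simp add: power2_eq_square)
  have s0: "s v = 0 \<longleftrightarrow> v = (\<lambda>i. 0)" for v
    unfolding s_def by (auto simp: vec_eq_iff)
  have le: "norm (s u) \<le> norm (s v) \<longleftrightarrow> (\<Sum>i\<in>UNIV. (u i)\<^sup>2) \<le> (\<Sum>i\<in>UNIV. (v i)\<^sup>2)" for u v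
  proof -
    have "norm (s u) \<le> norm (s v) \<longleftrightarrow> (norm (s u))\<^sup>2 \<le> (norm (s v))\<^sup>2"
      by (simp add: abs_le_square_iff[symmetric])
    then show ?thesis unfolding nsq by (simp del: of_int_sum)
  qed
  have minimal: "{x \<in> leech_lattice. x \<noteq> 0 \<and> (\<forall>y \<in> leech_lattice. y \<noteq> 0 \<longrightarrow> norm x \<le> norm y)} = s ` leech_min"
  proof -
    obtain w where w: "w \<in> leech_min" using card_leech_min by fastforce
    have w0: "w \<noteq> (\<lambda>i. 0)" using w by (auto simp: leech_min_def)
    define Q where "Q v \<longleftrightarrow> v \<noteq> (\<lambda>i. 0) \<and>
        (\<forall>u\<in>leech_int. u \<noteq> (\<lambda>i. 0) \<longrightarrow> (\<Sum>i\<in>UNIV. (v i)\<^sup>2) \<le> (\<Sum>i\<in>UNIV. (u i)\<^sup>2))" for v :: "point \<Rightarrow> int"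
    have Q: "Q v \<longleftrightarrow> (\<Sum>i\<in>UNIV. (v i)\<^sup>2) = 32" if "v \<in> leech_int" for v
    proof
      assume "Q v"
      then have "(\<Sum>i\<in>UNIV. (v i)\<^sup>2) \<le> (\<Sum>i\<in>UNIV. (w i)\<^sup>2)" "v \<noteq> (\<lambda>i. 0)"
        using w w0 unfolding Q_def leech_min_def by blast+
      then show "(\<Sum>i\<in>UNIV. (v i)\<^sup>2) = 32"
        using leech_int_norm_ge[OF \<open>v \<in> leech_int\<close>] w by (simp add: leech_min_def)
    next
      assume 32: "(\<Sum>i\<in>UNIV. (v i)\<^sup>2) = 32"
      then have "v \<noteq> (\<lambda>i. 0)" by auto
      then show "Q v" unfolding Q_def 32 using leech_int_norm_ge by blast
    qed
    define P where "P x \<longleftrightarrow> x \<noteq> 0 \<and> (\<forall>y \<in> s ` leech_int. y \<noteq> 0 \<longrightarrow> norm x \<le> norm y)" for x :: "real ^ point"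
    have PQ: "P (s v) \<longleftrightarrow> Q v" for v
      unfolding P_def Q_def by (simp only: s0 le ball_simps)
    have "{x \<in> s ` leech_int. P x} = s ` {v \<in> leech_int. P (s v)}" by blast
    also have "\<dots> = s ` {v \<in> leech_int. Q v}" unfolding PQ ..
    also have "{v \<in> leech_int. Q v} = leech_min" using Q by (auto simp: leech_min_def)
    finally show ?thesis unfolding lattice P_def .
  qed
  have "sgn (s v) = leech_vec v" if "v \<in> leech_min" for v
  proof -
    have "(norm (s v))\<^sup>2 = 2\<^sup>2" using that unfolding nsq by (simp add: leech_min_def del: of_int_sum)
    then have "norm (s v) = 2" by (rule power2_eq_imp_eq) auto
    moreover have "sqrt 32 = 2 * sqrt 8" using real_sqrt_mult[of 4 8] by simp
    ultimately show ?thesis by (simp add: sgn_div_norm s_def leech_vec_def)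
  qed
  then have "sgn ` s ` leech_min = leech_vec ` leech_min" by (force simp: image_iff)
  then show ?thesis unfolding leech_code_def minimal .
qed

lemma card_leech_code: "card leech_code = 196560"
  unfolding leech_code_eq using card_leech_min inj_leech_vec
  by (simp add: card_image inj_on_subset)

lemma finite_leech_code: "finite leech_code"
  unfolding leech_code_eq by (simp add: finite_leech_min)

lemma leech_code_norm: "x \<in> leech_code \<Longrightarrow> norm x = 1"
  by (auto simp: leech_code_def norm_sgn)

lemma leech_code_inner_self: "x \<in> leech_code \<Longrightarrow> x \<bullet> x = 1"
  using leech_code_norm by (simp add: norm_eq_1)

lemma leech_code_uminus: "x \<in> leech_code \<Longrightarrow> - x \<in> leech_code"
proof -
  assume "x \<in> leech_code"
  then obtain v where v: "v \<in> leech_min" "x = leech_vec v" unfolding leech_code_eq by blast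
  then have "(\<lambda>i. - v i) \<in> leech_min" using leech_int_uminus by (simp add: leech_min_def)
  moreover have "- x = leech_vec (\<lambda>i. - v i)" by (simp add: v leech_vec_def vec_eq_iff)
  ultimately show ?thesis unfolding leech_code_eq by blast
qed

text \<open>The norm of \<open>u - v\<close> is 64 minus twice the inner product and is at least 32
  unless \<open>u = v\<close>. At inner product 16 it is exactly 32.\<close>

lemma leech_min_inner:
  assumes u: "u \<in> leech_min" and v: "v \<in> leech_min"
  shows "(\<Sum>i\<in>UNIV. u i * v i) \<le> 16 \<or> u = v"
    and "(\<Sum>i\<in>UNIV. u i * v i) = 16 \<Longrightarrow> (\<lambda>i. u i - v i) \<in> leech_min"
proof -
  have d: "(\<lambda>i. u i - v i) \<in> leech_int" using leech_int_diff u v by (simp add: leech_min_def)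
  have "(\<Sum>i\<in>UNIV. (u i - v i)\<^sup>2) = (\<Sum>i\<in>UNIV. (u i)\<^sup>2) + (\<Sum>i\<in>UNIV. (v i)\<^sup>2) - 2 * (\<Sum>i\<in>UNIV. u i * v i)"
    by (simp add: power2_diff sum.distrib sum_subtractf sum_distrib_left mult.assoc)
  then have n: "(\<Sum>i\<in>UNIV. (u i - v i)\<^sup>2) = 64 - 2 * (\<Sum>i\<in>UNIV. u i * v i)"
    using u v by (simp add: leech_min_def)
  show "(\<Sum>i\<in>UNIV. u i * v i) \<le> 16 \<or> u = v"
  proof (cases "u = v")
    case False
    then have "(\<lambda>i. u i - v i) \<noteq> (\<lambda>i. 0)" by (auto simp: fun_eq_iff)
    then show ?thesis using leech_int_norm_ge[OF d] unfolding n by linarith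
  qed simp
  show "(\<lambda>i. u i - v i) \<in> leech_min" if "(\<Sum>i\<in>UNIV. u i * v i) = 16"
    using d n that by (simp add: leech_min_def)
qed

lemma leech_code_inner:
  assumes x: "x \<in> leech_code" and y: "y \<in> leech_code" and "x \<noteq> y" "x \<noteq> - y"
  shows "x \<bullet> y \<in> {-1/2, -1/4, 0, 1/4, 1/2}"
proof -
  obtain u where u: "u \<in> leech_min" "x = leech_vec u" using x unfolding leech_code_eq by blast
  obtain v where v: "v \<in> leech_min" "y = leech_vec v" using y unfolding leech_code_eq by blast
  have mv: "(\<lambda>i. - v i) \<in> leech_min" using leech_int_uminus v by (simp add: leech_min_def)
  have "- y = leech_vec (\<lambda>i. - v i)" by (simp add: v leech_vec_def vec_eq_iff)
  then have ne: "u \<noteq> v" "u \<noteq> (\<lambda>i. - v i)" using assms(3,4) u v by auto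
  obtain k where k: "(\<Sum>i\<in>UNIV. u i * v i) = 8 * k"
    using leech_int_inner_dvd[of u v] u v by (auto simp: leech_min_def elim: dvdE)
  have "8 * k \<le> 16" using leech_min_inner(1)[OF u(1) v(1)] ne k by simp
  moreover have "- (8 * k) \<le> 16" using leech_min_inner(1)[OF u(1) mv] ne k by (simp add: sum_negf)
  ultimately have "k \<in> {-2, -1, 0, 1, 2}" by auto
  moreover have "x \<bullet> y = real_of_int k / 4" unfolding u v inner_leech_vec k by simp
  ultimately show ?thesis by auto
qed

text \<open>The map from \<open>y\<close> to \<open>x - y\<close> is the source of the antipodality
  of the 4600-point code, and it sharpens the list of its inner products.\<close>

lemma leech_code_diff:
  assumes x: "x \<in> leech_code" and y: "y \<in> leech_code" and "x \<bullet> y = 1 / 2"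
  shows "x - y \<in> leech_code"
proof -
  obtain u where u: "u \<in> leech_min" "x = leech_vec u" using x unfolding leech_code_eq by blast
  obtain v where v: "v \<in> leech_min" "y = leech_vec v" using y unfolding leech_code_eq by blast
  have "real_of_int (\<Sum>i\<in>UNIV. u i * v i) = 16" using assms(3) unfolding u v inner_leech_vec by simp
  then have "(\<Sum>i\<in>UNIV. u i * v i) = 16" by linarith
  then have "(\<lambda>i. u i - v i) \<in> leech_min" by (rule leech_min_inner(2)[OF u(1) v(1)])
  moreover have "x - y = leech_vec (\<lambda>i. u i - v i)"
    by (simp add: u v leech_vec_def vec_eq_iff diff_divide_distrib)
  ultimately show ?thesis unfolding leech_code_eq by blast
qed

section \<open>Second and fourth moments by averaging over sign changes\<close>

lemma sum_of_bool_eq_mult: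
  fixes g :: "'a::finite \<Rightarrow> real"
  shows "(\<Sum>l\<in>UNIV. g l * of_bool (k = l)) = g k"
  by (simp add: of_bool_def if_distrib[of "\<lambda>x. _ * x"] cong: if_cong)

lemma golay_sign_moment_2:
  "(\<Sum>c\<in>golay. (\<Sum>i\<in>UNIV. support_sign c i * a i)\<^sup>2) = 4096 * (\<Sum>i\<in>UNIV. (a i)\<^sup>2)"
proof -
  have "(\<Sum>c\<in>golay. (\<Sum>i\<in>UNIV. support_sign c i * a i)\<^sup>2) =
    (\<Sum>c\<in>golay. \<Sum>i\<in>UNIV. \<Sum>j\<in>UNIV. a i * a j * (support_sign c i * support_sign c j))"
    by (simp add: power2_eq_square sum_product mult_ac)
  also have "\<dots> = (\<Sum>i\<in>UNIV. \<Sum>j\<in>UNIV. a i * a j * (\<Sum>c\<in>golay. support_sign c i * support_sign c j))"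
    unfolding sum_distrib_left by (subst sum.swap, rule sum.cong[OF refl], rule sum.swap)
  also have "\<dots> = (\<Sum>i\<in>UNIV. \<Sum>j\<in>UNIV. 4096 * a i * a j * of_bool (i = j))"
    by (intro sum.cong) (auto simp: golay_character_sum_2 card_golay)
  also have "\<dots> = 4096 * (\<Sum>i\<in>UNIV. (a i)\<^sup>2)"
    unfolding sum_of_bool_eq_mult sum_distrib_left by (simp add: power2_eq_square mult_ac)
  finally show ?thesis .
qed

text \<open>Each of the three index pairings in \<open>golay_character_sum_4\<close> yields the
  square of the quadratic sum; its correction term yields the quartic sum.\<close>

lemma golay_sign_moment_4:
  "(\<Sum>c\<in>golay. (\<Sum>i\<in>UNIV. support_sign c i * a i) ^ 4) =
     4096 * (3 * (\<Sum>i\<in>UNIV. (a i)\<^sup>2)\<^sup>2 - 2 * (\<Sum>i\<in>UNIV. (a i) ^ 4))"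
proof -
  define b where "b i j k l = a i * a j * (a k * a l)" for i j k l
  have sq: "(\<Sum>i\<in>UNIV. (a i)\<^sup>2)\<^sup>2 = (\<Sum>i\<in>UNIV. \<Sum>j\<in>UNIV. (a i)\<^sup>2 * (a j)\<^sup>2)"
    by (simp only: power2_eq_square[of "\<Sum>i\<in>UNIV. (a i)\<^sup>2"] sum_product)
  have "(\<Sum>i\<in>UNIV. support_sign c i * a i) ^ 4 =
      (\<Sum>i\<in>UNIV. \<Sum>j\<in>UNIV. \<Sum>k\<in>UNIV. \<Sum>l\<in>UNIV.
        b i j k l * (support_sign c i * support_sign c j * (support_sign c k * support_sign c l)))" for c
  proof -
    have "(\<Sum>i\<in>UNIV. support_sign c i * a i) ^ 4 =
        (\<Sum>i\<in>UNIV. \<Sum>j\<in>UNIV. (support_sign c i * a i) * (support_sign c j * a j)) *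
        (\<Sum>k\<in>UNIV. \<Sum>l\<in>UNIV. (support_sign c k * a k) * (support_sign c l * a l))"
      unfolding sum_product[symmetric] by (simp add: power4_eq_xxxx)
    also have "\<dots> = (\<Sum>i\<in>UNIV. \<Sum>j\<in>UNIV. \<Sum>k\<in>UNIV. \<Sum>l\<in>UNIV.
        ((support_sign c i * a i) * (support_sign c j * a j)) * ((support_sign c k * a k) * (support_sign c l * a l)))"
      unfolding sum_distrib_right unfolding sum_distrib_left ..
    also have "\<dots> = (\<Sum>i\<in>UNIV. \<Sum>j\<in>UNIV. \<Sum>k\<in>UNIV. \<Sum>l\<in>UNIV.
        b i j k l * (support_sign c i * support_sign c j * (support_sign c k * support_sign c l)))"
      by (intro sum.cong refl) (simp add: b_def mult_ac)
    finally show ?thesis .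
  qed
  then have "(\<Sum>c\<in>golay. (\<Sum>i\<in>UNIV. support_sign c i * a i) ^ 4) =
      (\<Sum>i\<in>UNIV. \<Sum>j\<in>UNIV. \<Sum>k\<in>UNIV. \<Sum>l\<in>UNIV. \<Sum>c\<in>golay.
        b i j k l * (support_sign c i * support_sign c j * (support_sign c k * support_sign c l)))"
    by (simp only: sum.swap[of _ UNIV golay])
  also have "\<dots> = (\<Sum>i\<in>UNIV. \<Sum>j\<in>UNIV. \<Sum>k\<in>UNIV. \<Sum>l\<in>UNIV.
        4096 * b i j k l * of_bool (i = j) * of_bool (k = l) + 4096 * b i j k l * of_bool (i = k) * of_bool (j = l)
        + 4096 * b i j k l * of_bool (j = k) * of_bool (i = l) - 8192 * b i j k l * of_bool (i = j) * of_bool (j = k) * of_bool (k = l))"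
    by (intro sum.cong refl, subst sum_distrib_left[symmetric], subst golay_character_sum_4)
       (simp add: card_golay of_bool_conj algebra_simps)
  also have "\<dots> = (\<Sum>i\<in>UNIV. \<Sum>j\<in>UNIV. \<Sum>k\<in>UNIV. 4096 * b i j k k * of_bool (i = j)) +
      (\<Sum>i\<in>UNIV. \<Sum>j\<in>UNIV. 4096 * b i j i j) + (\<Sum>i\<in>UNIV. \<Sum>j\<in>UNIV. 4096 * b i j j i)
      - (\<Sum>i\<in>UNIV. 8192 * b i i i i)"
    unfolding sum.distrib sum_subtractf sum_of_bool_eq_mult ..
  also have "(\<Sum>i\<in>UNIV. \<Sum>j\<in>UNIV. \<Sum>k\<in>UNIV. 4096 * b i j k k * of_bool (i = j)) = (\<Sum>i\<in>UNIV. \<Sum>k\<in>UNIV. 4096 * b i i k k)"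
    unfolding sum_distrib_right[symmetric] sum_of_bool_eq_mult ..
  also have "(\<Sum>i\<in>UNIV. \<Sum>k\<in>UNIV. 4096 * b i i k k) = 4096 * (\<Sum>i\<in>UNIV. (a i)\<^sup>2)\<^sup>2"
    unfolding sq sum_distrib_left by (intro sum.cong refl) (simp add: b_def power2_eq_square)
  also have "(\<Sum>i\<in>UNIV. \<Sum>j\<in>UNIV. 4096 * b i j i j) = 4096 * (\<Sum>i\<in>UNIV. (a i)\<^sup>2)\<^sup>2"
    unfolding sq sum_distrib_left by (intro sum.cong refl) (simp add: b_def power2_eq_square mult_ac)
  also have "(\<Sum>i\<in>UNIV. \<Sum>j\<in>UNIV. 4096 * b i j j i) = 4096 * (\<Sum>i\<in>UNIV. (a i)\<^sup>2)\<^sup>2"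
    unfolding sq sum_distrib_left by (intro sum.cong refl) (simp add: b_def power2_eq_square mult_ac)
  also have "(\<Sum>i\<in>UNIV. 8192 * b i i i i) = 8192 * (\<Sum>i\<in>UNIV. (a i) ^ 4)"
    unfolding sum_distrib_left by (intro sum.cong refl) (simp add: b_def power4_eq_xxxx mult_ac)
  finally show ?thesis by simp
qed

lemma leech_min_sign_average:
  fixes u :: "point \<Rightarrow> real"
  shows "4096 * (\<Sum>v\<in>leech_min. (\<Sum>i\<in>UNIV. u i * real_of_int (v i)) ^ k) =
    (\<Sum>v\<in>leech_min. \<Sum>c\<in>golay. (\<Sum>i\<in>UNIV. support_sign c i * (u i * real_of_int (v i))) ^ k)"
proof -
  have "(\<Sum>v\<in>leech_min. (\<Sum>i\<in>UNIV. u i * real_of_int (v i)) ^ k) =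
      (\<Sum>v\<in>leech_min. (\<Sum>i\<in>UNIV. support_sign c i * (u i * real_of_int (v i))) ^ k)" if c: "c \<in> golay" for c
  proof -
    define T where "T v = (\<lambda>i. if i \<in> c then - v i else v i)" for v :: "point \<Rightarrow> int"
    have TT: "T (T v) = v" for v by (auto simp: T_def)
    have "(\<Sum>i\<in>UNIV. (T v i)\<^sup>2) = (\<Sum>i\<in>UNIV. (v i)\<^sup>2)" for v
      by (intro sum.cong) (auto simp: T_def)
    then have T: "T v \<in> leech_min" if "v \<in> leech_min" for v
      using leech_int_sign_change[OF _ c, of v] that by (simp add: leech_min_def T_def)
    show ?thesis
    proof (rule sum.reindex_bij_witness[of _ T T])
      fix v
      show "(\<Sum>i\<in>UNIV. support_sign c i * (u i * real_of_int (T v i))) ^ k = (\<Sum>i\<in>UNIV. u i * real_of_int (v i)) ^ k"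
        by (intro arg_cong[of _ _ "\<lambda>x. x ^ k"] sum.cong) (auto simp: T_def support_sign_def)
    qed (auto simp: TT T)
  qed
  then have "(\<Sum>c\<in>golay. \<Sum>v\<in>leech_min. (\<Sum>i\<in>UNIV. u i * real_of_int (v i)) ^ k) =
      (\<Sum>c\<in>golay. \<Sum>v\<in>leech_min. (\<Sum>i\<in>UNIV. support_sign c i * (u i * real_of_int (v i))) ^ k)"
    by (rule sum.cong[OF refl])
  then show ?thesis by (simp only: sum.swap[of _ leech_min golay] sum_constant card_golay of_nat_numeral)
qed

lemma leech_min_moment_2:
  fixes u :: "point \<Rightarrow> real"
  shows "(\<Sum>v\<in>leech_min. (\<Sum>i\<in>UNIV. u i * real_of_int (v i))\<^sup>2) = 262080 * (\<Sum>i\<in>UNIV. (u i)\<^sup>2)"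
proof -
  have "4096 * (\<Sum>v\<in>leech_min. (\<Sum>i\<in>UNIV. u i * real_of_int (v i))\<^sup>2) =
      (\<Sum>v\<in>leech_min. 4096 * (\<Sum>i\<in>UNIV. (u i)\<^sup>2 * real_of_int ((v i)\<^sup>2)))"
    unfolding leech_min_sign_average golay_sign_moment_2 by (simp add: power_mult_distrib)
  also have "\<dots> = 4096 * (\<Sum>i\<in>UNIV. (u i)\<^sup>2 * real_of_int (\<Sum>v\<in>leech_min. (v i)\<^sup>2))"
    unfolding sum_distrib_left[symmetric] unfolding of_int_sum unfolding sum_distrib_left[of "(u _)\<^sup>2"]
    by (intro arg_cong2[where f="(*)"] refl sum.swap)
  finally show ?thesis unfolding sum_leech_min_square sum_distrib_right[symmetric] by simp
qed

lemma leech_min_moment_4: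
  fixes u :: "point \<Rightarrow> real"
  shows "(\<Sum>v\<in>leech_min. (\<Sum>i\<in>UNIV. u i * real_of_int (v i)) ^ 4) = 967680 * (\<Sum>i\<in>UNIV. (u i)\<^sup>2)\<^sup>2"
proof -
  have F: "(\<Sum>v\<in>leech_min. real_of_int ((v i)\<^sup>2 * (v j)\<^sup>2)) = (322560 + 645120 * of_bool (i = j))" for i j
    unfolding of_int_sum[symmetric] sum_leech_min_squares by simp
  have 1: "(\<Sum>v\<in>leech_min. (\<Sum>i\<in>UNIV. (u i * real_of_int (v i))\<^sup>2)\<^sup>2) =
      322560 * (\<Sum>i\<in>UNIV. (u i)\<^sup>2)\<^sup>2 + 645120 * (\<Sum>i\<in>UNIV. (u i) ^ 4)"
  proof -
    have "(\<Sum>v\<in>leech_min. (\<Sum>i\<in>UNIV. (u i * real_of_int (v i))\<^sup>2)\<^sup>2) =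
        (\<Sum>v\<in>leech_min. \<Sum>i\<in>UNIV. \<Sum>j\<in>UNIV. (u i)\<^sup>2 * (u j)\<^sup>2 * real_of_int ((v i)\<^sup>2 * (v j)\<^sup>2))"
      unfolding power2_eq_square[of "sum _ _"] sum_product
      by (intro sum.cong refl) (simp add: power_mult_distrib)
    also have "\<dots> = (\<Sum>i\<in>UNIV. \<Sum>j\<in>UNIV. (u i)\<^sup>2 * (u j)\<^sup>2 * (\<Sum>v\<in>leech_min. real_of_int ((v i)\<^sup>2 * (v j)\<^sup>2)))"
      unfolding sum_distrib_left by (subst sum.swap, rule sum.cong[OF refl], rule sum.swap)
    also have "\<dots> = (\<Sum>i\<in>UNIV. \<Sum>j\<in>UNIV. 322560 * ((u i)\<^sup>2 * (u j)\<^sup>2) + 645120 * ((u i)\<^sup>2 * (u j)\<^sup>2) * of_bool (i = j))"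
      unfolding F by (intro sum.cong refl) (simp add: algebra_simps)
    also have "\<dots> = (\<Sum>i\<in>UNIV. \<Sum>j\<in>UNIV. 322560 * ((u i)\<^sup>2 * (u j)\<^sup>2)) + (\<Sum>i\<in>UNIV. 645120 * ((u i)\<^sup>2 * (u i)\<^sup>2))"
      unfolding sum.distrib sum_of_bool_eq_mult ..
    also have "(\<Sum>i\<in>UNIV. \<Sum>j\<in>UNIV. 322560 * ((u i)\<^sup>2 * (u j)\<^sup>2)) = 322560 * (\<Sum>i\<in>UNIV. (u i)\<^sup>2)\<^sup>2"
      unfolding power2_eq_square[of "sum _ _"] sum_product by (simp add: sum_distrib_left)
    also have "(\<Sum>i\<in>UNIV. 645120 * ((u i)\<^sup>2 * (u i)\<^sup>2)) = 645120 * (\<Sum>i\<in>UNIV. (u i) ^ 4)"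
      unfolding sum_distrib_left by (intro sum.cong refl) (simp add: power4_eq_xxxx power2_eq_square mult_ac)
    finally show ?thesis .
  qed
  have 2: "(\<Sum>v\<in>leech_min. \<Sum>i\<in>UNIV. (u i * real_of_int (v i)) ^ 4) = 967680 * (\<Sum>i\<in>UNIV. (u i) ^ 4)"
  proof -
    have "(\<Sum>v\<in>leech_min. \<Sum>i\<in>UNIV. (u i * real_of_int (v i)) ^ 4) =
        (\<Sum>v\<in>leech_min. \<Sum>i\<in>UNIV. (u i) ^ 4 * real_of_int ((v i)\<^sup>2 * (v i)\<^sup>2))"
      by (intro sum.cong refl) (simp add: power_mult_distrib power4_eq_xxxx power2_eq_square)
    also have "\<dots> = (\<Sum>i\<in>UNIV. (u i) ^ 4 * (\<Sum>v\<in>leech_min. real_of_int ((v i)\<^sup>2 * (v i)\<^sup>2)))"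
      unfolding sum_distrib_left by (rule sum.swap)
    finally show ?thesis unfolding F by (simp flip: sum_distrib_right)
  qed
  have "4096 * (\<Sum>v\<in>leech_min. (\<Sum>i\<in>UNIV. u i * real_of_int (v i)) ^ 4) =
      4096 * (3 * (\<Sum>v\<in>leech_min. (\<Sum>i\<in>UNIV. (u i * real_of_int (v i))\<^sup>2)\<^sup>2)
        - 2 * (\<Sum>v\<in>leech_min. \<Sum>i\<in>UNIV. (u i * real_of_int (v i)) ^ 4))"
    unfolding leech_min_sign_average golay_sign_moment_4
    by (simp only: sum_distrib_left[symmetric] sum_subtractf)
  \<comment> \<open>The quartic terms cancel because 3 * 645120 = 2 * 967680.\<close>
  then show ?thesis unfolding 1 2 by simp
qed

lemma leech_code_moment_2: "(\<Sum>y\<in>leech_code. (u \<bullet> y)\<^sup>2) = 8190 * (norm u)\<^sup>2"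
  and leech_code_moment_4: "(\<Sum>y\<in>leech_code. (u \<bullet> y) ^ 4) = 945 * norm u ^ 4"
proof -
  have s: "(\<Sum>y\<in>leech_code. (u \<bullet> y) ^ k) = (1 / sqrt 32) ^ k * (\<Sum>v\<in>leech_min. (\<Sum>i\<in>UNIV. u $ i * real_of_int (v i)) ^ k)" for k
  proof -
    have "u \<bullet> leech_vec v = (1 / sqrt 32) * (\<Sum>i\<in>UNIV. u $ i * real_of_int (v i))" for v
      unfolding leech_vec_def inner_scaleR_right by (simp add: inner_vec_def)
    then have "(u \<bullet> leech_vec v) ^ k = (1 / sqrt 32) ^ k * (\<Sum>i\<in>UNIV. u $ i * real_of_int (v i)) ^ k" for v
      by (simp only: power_mult_distrib)
    moreover have "inj_on leech_vec leech_min" using inj_leech_vec inj_on_subset by blast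
    ultimately show ?thesis
      unfolding leech_code_eq sum_distrib_left by (subst sum.reindex) (simp_all only: o_def)
  qed
  have n: "(\<Sum>i\<in>UNIV. (u $ i)\<^sup>2) = (norm u)\<^sup>2"
    unfolding power2_norm_eq_inner by (simp add: inner_vec_def power2_eq_square)
  have p2: "(1 / sqrt 32)\<^sup>2 = (1 / 32 :: real)" by (simp add: power_divide)
  then have "((1 / sqrt 32)\<^sup>2)\<^sup>2 = (1 / 1024 :: real)" by (simp add: power2_eq_square)
  then have p4: "(1 / sqrt 32) ^ 4 = (1 / 1024 :: real)" by (simp flip: power_mult)
  show "(\<Sum>y\<in>leech_code. (u \<bullet> y)\<^sup>2) = 8190 * (norm u)\<^sup>2"
    unfolding s leech_min_moment_2 n p2 by simp
  show "(\<Sum>y\<in>leech_code. (u \<bullet> y) ^ 4) = 945 * norm u ^ 4"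
    unfolding s leech_min_moment_4 n p4 by (simp flip: power_mult)
qed

section \<open>Moments of degree 6, 8 and 10\<close>

lemma unit_neq_uminus: "norm x = 1 \<Longrightarrow> x \<noteq> - x" for x :: "'a::real_inner"
proof
  assume "norm x = 1" "x = - x"
  from \<open>x = - x\<close> have "x \<bullet> x = x \<bullet> (- x)" by (rule arg_cong)
  then have "x \<bullet> x = - (x \<bullet> x)" by (simp only: inner_minus_right)
  then show False using \<open>norm x = 1\<close> by (simp add: norm_eq_1)
qed

lemma leech_code_unit_inner:
  assumes "x \<in> leech_code" "y \<in> leech_code"
  shows "x \<bullet> y \<in> {-1, -1/2, -1/4, 0, 1/4, 1/2, 1}"
    and "x \<bullet> y = 1 \<longleftrightarrow> y = x" "x \<bullet> y = - 1 \<longleftrightarrow> y = - x"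
proof -
  have xx: "x \<bullet> x = 1" using assms leech_code_inner_self by blast
  have in5: "x \<bullet> y \<in> {-1/2, -1/4, 0, 1/4, 1/2}" if "y \<noteq> x" "y \<noteq> - x"
    using leech_code_inner[OF assms] that by (metis minus_minus)
  have ne: "x \<noteq> - x" using unit_neq_uminus leech_code_norm assms by blast
  consider "y = x" "y \<noteq> - x" | "y = - x" "y \<noteq> x" | "y \<noteq> x" "y \<noteq> - x" using ne by metis
  then have "x \<bullet> y \<in> {-1, -1/2, -1/4, 0, 1/4, 1/2, 1} \<and> (x \<bullet> y = 1 \<longleftrightarrow> y = x) \<and> (x \<bullet> y = - 1 \<longleftrightarrow> y = - x)"
  proof cases
    case 1
    then have "x \<bullet> y = 1" using xx by simp
    then show ?thesis using 1 by simp
  next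
    case 2
    then have "x \<bullet> y = - 1" using xx by simp
    then show ?thesis using 2 by simp
  next
    case 3
    moreover have "\<forall>t\<in>{-1/2, -1/4, 0, 1/4, 1/2}. t \<noteq> 1 \<and> t \<noteq> (- 1 :: real)" by simp
    ultimately show ?thesis using in5 by blast
  qed
  then show "x \<bullet> y \<in> {-1, -1/2, -1/4, 0, 1/4, 1/2, 1}"
    "x \<bullet> y = 1 \<longleftrightarrow> y = x" "x \<bullet> y = - 1 \<longleftrightarrow> y = - x" by blast+
qed

text \<open>The polynomial t^k (t^2 - 1/4) (t^2 - 1/16) vanishes at every inner product except 1 and
  -1, where it is 45/64; positivity of \<open>k\<close> takes care of the zero at 0.\<close>

lemma leech_code_power_sum:
  assumes x: "x \<in> leech_code" and k: "even k" "k \<noteq> 0"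
  shows "(\<Sum>y\<in>leech_code. (x \<bullet> y) ^ (k + 4)) =
    5 / 16 * (\<Sum>y\<in>leech_code. (x \<bullet> y) ^ (k + 2)) - 1 / 64 * (\<Sum>y\<in>leech_code. (x \<bullet> y) ^ k) + 45 / 32"
proof -
  let ?F = "\<lambda>t::real. t ^ (k + 4) - 5 / 16 * t ^ (k + 2) + 1 / 64 * t ^ k"
  have F: "?F t = t ^ k * (t\<^sup>2 - 1 / 4) * (t\<^sup>2 - 1 / 16)" for t
    by (simp add: power_add power4_eq_xxxx power2_eq_square algebra_simps)
  have xx: "x \<bullet> x = 1" using x leech_code_inner_self by blast
  have "x \<noteq> - x" using unit_neq_uminus leech_code_norm[OF x] by blast
  have "(\<Sum>y\<in>leech_code. ?F (x \<bullet> y)) = (\<Sum>y\<in>{x, - x}. ?F (x \<bullet> y))"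
  proof (rule sum.mono_neutral_right)
    show "\<forall>y\<in>leech_code - {x, - x}. ?F (x \<bullet> y) = 0"
    proof
      fix y assume y: "y \<in> leech_code - {x, - x}"
      have "\<forall>t\<in>{-1, -1/2, -1/4, 0, 1/4, 1/2, 1}. t = 1 \<or> t = - 1 \<or>
          t ^ k * (t\<^sup>2 - 1 / 4) * (t\<^sup>2 - 1 / 16) = (0 :: real)"
        using k by (simp add: power2_eq_square)
      then show "?F (x \<bullet> y) = 0"
        unfolding F using leech_code_unit_inner[OF x, of y] y by blast
    qed
  qed (use x leech_code_uminus finite_leech_code in auto)
  also have "\<dots> = 45 / 32"
    using \<open>x \<noteq> - x\<close> k unfolding F by (simp add: xx)
  finally show ?thesis
    by (simp add: sum.distrib sum_subtractf sum_distrib_left)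
qed

lemma leech_code_power_sums:
  assumes x: "x \<in> leech_code"
  shows "(\<Sum>y\<in>leech_code. (x \<bullet> y) ^ 6) = 675 / 4"
    "(\<Sum>y\<in>leech_code. (x \<bullet> y) ^ 8) = 315 / 8"
    "(\<Sum>y\<in>leech_code. (x \<bullet> y) ^ 10) = 2835 / 256"
proof -
  have n: "norm x = 1" using x leech_code_norm by blast
  show 6: "(\<Sum>y\<in>leech_code. (x \<bullet> y) ^ 6) = 675 / 4"
    using leech_code_power_sum[OF x, of 2] leech_code_moment_2[of x] leech_code_moment_4[of x] n by simp
  show 8: "(\<Sum>y\<in>leech_code. (x \<bullet> y) ^ 8) = 315 / 8"
    using leech_code_power_sum[OF x, of 4] leech_code_moment_4[of x] 6 n by simp
  show "(\<Sum>y\<in>leech_code. (x \<bullet> y) ^ 10) = 2835 / 256"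
    using leech_code_power_sum[OF x, of 6] 6 8 by simp
qed

lemma sphere_moments_24:
  "sphere_moment TYPE(point) 6 = 5 / 5824" "sphere_moment TYPE(point) 8 = 1 / 4992"
  "sphere_moment TYPE(point) 10 = 3 / 53248"
proof -
  have 2: "sphere_moment TYPE(point) 2 = 1 / 24"
    using sphere_moment_Suc_Suc[where 'n=point, of 0] by (simp add: numeral_2_eq_2)
  have 4: "sphere_moment TYPE(point) 4 = 1 / 208"
    using sphere_moment_Suc_Suc[where 'n=point, of 1] 2 by simp
  show 6: "sphere_moment TYPE(point) 6 = 5 / 5824"
    using sphere_moment_Suc_Suc[where 'n=point, of 2] 4 by simp
  show 8: "sphere_moment TYPE(point) 8 = 1 / 4992"
    using sphere_moment_Suc_Suc[where 'n=point, of 3] 6 by simp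
  show "sphere_moment TYPE(point) 10 = 3 / 53248"
    using sphere_moment_Suc_Suc[where 'n=point, of 4] 8 by simp
qed

text \<open>The power sums are known at code points. There they equal 196560 times the sphere
  moment, so summing over the code gives the equality case, which extends them to arbitrary
  \<open>u\<close>.\<close>

lemma leech_code_moments_higher:
  "(\<Sum>y\<in>leech_code. (u \<bullet> y) ^ 6) = 675 / 4 * norm u ^ 6"
  "(\<Sum>y\<in>leech_code. (u \<bullet> y) ^ 8) = 315 / 8 * norm u ^ 8"
  "(\<Sum>y\<in>leech_code. (u \<bullet> y) ^ 10) = 2835 / 256 * norm u ^ 10"
proof -
  have L: "leech_code \<subseteq> sphere 0 1" using leech_code_norm by auto
  have m: "(\<Sum>y\<in>leech_code. (u \<bullet> y) ^ k) = P * norm u ^ k"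
    if "196560 * sphere_moment TYPE(point) k = P" "\<And>x. x \<in> leech_code \<Longrightarrow> (\<Sum>y\<in>leech_code. (x \<bullet> y) ^ k) = P" for k P
  proof -
    have "(\<Sum>x\<in>leech_code. \<Sum>y\<in>leech_code. (x \<bullet> y) ^ k) = 196560 * P"
      using that(2) by (simp add: card_leech_code)
    then have "(\<Sum>x\<in>leech_code. \<Sum>y\<in>leech_code. (x \<bullet> y) ^ k) = (real (card leech_code))\<^sup>2 * sphere_moment TYPE(point) k"
      using that(1) by (simp add: card_leech_code)
    from sidelnikov_equality_moments[OF L this, of u] show ?thesis
      using that(1) by (simp add: card_leech_code)
  qed
  show "(\<Sum>y\<in>leech_code. (u \<bullet> y) ^ 6) = 675 / 4 * norm u ^ 6"
    by (rule m) (simp_all add: sphere_moments_24 leech_code_power_sums)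
  show "(\<Sum>y\<in>leech_code. (u \<bullet> y) ^ 8) = 315 / 8 * norm u ^ 8"
    by (rule m) (simp_all add: sphere_moments_24 leech_code_power_sums)
  show "(\<Sum>y\<in>leech_code. (u \<bullet> y) ^ 10) = 2835 / 256 * norm u ^ 10"
    by (rule m) (simp_all add: sphere_moments_24 leech_code_power_sums)
qed

section \<open>The derived codes\<close>

definition leech_half :: "real ^ point \<Rightarrow> (real ^ point) set" where
  "leech_half x = {y \<in> leech_code. x \<bullet> y = 1 / 2}"

text \<open>The weight t^4 - t^2 / 16 vanishes at 0, 1/4 and -1/4 and is 3/64 at 1/2 and -1/2.
  Evenness of \<open>g\<close> identifies the last two, whence the factor 32/3, and makes
  \<open>g\<close> vanish at \<open>- x\<close> along with \<open>x\<close>.\<close>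

lemma sum_leech_half:
  fixes g :: "real ^ point \<Rightarrow> real"
  assumes x: "x \<in> leech_code" and g: "\<And>y. g (- y) = g y" "g x = 0"
  shows "(\<Sum>y\<in>leech_half x. g y) = 32 / 3 * (\<Sum>y\<in>leech_code. g y * ((x \<bullet> y) ^ 4 - 1 / 16 * (x \<bullet> y)\<^sup>2))"
proof -
  let ?A = "leech_half x" and ?G = "\<lambda>y. g y * ((x \<bullet> y) ^ 4 - 1 / 16 * (x \<bullet> y)\<^sup>2)"
  have fin: "finite ?A" unfolding leech_half_def using finite_leech_code by simp
  have "(\<Sum>y\<in>leech_code. ?G y) = (\<Sum>y\<in>?A \<union> uminus ` ?A. ?G y)"
  proof (rule sum.mono_neutral_right)
    show "\<forall>y\<in>leech_code - (?A \<union> uminus ` ?A). ?G y = 0"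
    proof
      fix y assume y: "y \<in> leech_code - (?A \<union> uminus ` ?A)"
      have "x \<bullet> y \<noteq> 1 / 2" using y by (simp add: leech_half_def)
      moreover have "x \<bullet> y \<noteq> - 1 / 2"
      proof
        assume "x \<bullet> y = - 1 / 2"
        then have "- y \<in> ?A" using y leech_code_uminus by (simp add: leech_half_def)
        then have "y \<in> uminus ` ?A" by (intro image_eqI[of _ _ "- y"]) auto
        then show False using y by simp
      qed
      moreover have "\<forall>t\<in>{-1, -1/2, -1/4, 0, 1/4, 1/2, 1}. t = 1 / 2 \<or> t = - 1 / 2 \<or> t = 1 \<or> t = - 1 \<or> t ^ 4 - 1 / 16 * t\<^sup>2 = (0 :: real)"
        by (simp add: power4_eq_xxxx power2_eq_square)
      ultimately have "x \<bullet> y = 1 \<or> x \<bullet> y = - 1 \<or> (x \<bullet> y) ^ 4 - 1 / 16 * (x \<bullet> y)\<^sup>2 = 0"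
        using leech_code_unit_inner(1)[OF x, of y] y by blast
      moreover have "g y = 0" if "x \<bullet> y = 1 \<or> x \<bullet> y = - 1"
        using that leech_code_unit_inner(2,3)[OF x, of y] y g by auto
      ultimately show "?G y = 0" by auto
    qed
  qed (use finite_leech_code leech_code_uminus in \<open>auto simp: leech_half_def\<close>)
  also have "\<dots> = (\<Sum>y\<in>?A. ?G y) + (\<Sum>y\<in>uminus ` ?A. ?G y)"
    by (rule sum.union_disjoint[OF fin finite_imageI[OF fin]]) (auto simp: leech_half_def)
  also have "(\<Sum>y\<in>uminus ` ?A. ?G y) = (\<Sum>y\<in>?A. ?G y)"
    by (subst sum.reindex) (auto simp: g)
  also have "(\<Sum>y\<in>?A. ?G y) = (\<Sum>y\<in>?A. g y * (3 / 64))"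
  proof (rule sum.cong[OF refl])
    fix y assume "y \<in> ?A"
    then have "x \<bullet> y = 1 / 2" unfolding leech_half_def by blast
    then show "?G y = g y * (3 / 64)" by (simp only: power4_eq_xxxx power2_eq_square) simp
  qed
  finally show ?thesis unfolding sum_distrib_right[symmetric] by simp
qed

lemma leech_half_power_sum:
  assumes x: "x \<in> leech_code" and ux: "u \<bullet> x = 0" and k: "even k" "k \<noteq> 0"
  shows "(\<Sum>y\<in>leech_half x. (u \<bullet> y) ^ k) =
    32 / 3 * ((\<Sum>y\<in>leech_code. (u \<bullet> y) ^ k * (x \<bullet> y) ^ 4) - 1 / 16 * (\<Sum>y\<in>leech_code. (u \<bullet> y) ^ k * (x \<bullet> y)\<^sup>2))"
proof -
  have "(\<Sum>y\<in>leech_half x. (u \<bullet> y) ^ k) =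
      32 / 3 * (\<Sum>y\<in>leech_code. (u \<bullet> y) ^ k * ((x \<bullet> y) ^ 4 - 1 / 16 * (x \<bullet> y)\<^sup>2))"
    by (rule sum_leech_half[OF x]) (use ux k in auto)
  then show ?thesis
    by (simp add: right_diff_distrib sum_subtractf sum_distrib_left mult_ac)
qed

lemma leech_half_moments:
  assumes x: "x \<in> leech_code" and ux: "u \<bullet> x = 0"
  shows "(\<Sum>y\<in>leech_half x. (u \<bullet> y)\<^sup>2) = 150 * norm u ^ 2"
    and "(\<Sum>y\<in>leech_half x. (u \<bullet> y) ^ 4) = 27 / 2 * norm u ^ 4"
    and "(\<Sum>y\<in>leech_half x. (u \<bullet> y) ^ 6) = 15 / 8 * norm u ^ 6"
proof -
  have n: "norm x = 1" using x leech_code_norm by blast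
  have c: "4 choose 2 = (6::nat)" "6 choose 2 = (15::nat)" "6 choose 4 = (15::nat)" "8 choose 2 = (28::nat)"
    "8 choose 4 = (70::nat)" "10 choose 4 = (210::nat)" "3 choose 2 = (3::nat)" "5 choose 2 = (10::nat)"
    by (simp_all add: eval_nat_numeral)
  have S22: "6 * (\<Sum>y\<in>leech_code. (u \<bullet> y)\<^sup>2 * (x \<bullet> y)\<^sup>2) = 945 * 2 * norm u ^ 2"
    using mixed_moment_sum[where C=leech_code and u=u and v=x and m=2 and c=945 and j=1] leech_code_moment_4 ux n by (simp add: c)
  have S24: "15 * (\<Sum>y\<in>leech_code. (u \<bullet> y)\<^sup>2 * (x \<bullet> y) ^ 4) = 675 / 4 * 3 * norm u ^ 2"
    using mixed_moment_sum[where C=leech_code and u=u and v=x and m=3 and c="675/4" and j=2] leech_code_moments_higher(1) ux n by (simp add: c)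
  have S42: "15 * (\<Sum>y\<in>leech_code. (u \<bullet> y) ^ 4 * (x \<bullet> y)\<^sup>2) = 675 / 4 * 3 * norm u ^ 4"
    using mixed_moment_sum[where C=leech_code and u=u and v=x and m=3 and c="675/4" and j=1] leech_code_moments_higher(1) ux n by (simp add: c)
  have S44: "70 * (\<Sum>y\<in>leech_code. (u \<bullet> y) ^ 4 * (x \<bullet> y) ^ 4) = 315 / 8 * 6 * norm u ^ 4"
    using mixed_moment_sum[where C=leech_code and u=u and v=x and m=4 and c="315/8" and j=2] leech_code_moments_higher(2) ux n by (simp add: c)
  have S62: "28 * (\<Sum>y\<in>leech_code. (u \<bullet> y) ^ 6 * (x \<bullet> y)\<^sup>2) = 315 / 8 * 4 * norm u ^ 6"
    using mixed_moment_sum[where C=leech_code and u=u and v=x and m=4 and c="315/8" and j=1] leech_code_moments_higher(2) ux n by (simp add: c)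
  \<comment> \<open>The weight raises degree 6 by 4: this is the use of the tenth moment.\<close>
  have S64: "210 * (\<Sum>y\<in>leech_code. (u \<bullet> y) ^ 6 * (x \<bullet> y) ^ 4) = 2835 / 256 * 10 * norm u ^ 6"
    using mixed_moment_sum[where C=leech_code and u=u and v=x and m=5 and c="2835/256" and j=2] leech_code_moments_higher(3) ux n by (simp add: c)
  show "(\<Sum>y\<in>leech_half x. (u \<bullet> y)\<^sup>2) = 150 * norm u ^ 2"
    using leech_half_power_sum[OF x ux, of 2] S22 S24 by simp
  show "(\<Sum>y\<in>leech_half x. (u \<bullet> y) ^ 4) = 27 / 2 * norm u ^ 4"
    using leech_half_power_sum[OF x ux, of 4] S42 S44 by simp
  show "(\<Sum>y\<in>leech_half x. (u \<bullet> y) ^ 6) = 15 / 8 * norm u ^ 6"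
    using leech_half_power_sum[OF x ux, of 6] S62 S64 by simp
qed

text \<open>The constant function is cut off at \<open>x\<close> and \<open>- x\<close> to suit
  \<open>sum_leech_half\<close>. The two removed values of the weight add up to 2 * 15/16.\<close>

lemma card_leech_half:
  assumes x: "x \<in> leech_code"
  shows "card (leech_half x) = 4600"
proof -
  have n: "norm x = 1" using x leech_code_norm by blast
  then have xx: "x \<bullet> x = 1" by (simp add: norm_eq_1)
  let ?g = "\<lambda>y. if y = x \<or> y = - x then 0 else 1 :: real" and ?p = "\<lambda>y. (x \<bullet> y) ^ 4 - 1 / 16 * (x \<bullet> y)\<^sup>2"
  have "real (card (leech_half x)) = (\<Sum>y\<in>leech_half x. ?g y)"
  proof -
    have "(\<Sum>y\<in>leech_half x. ?g y) = (\<Sum>y\<in>leech_half x. 1)"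
      by (intro sum.cong) (auto simp: leech_half_def xx)
    then show ?thesis by simp
  qed
  also have "\<dots> = 32 / 3 * (\<Sum>y\<in>leech_code. ?g y * ?p y)"
  proof (rule sum_leech_half[OF x])
    have "- y = x \<longleftrightarrow> y = - x" for y by (metis minus_minus)
    then show "?g (- y) = ?g y" for y by auto
  qed simp
  also have "(\<Sum>y\<in>leech_code. ?g y * ?p y) = (\<Sum>y\<in>leech_code. ?p y) - (\<Sum>y\<in>{x, - x}. ?p y)"
  proof -
    have "(\<Sum>y\<in>leech_code. ?g y * ?p y) = (\<Sum>y\<in>leech_code - {x, - x}. ?p y)"
      by (rule sum.mono_neutral_cong_right) (auto simp: finite_leech_code)
    also have "\<dots> = (\<Sum>y\<in>leech_code. ?p y) - (\<Sum>y\<in>{x, - x}. ?p y)"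
      using x leech_code_uminus finite_leech_code by (intro sum_diff) auto
    finally show ?thesis .
  qed
  also have "(\<Sum>y\<in>{x, - x}. ?p y) = 15 / 8"
    using unit_neq_uminus[OF n] by (simp add: xx)
  also have "(\<Sum>y\<in>leech_code. ?p y) = 945 - 1 / 16 * 8190"
    unfolding sum_subtractf sum_distrib_left[symmetric] leech_code_moment_2 leech_code_moment_4 n by simp
  finally show ?thesis by simp
qed

section \<open>The 4600-point code\<close>

lemma code_half_eq: "code_half x = (\<lambda>y. (2 / sqrt 3) *\<^sub>R (y - (1 / 2) *\<^sub>R x)) ` leech_half x"
proof -
  have "1 / sqrt (1 - 1 / 4) = 2 / sqrt 3" by (simp add: real_sqrt_divide)
  then show ?thesis unfolding code_half_def leech_half_def by auto
qed

lemma sum_code_half: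
  "(\<Sum>w\<in>code_half x. g w) = (\<Sum>y\<in>leech_half x. g ((2 / sqrt 3) *\<^sub>R (y - (1 / 2) *\<^sub>R x)))"
  unfolding code_half_eq by (subst sum.reindex) (auto simp: inj_on_def)

lemma card_code_half: "x \<in> leech_code \<Longrightarrow> card (code_half x) = 4600"
  unfolding code_half_eq using card_leech_half[of x] by (subst card_image) (auto simp: inj_on_def)

lemma finite_code_half: "finite (code_half x)"
  unfolding code_half_eq leech_half_def using finite_leech_code by simp

lemma code_half_moments:
  assumes x: "x \<in> leech_code" and ux: "u \<bullet> x = 0"
  shows "(\<Sum>w\<in>code_half x. (u \<bullet> w)\<^sup>2) = 200 * norm u ^ 2"
    and "(\<Sum>w\<in>code_half x. (u \<bullet> w) ^ 4) = 24 * norm u ^ 4"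
    and "(\<Sum>w\<in>code_half x. (u \<bullet> w) ^ 6) = 40 / 9 * norm u ^ 6"
proof -
  have s: "(\<Sum>w\<in>code_half x. (u \<bullet> w) ^ (2 * m)) = (4 / 3) ^ m * (\<Sum>y\<in>leech_half x. (u \<bullet> y) ^ (2 * m))" for m
  proof -
    have sq: "(2 / sqrt 3) ^ (2 * m) = (4 / 3 :: real) ^ m"
      unfolding power_mult by (simp add: power_divide)
    have "(\<Sum>w\<in>code_half x. (u \<bullet> w) ^ (2 * m)) = (\<Sum>y\<in>leech_half x. (2 / sqrt 3) ^ (2 * m) * (u \<bullet> y) ^ (2 * m))"
      unfolding sum_code_half using ux
      by (intro sum.cong refl) (simp only: inner_scaleR_right inner_diff_right power_mult_distrib mult_zero_right diff_zero)
    then show ?thesis unfolding sq sum_distrib_left .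
  qed
  show "(\<Sum>w\<in>code_half x. (u \<bullet> w)\<^sup>2) = 200 * norm u ^ 2"
    using s[of 1] leech_half_moments(1)[OF x ux] by simp
  show "(\<Sum>w\<in>code_half x. (u \<bullet> w) ^ 4) = 24 * norm u ^ 4"
    using s[of 2] leech_half_moments(2)[OF x ux] by (simp add: power2_eq_square)
  show "(\<Sum>w\<in>code_half x. (u \<bullet> w) ^ 6) = 40 / 9 * norm u ^ 6"
    using s[of 3] leech_half_moments(3)[OF x ux] by (simp add: power3_eq_cube)
qed

text \<open>Reflection in the midpoint \<open>(1 / 2) *\<^sub>R x\<close> takes \<open>y\<close> to
  \<open>x - y\<close>, which again has inner product 1/2 with \<open>x\<close>.\<close>

lemma code_half_uminus:
  assumes x: "x \<in> leech_code" and w: "w \<in> code_half x"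
  shows "- w \<in> code_half x"
proof -
  obtain y where y: "y \<in> leech_code" "x \<bullet> y = 1 / 2" and wy: "w = (2 / sqrt 3) *\<^sub>R (y - (1 / 2) *\<^sub>R x)"
    using w by (auto simp: code_half_eq leech_half_def)
  have "x - y \<in> leech_half x"
    using leech_code_diff[OF x y] y leech_code_inner_self[OF x] by (simp add: leech_half_def inner_diff_right)
  moreover have "- w = (2 / sqrt 3) *\<^sub>R ((x - y) - (1 / 2) *\<^sub>R x)"
  proof -
    define h where "h = (1 / 2) *\<^sub>R x"
    have "x = h + h" unfolding h_def by (simp flip: scaleR_add_left)
    then have "(x - y) - h = - (y - h)" by simp
    then show ?thesis unfolding wy h_def[symmetric] by (simp only: scaleR_minus_right)
  qed
  ultimately show ?thesis unfolding code_half_eq by blast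
qed

text \<open>The inner product is 4/3 (t - 1/4) with t the inner product of \<open>y\<close> and
  \<open>y'\<close>. Since \<open>x - y'\<close> is also a minimal vector, 1/2 - t is in the list of
  inner products too, which excludes t = -1 and t = -1/4.\<close>

lemma code_half_inner:
  assumes x: "x \<in> leech_code" and w: "w \<in> code_half x" and w': "w' \<in> code_half x"
  shows "w \<bullet> w' \<in> {- 1, - 1 / 3, 0, 1 / 3, 1}" and "w \<bullet> w' = 1 \<longleftrightarrow> w = w'" and "w \<bullet> w' = - 1 \<longleftrightarrow> w = - w'"
proof -
  obtain y where y: "y \<in> leech_code" "x \<bullet> y = 1 / 2" and wy: "w = (2 / sqrt 3) *\<^sub>R (y - (1 / 2) *\<^sub>R x)"
    using w by (auto simp: code_half_eq leech_half_def)
  obtain y' where y': "y' \<in> leech_code" "x \<bullet> y' = 1 / 2" and wy': "w' = (2 / sqrt 3) *\<^sub>R (y' - (1 / 2) *\<^sub>R x)"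
    using w' by (auto simp: code_half_eq leech_half_def)
  have s: "(2 / sqrt 3) * (2 / sqrt 3) = (4 / 3 :: real)" by simp
  have "w \<bullet> w' = ((2 / sqrt 3) * (2 / sqrt 3)) * ((y - (1 / 2) *\<^sub>R x) \<bullet> (y' - (1 / 2) *\<^sub>R x))"
    unfolding wy wy' by (simp only: inner_scaleR_left inner_scaleR_right mult.assoc)
  also have "(y - (1 / 2) *\<^sub>R x) \<bullet> (y' - (1 / 2) *\<^sub>R x) = y \<bullet> y' - 1 / 4"
    using y y' leech_code_inner_self[OF x] by (simp add: inner_diff_left inner_diff_right inner_commute)
  finally have ip: "w \<bullet> w' = 4 / 3 * (y \<bullet> y' - 1 / 4)" unfolding s .
  have "y \<bullet> (x - y') = 1 / 2 - y \<bullet> y'" using y by (simp add: inner_diff_right inner_commute)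
  moreover have "x - y' \<in> leech_code" by (rule leech_code_diff[OF x y'])
  ultimately have "1 / 2 - y \<bullet> y' \<in> {-1, -1/2, -1/4, 0, 1/4, 1/2, 1}"
    using leech_code_unit_inner(1)[OF y(1), of "x - y'"] by metis
  then show "w \<bullet> w' \<in> {- 1, - 1 / 3, 0, 1 / 3, 1}"
    using leech_code_unit_inner(1)[OF y(1) y'(1)] unfolding ip by auto
  have n: "norm w = 1" "norm w' = 1" using code_half_orthogonal(3)[OF x] w w' by auto
  then have nn: "w \<bullet> w = 1" "w' \<bullet> w' = 1" by (simp_all add: norm_eq_1)
  have e1: "(w - w') \<bullet> (w - w') = 2 - 2 * (w \<bullet> w')" "(w + w') \<bullet> (w + w') = 2 + 2 * (w \<bullet> w')"
    using nn by (simp_all add: inner_diff_left inner_diff_right inner_add_left inner_add_right inner_commute)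
  show "w \<bullet> w' = 1 \<longleftrightarrow> w = w'"
    using e1(1) nn by (metis diff_self_eq_0 eq_iff_diff_eq_0 inner_eq_zero_iff mult_1_right)
  show "w \<bullet> w' = - 1 \<longleftrightarrow> w = - w'"
  proof
    assume "w \<bullet> w' = - 1"
    then have "(w + w') \<bullet> (w + w') = 0" using e1(2) by simp
    then show "w = - w'" unfolding inner_eq_zero_iff by (simp add: eq_neg_iff_add_eq_0)
  qed (simp add: nn)
qed

section \<open>The 2816-point code\<close>

lemma sum_code_2816:
  fixes g :: "real ^ point \<Rightarrow> real"
  assumes x: "x \<in> leech_code" and z: "z \<in> code_half x" and g: "g z = 0" "g (- z) = 0"
  shows "(\<Sum>w\<in>code_2816 x z. g w) = (\<Sum>w\<in>code_half x. g w * (1 - 9 * (z \<bullet> w)\<^sup>2))"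
proof (rule sum.mono_neutral_cong_left)
  show "\<forall>w\<in>code_half x - code_2816 x z. g w * (1 - 9 * (z \<bullet> w)\<^sup>2) = 0"
  proof
    fix w assume w: "w \<in> code_half x - code_2816 x z"
    then have "z \<bullet> w \<noteq> 0" by (simp add: code_2816_def inner_commute)
    \<comment> \<open>The weight 1 - 9 t^2 is 1 at 0 and vanishes at 1/3 and -1/3; at 1 and -1 it is
      \<open>g\<close> that vanishes.\<close>
    moreover have "\<forall>t\<in>{- 1, - 1 / 3, 0, 1 / 3, 1}. t = 0 \<or> t = 1 \<or> t = - 1 \<or> 1 - 9 * t\<^sup>2 = (0 :: real)"
      by (simp add: power2_eq_square)
    ultimately have "z \<bullet> w = 1 \<or> z \<bullet> w = - 1 \<or> 1 - 9 * (z \<bullet> w)\<^sup>2 = 0"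
      using code_half_inner(1)[OF x z, of w] w by blast
    moreover have "g w = 0" if "z \<bullet> w = 1 \<or> z \<bullet> w = - 1"
      using that code_half_inner(2,3)[OF x z, of w] w g by auto
    ultimately show "g w * (1 - 9 * (z \<bullet> w)\<^sup>2) = 0" by auto
  qed
qed (auto simp: finite_code_half code_2816_def inner_commute)

lemma code_2816_moments:
  assumes x: "x \<in> leech_code" and z: "z \<in> code_half x" and u: "u \<bullet> x = 0" "u \<bullet> z = 0"
  shows "(\<Sum>w\<in>code_2816 x z. (u \<bullet> w)\<^sup>2) = 128 * norm u ^ 2"
    and "(\<Sum>w\<in>code_2816 x z. (u \<bullet> w) ^ 4) = 16 * norm u ^ 4"
proof -
  have n: "norm z = 1" and zx: "z \<bullet> x = 0" using code_half_orthogonal[OF x z] by (simp_all add: inner_commute)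
  have us: "(u + s *\<^sub>R z) \<bullet> x = 0" for s using u zx by (simp add: inner_add_left)
  have c: "4 choose 2 = (6::nat)" "6 choose 2 = (15::nat)" by (simp_all add: eval_nat_numeral)
  have S22: "6 * (\<Sum>w\<in>code_half x. (u \<bullet> w)\<^sup>2 * (z \<bullet> w)\<^sup>2) = 24 * 2 * norm u ^ 2"
    using mixed_moment_sum[where C="code_half x" and u=u and v=z and m=2 and c=24 and j=1] code_half_moments(2)[OF x us] u n by (simp add: c)
  have S42: "15 * (\<Sum>w\<in>code_half x. (u \<bullet> w) ^ 4 * (z \<bullet> w)\<^sup>2) = 40 / 9 * 3 * norm u ^ 4"
    using mixed_moment_sum[where C="code_half x" and u=u and v=z and m=3 and c="40/9" and j=1] code_half_moments(3)[OF x us] u n by (simp add: c)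
  have s: "(\<Sum>w\<in>code_2816 x z. (u \<bullet> w) ^ k) = (\<Sum>w\<in>code_half x. (u \<bullet> w) ^ k) - 9 * (\<Sum>w\<in>code_half x. (u \<bullet> w) ^ k * (z \<bullet> w)\<^sup>2)"
    if "k \<noteq> 0" for k
    using sum_code_2816[OF x z, of "\<lambda>w. (u \<bullet> w) ^ k"] u that
    by (simp add: right_diff_distrib sum_subtractf sum_distrib_left mult_ac)
  show "(\<Sum>w\<in>code_2816 x z. (u \<bullet> w)\<^sup>2) = 128 * norm u ^ 2"
    using s[of 2] S22 code_half_moments(1)[OF x u(1)] by simp
  show "(\<Sum>w\<in>code_2816 x z. (u \<bullet> w) ^ 4) = 16 * norm u ^ 4"
    using s[of 4] S42 code_half_moments(2)[OF x u(1)] by simp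
qed

lemma card_code_2816:
  assumes x: "x \<in> leech_code" and z: "z \<in> code_half x"
  shows "card (code_2816 x z) = 2816"
proof -
  have n: "norm z = 1" and zx: "z \<bullet> x = 0" using code_half_orthogonal[OF x z] by (simp_all add: inner_commute)
  then have zz: "z \<bullet> z = 1" by (simp add: norm_eq_1)
  let ?g = "\<lambda>w. if w = z \<or> w = - z then 0 else 1 :: real" and ?p = "\<lambda>w. 1 - 9 * (z \<bullet> w)\<^sup>2"
  have "real (card (code_2816 x z)) = (\<Sum>w\<in>code_2816 x z. ?g w)"
  proof -
    have "(\<Sum>w\<in>code_2816 x z. ?g w) = (\<Sum>w\<in>code_2816 x z. 1)"
      by (intro sum.cong) (auto simp: code_2816_def zz)
    then show ?thesis by simp
  qed
  also have "\<dots> = (\<Sum>w\<in>code_half x. ?g w * ?p w)"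
    by (rule sum_code_2816[OF x z]) auto
  also have "\<dots> = (\<Sum>w\<in>code_half x - {z, - z}. ?p w)"
    by (rule sum.mono_neutral_cong_right) (auto simp: finite_code_half)
  also have "\<dots> = (\<Sum>w\<in>code_half x. ?p w) - (\<Sum>w\<in>{z, - z}. ?p w)"
    using z code_half_uminus[OF x z] finite_code_half by (intro sum_diff) auto
  also have "(\<Sum>w\<in>{z, - z}. ?p w) = - 16"
    using unit_neq_uminus[OF n] by (simp add: zz)
  also have "(\<Sum>w\<in>code_half x. ?p w) = 4600 - 9 * 200"
    unfolding sum_subtractf sum_distrib_left[symmetric] code_half_moments(1)[OF x zx] n
    using card_code_half[OF x] by simp
  finally show ?thesis by simp
qed

section \<open>Gegenbauer polynomials\<close>

definition gegenbauer_int :: "nat \<Rightarrow> real poly \<Rightarrow> real" where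
  "gegenbauer_int n p = integral {-1..1} (\<lambda>t. poly p t * (1 - t\<^sup>2) powr ((real n - 3) / 2))"

lemma one_minus_square_nonneg: "t \<in> {-1..1} \<Longrightarrow> 0 \<le> 1 - t\<^sup>2" for t :: real
  by (simp add: abs_square_le_1 abs_le_iff)

text \<open>For \<open>n > 3\<close> the exponent is positive, so the weight is continuous up to the
  endpoints. At \<open>n = 3\<close> the convention \<open>0 powr 0 = 0\<close> would break
  this.\<close>

lemma continuous_on_gegenbauer_integrand:
  assumes "n > 3"
  shows "continuous_on {-1..1} (\<lambda>t. poly p t * (1 - t\<^sup>2) powr ((real n - 3) / 2))"
  using assms one_minus_square_nonneg by (intro continuous_intros continuous_on_powr') auto

lemma gegenbauer_int_has_integral:
  assumes "n > 3"
  shows "((\<lambda>t. poly p t * (1 - t\<^sup>2) powr ((real n - 3) / 2)) has_integral gegenbauer_int n p) {-1..1}"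
  unfolding gegenbauer_int_def
  by (intro integrable_integral integrable_continuous_real continuous_on_gegenbauer_integrand assms)

lemma gegenbauer_int_add:
  assumes "n > 3"
  shows "gegenbauer_int n (p + q) = gegenbauer_int n p + gegenbauer_int n q"
  using has_integral_add[OF gegenbauer_int_has_integral[OF assms, of p] gegenbauer_int_has_integral[OF assms, of q]]
  unfolding gegenbauer_int_def by (simp add: distrib_right integral_unique)

lemma gegenbauer_int_smult: "gegenbauer_int n (smult c p) = c * gegenbauer_int n p"
  unfolding gegenbauer_int_def by (simp add: mult.assoc)

lemma gegenbauer_int_0 [simp]: "gegenbauer_int n 0 = 0"
  by (simp add: gegenbauer_int_def)

lemma gegenbauer_int_diff:
  assumes "n > 3"
  shows "gegenbauer_int n (p - q) = gegenbauer_int n p - gegenbauer_int n q"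
  using gegenbauer_int_add[OF assms, of p "smult (- 1) q"] gegenbauer_int_smult[of n "- 1" q] by simp

lemma gegenbauer_int_sum:
  assumes "n > 3"
  shows "gegenbauer_int n (\<Sum>i\<in>A. f i) = (\<Sum>i\<in>A. gegenbauer_int n (f i))"
  by (induction A rule: infinite_finite_induct) (simp_all add: gegenbauer_int_add[OF assms])

text \<open>A continuous nonnegative integrand with integral 0 vanishes identically; the weight is
  positive inside the interval, so \<open>p\<close> would have infinitely many roots.\<close>

lemma gegenbauer_int_pos:
  assumes n: "n > 3" and nonneg: "\<And>t. t \<in> {-1..1} \<Longrightarrow> 0 \<le> poly p t" and "p \<noteq> 0"
  shows "0 < gegenbauer_int n p"
proof -
  let ?f = "\<lambda>t. poly p t * (1 - t\<^sup>2) powr ((real n - 3) / 2)"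
  have f: "0 \<le> ?f t" if "t \<in> {-1..1}" for t using nonneg[OF that] by simp
  have "0 \<le> gegenbauer_int n p"
    unfolding gegenbauer_int_def
    by (intro integral_nonneg integrable_continuous_real continuous_on_gegenbauer_integrand n f)
  moreover have "gegenbauer_int n p \<noteq> 0"
  proof
    assume "gegenbauer_int n p = 0"
    then have zero: "?f t = 0" if "t \<in> {-1..1}" for t
      using integral_eq_0_iff[OF continuous_on_gegenbauer_integrand[OF n, of p] _ f] that
      unfolding gegenbauer_int_def by auto
    have "{-1<..<1} \<subseteq> {t. poly p t = 0}"
    proof
      fix t :: real assume t: "t \<in> {-1<..<1}"
      then have "t\<^sup>2 < 1" by (simp add: abs_square_less_1 abs_less_iff)
      then show "t \<in> {t. poly p t = 0}" using zero[of t] t by simp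
    qed
    then have "finite {-1<..<1 :: real}"
      using poly_roots_finite[OF \<open>p \<noteq> 0\<close>] finite_subset by blast
    then show False using infinite_Ioo[of "-1" "1 :: real"] by simp
  qed
  ultimately show ?thesis by simp
qed

lemma gegenbauer_int_square_eq_0:
  assumes "n > 3" "gegenbauer_int n (p * p) = 0"
  shows "p = 0"
  using gegenbauer_int_pos[OF assms(1), of "p * p"] assms(2) by fastforce

text \<open>The bound on \<open>p\<close> is put in terms of coefficients because
  \<open>degree\<close> does not tell the zero polynomial from constants, which matters at
  \<open>i = 0\<close>.\<close>

lemma poly_basis_expansion:
  fixes Q :: "nat \<Rightarrow> 'a::field poly"
  assumes "\<And>j. j < i \<Longrightarrow> degree (Q j) = j \<and> Q j \<noteq> 0" "\<And>k. k \<ge> i \<Longrightarrow> coeff p k = 0"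
  shows "\<exists>c. p = (\<Sum>j<i. smult (c j) (Q j))"
  using assms
proof (induction i arbitrary: p)
  case 0
  then show ?case by (auto simp: poly_eq_iff)
next
  case (Suc i)
  define a where "a = coeff p i / lead_coeff (Q i)"
  have Qi: "degree (Q i) = i" "Q i \<noteq> 0" using Suc.prems(1)[of i] by auto
  then have ci: "coeff (Q i) i \<noteq> 0" by (metis leading_coeff_0_iff)
  have "coeff (p - smult a (Q i)) k = 0" if "k \<ge> i" for k
  proof (cases "k = i")
    case True
    then show ?thesis using Qi(1) ci by (simp add: a_def)
  next
    case False
    then have "k > i" using that by simp
    then show ?thesis using Qi Suc.prems(2)[of k] by (simp add: coeff_eq_0)
  qed
  then obtain c where c: "p - smult a (Q i) = (\<Sum>j<i. smult (c j) (Q j))"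
    using Suc.IH[of "p - smult a (Q i)"] Suc.prems(1) by auto
  have "p = (\<Sum>j<Suc i. smult ((c(i := a)) j) (Q j))"
  proof -
    have "(\<Sum>j<i. smult ((c(i := a)) j) (Q j)) = (\<Sum>j<i. smult (c j) (Q j))"
      by (intro sum.cong) auto
    then show ?thesis using c by (simp add: algebra_simps)
  qed
  then show ?case by blast
qed

definition gegenbauer_orthogonal :: "nat \<Rightarrow> nat \<Rightarrow> real poly \<Rightarrow> bool" where
  "gegenbauer_orthogonal n i q \<longleftrightarrow> degree q = i \<and> q \<noteq> 0 \<and>
     (\<forall>p. (\<forall>k\<ge>i. coeff p k = 0) \<longrightarrow> gegenbauer_int n (p * q) = 0)"

lemma gegenbauer_orthogonal_pairs:
  assumes n: "n > 3" and Q: "\<And>j. j < i \<Longrightarrow> degree (Q j) = j \<and> Q j \<noteq> 0"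
    and orth: "\<And>j. j < i \<Longrightarrow> gegenbauer_int n (Q j * q) = 0" and q: "degree q = i" "q \<noteq> 0"
  shows "gegenbauer_orthogonal n i q"
  unfolding gegenbauer_orthogonal_def
proof (intro conjI allI impI q)
  fix p :: "real poly" assume "\<forall>k\<ge>i. coeff p k = 0"
  then obtain c where "p = (\<Sum>j<i. smult (c j) (Q j))" using poly_basis_expansion[of i Q p] Q by blast
  then show "gegenbauer_int n (p * q) = 0"
    by (simp add: sum_distrib_right gegenbauer_int_sum[OF n] gegenbauer_int_smult orth)
qed

text \<open>Gram-Schmidt on the monomials: \<open>r\<close> is the projection of
  \<open>monom 1 i\<close> to the span of the earlier polynomials.\<close>

lemma ex_gegenbauer_orthogonal:
  assumes n: "n > 3"
  shows "\<exists>q. gegenbauer_orthogonal n i q"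
proof (induction i rule: less_induct)
  case (less i)
  then obtain Q where Q: "\<And>j. j < i \<Longrightarrow> gegenbauer_orthogonal n j (Q j)" by metis
  have dQ: "degree (Q j) = j \<and> Q j \<noteq> 0" if "j < i" for j
    using Q[OF that] by (simp add: gegenbauer_orthogonal_def)
  have QQ: "gegenbauer_int n (Q j * Q k) = 0" if "j < i" "k < i" "j \<noteq> k" for j k
  proof -
    have *: "gegenbauer_int n (Q j * Q k) = 0" if "j < k" "k < i" for j k
      using Q[of k] dQ[of j] that by (auto simp: gegenbauer_orthogonal_def coeff_eq_0)
    show ?thesis
      using *[of j k] *[of k j] that by (cases "j < k") (auto simp: mult.commute)
  qed
  have QQ0: "gegenbauer_int n (Q j * Q j) \<noteq> 0" if "j < i" for j
    using gegenbauer_int_square_eq_0[OF n, of "Q j"] dQ[OF that] by blast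
  define a where "a j = gegenbauer_int n (Q j * monom 1 i) / gegenbauer_int n (Q j * Q j)" for j
  define r where "r = (\<Sum>j<i. smult (a j) (Q j))"
  define q where "q = monom 1 i - r"
  have r: "coeff r k = 0" if "k \<ge> i" for k
    unfolding r_def coeff_sum using dQ that by (intro sum.neutral) (auto simp: coeff_eq_0)
  have ci: "coeff q i = 1" unfolding q_def using r by simp
  have ck: "coeff q k = 0" if "k > i" for k unfolding q_def using r that by simp
  have "degree q = i" using ci ck by (intro antisym degree_le le_degree) auto
  moreover have "q \<noteq> 0" using ci by auto
  moreover have "gegenbauer_int n (Q k * q) = 0" if "k < i" for k
  proof -
    have "gegenbauer_int n (Q k * r) = (\<Sum>j<i. a j * gegenbauer_int n (Q k * Q j))"
      unfolding r_def by (simp add: sum_distrib_left gegenbauer_int_sum[OF n] gegenbauer_int_smult)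
    also have "\<dots> = (\<Sum>j\<in>{k}. a j * gegenbauer_int n (Q k * Q j))"
      using that QQ by (intro sum.mono_neutral_right) auto
    also have "\<dots> = gegenbauer_int n (Q k * monom 1 i)"
      using QQ0[OF that] by (simp add: a_def)
    finally show ?thesis
      unfolding q_def right_diff_distrib gegenbauer_int_diff[OF n] by simp
  qed
  ultimately have "gegenbauer_orthogonal n i q"
    using gegenbauer_orthogonal_pairs[OF n dQ] by blast
  then show ?case ..
qed

text \<open>If \<open>q = (t - 1) r\<close> then \<open>(1 - t) r\<^sup>2\<close> is nonnegative and nonzero but integrates to 0 by orthogonality.\<close>

lemma gegenbauer_orthogonal_at_1:
  assumes n: "n > 3" and q: "gegenbauer_orthogonal n i q"
  shows "poly q 1 \<noteq> 0"
proof
  assume "poly q 1 = 0"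
  then obtain r where r: "q = [:- 1, 1:] * r" by (auto simp: poly_eq_0_iff_dvd elim: dvdE)
  have q0: "degree q = i" "q \<noteq> 0" using q by (auto simp: gegenbauer_orthogonal_def)
  then have r0: "r \<noteq> 0" using r by auto
  have "degree q = Suc (degree r)"
    unfolding r using r0 by (subst degree_mult_eq) auto
  then have "\<forall>k\<ge>i. coeff r k = 0" using q0 by (auto simp: coeff_eq_0)
  then have "gegenbauer_int n (r * q) = 0" using q by (auto simp: gegenbauer_orthogonal_def)
  moreover have "0 < gegenbauer_int n ([:1, - 1:] * (r * r))"
  proof (rule gegenbauer_int_pos[OF n])
    show "[:1, - 1:] * (r * r) \<noteq> 0" using r0 by (metis mult_eq_0_iff one_neq_zero pCons_eq_0_iff)
    fix t :: real assume "t \<in> {-1..1}"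
    then have "0 \<le> (1 - t) * (poly r t * poly r t)" by simp
    then show "0 \<le> poly ([:1, - 1:] * (r * r)) t" by (simp add: left_diff_distrib)
  qed
  moreover have "[:1, - 1:] * (r * r) = smult (- 1) (r * q)" unfolding r by (simp add: algebra_simps)
  ultimately show False by (simp only: gegenbauer_int_smult)
qed

definition is_gegenbauer_family :: "nat \<Rightarrow> (nat \<Rightarrow> real poly) \<Rightarrow> bool" where
  "is_gegenbauer_family n P \<longleftrightarrow> (\<forall>i. degree (P i) = i \<and> poly (P i) 1 = 1) \<and>
     (\<forall>i j. i \<noteq> j \<longrightarrow>
        integral {-1..1} (\<lambda>t. poly (P i) t * poly (P j) t * (1 - t\<^sup>2) powr ((real n - 3) / 2)) = 0)"

lemma is_gegenbauer_family_iff: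
  "is_gegenbauer_family n P \<longleftrightarrow> (\<forall>i. degree (P i) = i \<and> poly (P i) 1 = 1) \<and>
     (\<forall>i j. i \<noteq> j \<longrightarrow> gegenbauer_int n (P i * P j) = 0)"
  unfolding is_gegenbauer_family_def gegenbauer_int_def by simp

lemma is_gegenbauer_family_nonzero: "is_gegenbauer_family n P \<Longrightarrow> P i \<noteq> 0"
  unfolding is_gegenbauer_family_def by (metis poly_0 zero_neq_one)

lemma is_gegenbauer_family_orthogonal:
  assumes n: "n > 3" and P: "is_gegenbauer_family n P"
  shows "gegenbauer_orthogonal n i (P i)"
proof (rule gegenbauer_orthogonal_pairs[OF n])
  show "degree (P j) = j \<and> P j \<noteq> 0" for j
    using P is_gegenbauer_family_nonzero[OF P] by (simp add: is_gegenbauer_family_iff)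
  show "degree (P i) = i" "P i \<noteq> 0"
    using P is_gegenbauer_family_nonzero[OF P] by (simp_all add: is_gegenbauer_family_iff)
  show "gegenbauer_int n (P j * P i) = 0" if "j < i" for j
    using P that by (simp add: is_gegenbauer_family_iff)
qed

lemma ex_is_gegenbauer_family:
  assumes n: "n > 3"
  shows "\<exists>P. is_gegenbauer_family n P"
proof -
  obtain Q where Q: "\<And>i. gegenbauer_orthogonal n i (Q i)" using ex_gegenbauer_orthogonal[OF n] by metis
  define P where "P i = smult (1 / poly (Q i) 1) (Q i)" for i
  have Q1: "poly (Q i) 1 \<noteq> 0" for i using gegenbauer_orthogonal_at_1[OF n Q] .
  have dQ: "degree (Q i) = i" for i using Q by (simp add: gegenbauer_orthogonal_def)
  have *: "gegenbauer_int n (Q i * Q j) = 0" if "i < j" for i j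
    using Q[of j] dQ[of i] that by (auto simp: gegenbauer_orthogonal_def coeff_eq_0)
  have QQ: "gegenbauer_int n (Q i * Q j) = 0" if "i \<noteq> j" for i j
    using *[of i j] *[of j i] that by (cases "i < j") (auto simp: mult.commute)
  have "is_gegenbauer_family n P"
    unfolding is_gegenbauer_family_iff P_def
    using Q1 by (simp add: dQ gegenbauer_int_smult QQ)
  then show ?thesis by (rule exI[of _ P])
qed

text \<open>The factor \<open>a\<close> matches leading coefficients, so the difference
  \<open>d\<close> has lower degree and is orthogonal to \<open>P i\<close> and \<open>P' i\<close>,
  hence to itself. The value at 1 then forces \<open>a = 1\<close>.\<close>

lemma is_gegenbauer_family_unique:
  assumes n: "n > 3" and P: "is_gegenbauer_family n P" and P': "is_gegenbauer_family n P'"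
  shows "P = P'"
proof
  fix i
  define a where "a = lead_coeff (P i) / lead_coeff (P' i)"
  define d where "d = P i - smult a (P' i)"
  have deg: "degree (P i) = i" "degree (P' i) = i" using P P' by (simp_all add: is_gegenbauer_family_iff)
  have "lead_coeff (P' i) \<noteq> 0" using is_gegenbauer_family_nonzero[OF P'] by simp
  then have d: "\<forall>k\<ge>i. coeff d k = 0"
    using deg by (auto simp: d_def a_def le_less coeff_eq_0)
  have "gegenbauer_int n (d * P i) = 0" "gegenbauer_int n (d * P' i) = 0"
    using is_gegenbauer_family_orthogonal[OF n P, of i] is_gegenbauer_family_orthogonal[OF n P', of i] d
    by (auto simp: gegenbauer_orthogonal_def)
  then have "gegenbauer_int n (d * d) = 0"
    using gegenbauer_int_diff[OF n, of "d * P i" "smult a (d * P' i)"]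
    by (simp add: d_def right_diff_distrib gegenbauer_int_smult)
  then have "d = 0" using gegenbauer_int_square_eq_0[OF n] by blast
  then have eq: "P i = smult a (P' i)" by (simp add: d_def)
  have "a = 1" using arg_cong[OF eq, of "\<lambda>p. poly p 1"] P P' by (simp add: is_gegenbauer_family_iff)
  then show "P i = P' i" using eq by simp
qed

lemma gegenbauer_family:
  assumes n: "n > 3"
  shows "is_gegenbauer_family n (gegenbauer n)"
proof -
  have "\<exists>!P. is_gegenbauer_family n P"
    using ex_is_gegenbauer_family[OF n] is_gegenbauer_family_unique[OF n] by blast
  then have "is_gegenbauer_family n (THE P. is_gegenbauer_family n P)" by (rule theI')
  then show ?thesis unfolding gegenbauer_def is_gegenbauer_family_def .
qed

lemma gegenbauer_0:
  assumes "n > 3" shows "gegenbauer n 0 = 1"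
proof -
  have "degree (gegenbauer n 0) = 0" "poly (gegenbauer n 0) 1 = 1"
    using gegenbauer_family[OF assms] by (simp_all add: is_gegenbauer_family_iff)
  then show ?thesis by (auto elim!: degree_eq_zeroE)
qed

text \<open>All \<open>gegenbauer n j\<close> with \<open>j > 0\<close> are orthogonal to the
  constant \<open>gegenbauer n 0\<close>, so the coefficient \<open>c 0\<close> is the weighted mean
  of \<open>f\<close>.\<close>

lemma ex_gegenbauer_expansion:
  assumes n: "n > 3" and f: "\<And>k. k \<ge> N \<Longrightarrow> coeff f k = 0" and N: "N > 0"
  shows "\<exists>c. gegenbauer_expansion n f c \<and> (\<forall>i\<ge>N. c i = 0) \<and> c 0 * gegenbauer_int n 1 = gegenbauer_int n f"
proof -
  let ?G = "gegenbauer n"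
  note G = gegenbauer_family[OF n]
  obtain c where c: "f = (\<Sum>j<N. smult (c j) (?G j))"
    using poly_basis_expansion[of N ?G f] f G is_gegenbauer_family_nonzero[OF G]
    by (auto simp: is_gegenbauer_family_iff)
  define b where "b i = (if i < N then c i else 0)" for i
  have sub: "{i. b i \<noteq> 0} \<subseteq> {..<N}" by (auto simp: b_def split: if_splits)
  have "(\<Sum>i | b i \<noteq> 0. smult (b i) (?G i)) = (\<Sum>i<N. smult (b i) (?G i))"
    by (rule sum.mono_neutral_left) (use sub in auto)
  also have "\<dots> = f" unfolding c by (intro sum.cong) (auto simp: b_def)
  finally have "gegenbauer_expansion n f b"
    using finite_subset[OF sub] by (simp add: gegenbauer_expansion_def)
  moreover have "b 0 * gegenbauer_int n 1 = gegenbauer_int n f"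
  proof -
    have orth: "gegenbauer_int n (?G j) = 0" if "j \<noteq> 0" for j
    proof -
      have "gegenbauer_int n (?G j * ?G 0) = 0" using G that by (simp add: is_gegenbauer_family_iff)
      then show ?thesis by (simp add: gegenbauer_0[OF n])
    qed
    have "gegenbauer_int n f = (\<Sum>j<N. c j * gegenbauer_int n (?G j))"
      unfolding c by (simp add: gegenbauer_int_sum[OF n] gegenbauer_int_smult)
    also have "\<dots> = (\<Sum>j\<in>{0}. c j * gegenbauer_int n (?G j))"
      using N orth by (intro sum.mono_neutral_right) auto
    finally show ?thesis using N by (simp add: b_def gegenbauer_0[OF n])
  qed
  ultimately show ?thesis by (intro exI[of _ b]) (auto simp: b_def)
qed

text \<open>Integrating the derivative of \<open>t ^ k * (1 - t\<^sup>2) powr ((n - 1) / 2)\<close>, which vanishes at both ends.\<close>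

lemma gegenbauer_int_monom_recurrence:
  assumes n: "n > 3"
  shows "(real k + real n - 1) * gegenbauer_int n (monom 1 (k + 1)) = real k * gegenbauer_int n (monom 1 (k - 1))"
proof -
  let ?a = "(real n - 1) / 2"
  let ?F = "\<lambda>t. t ^ k * (1 - t\<^sup>2) powr ?a"
  let ?p = "smult (real k) (monom 1 (k - 1)) - smult (real k + real n - 1) (monom 1 (k + 1))"
  have "((\<lambda>t. poly ?p t * (1 - t\<^sup>2) powr ((real n - 3) / 2)) has_integral ?F 1 - ?F (- 1)) {-1..1}"
  proof (rule fundamental_theorem_of_calculus_interior)
    show "continuous_on {-1..1} ?F"
      using n one_minus_square_nonneg by (intro continuous_intros continuous_on_powr') auto
    fix t :: real assume t: "t \<in> {-1<..<1}"
    then have pos: "0 < 1 - t\<^sup>2" by (simp add: abs_square_less_1 abs_less_iff)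
    have a: "?a - 1 = (real n - 3) / 2" by (simp add: field_simps)
    have "(1 - t\<^sup>2) powr ?a = (1 - t\<^sup>2) powr (1 + (?a - 1))" by simp
    also have "\<dots> = (1 - t\<^sup>2) * (1 - t\<^sup>2) powr (?a - 1)"
      using pos by (simp only: powr_add) simp
    finally have powr: "(1 - t\<^sup>2) powr ?a = (1 - t\<^sup>2) * (1 - t\<^sup>2) powr ((real n - 3) / 2)" unfolding a .
    have "(?F has_real_derivative (real k * t ^ (k - 1)) * (1 - t\<^sup>2) powr ?a +
        t ^ k * (?a * (1 - t\<^sup>2) powr (?a - 1) * (- (2 * t)))) (at t)"
      using pos by (auto intro!: derivative_eq_intros)
    also have "(real k * t ^ (k - 1)) * (1 - t\<^sup>2) powr ?a + t ^ k * (?a * (1 - t\<^sup>2) powr (?a - 1) * (- (2 * t))) =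
        poly ?p t * (1 - t\<^sup>2) powr ((real n - 3) / 2)"
    proof -
      have "real k * t ^ (k - 1) * (1 - t\<^sup>2) - (real n - 1) * t ^ (k + 1) = poly ?p t"
        by (cases k) (simp_all add: poly_monom power2_eq_square algebra_simps)
      moreover have "(real k * t ^ (k - 1)) * (1 - t\<^sup>2) powr ?a + t ^ k * (?a * (1 - t\<^sup>2) powr (?a - 1) * (- (2 * t))) =
          (real k * t ^ (k - 1) * (1 - t\<^sup>2) - (real n - 1) * t ^ (k + 1)) * (1 - t\<^sup>2) powr ((real n - 3) / 2)"
        unfolding powr a by (simp add: field_simps)
      ultimately show ?thesis by simp
    qed
    finally show "(?F has_vector_derivative poly ?p t * (1 - t\<^sup>2) powr ((real n - 3) / 2)) (at t)"
      by (simp add: has_real_derivative_iff_has_vector_derivative)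
  qed simp
  moreover have "?F 1 - ?F (- 1) = 0" by simp
  ultimately have "gegenbauer_int n ?p = 0"
    unfolding gegenbauer_int_def by (simp add: integral_unique)
  then show ?thesis
    by (simp only: gegenbauer_int_diff[OF n] gegenbauer_int_smult)
qed

text \<open>The factors 1/22 and 1/176 are the second and fourth moments of the weight, equal to
  those in \<open>sphere_moments_22\<close>. Hence \<open>c 0\<close> coincides with the average
  used in \<open>design_22_lower_bound\<close>.\<close>

lemma gegenbauer_int_22_quintic:
  "gegenbauer_int 22 [:a0, a1, a2, a3, a4, a5:] = (a0 + a2 / 22 + a4 / 176) * gegenbauer_int 22 1"
proof -
  let ?I = "\<lambda>k. gegenbauer_int 22 (monom 1 k)"
  have n: "(22::nat) > 3" by simp
  note rec = gegenbauer_int_monom_recurrence[OF n]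
  have I1: "?I 1 = 0" using rec[of 0] by simp
  have I2: "?I 2 = ?I 0 / 22" using rec[of 1] by (simp add: numeral_2_eq_2)
  have I3: "?I 3 = 0" using rec[of 2] I1 by (simp add: eval_nat_numeral)
  have I4: "?I 4 = ?I 0 / 176" using rec[of 3] I2 by (simp add: eval_nat_numeral)
  have I5: "?I 5 = 0" using rec[of 4] I3 by (simp add: eval_nat_numeral)
  have "[:a0, a1, a2, a3, a4, a5:] = smult a0 (monom 1 0) + smult a1 (monom 1 1) + smult a2 (monom 1 2)
      + smult a3 (monom 1 3) + smult a4 (monom 1 4) + smult a5 (monom 1 5)"
    by (simp add: monom_altdef eval_nat_numeral)
  then have "gegenbauer_int 22 [:a0, a1, a2, a3, a4, a5:] =
      a0 * ?I 0 + a1 * ?I 1 + a2 * ?I 2 + a3 * ?I 3 + a4 * ?I 4 + a5 * ?I 5"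
    by (simp only: gegenbauer_int_add[OF n] gegenbauer_int_smult)
  then show ?thesis unfolding I1 I2 I3 I4 I5 by (simp add: algebra_simps monom_0 one_pCons)
qed

lemma ex_gegenbauer_expansion_22_quintic:
  "\<exists>c. gegenbauer_expansion 22 [:a0, a1, a2, a3, a4, a5:] c \<and> (\<forall>i\<ge>6. c i = 0) \<and> c 0 = a0 + a2 / 22 + a4 / 176"
proof -
  have n: "(22::nat) > 3" by simp
  have z: "coeff [:a0, a1, a2, a3, a4, a5:] k = 0" if "k \<ge> 6" for k
    using that by (intro coeff_eq_0) (auto intro!: le_less_trans[OF degree_pCons_le] simp: eval_nat_numeral)
  then obtain c where "gegenbauer_expansion 22 [:a0, a1, a2, a3, a4, a5:] c" "\<forall>i\<ge>6. c i = 0"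
    "c 0 * gegenbauer_int 22 1 = gegenbauer_int 22 [:a0, a1, a2, a3, a4, a5:]"
    using ex_gegenbauer_expansion[OF n z zero_less_numeral] by blast
  moreover have "gegenbauer_int 22 1 \<noteq> 0"
    using gegenbauer_int_pos[OF n, of 1] by simp
  ultimately show ?thesis unfolding gegenbauer_int_22_quintic by auto
qed

section \<open>Spherical designs and polynomial functions\<close>

lemma poly_fun_le_monomial:
  fixes f :: "nat \<Rightarrow> 'n::finite"
  assumes "k \<le> d"
  shows "poly_fun_le d (\<lambda>x. \<Prod>j<k. x $ f j)"
proof -
  define \<beta> where "\<beta> i = card {j. j < k \<and> f j = i}" for i
  have "(\<Sum>i\<in>UNIV. \<beta> i) = (\<Sum>i\<in>UNIV. \<Sum>j | j \<in> {..<k} \<and> f j = i. 1)"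
    unfolding \<beta>_def by simp
  also have "\<dots> = (\<Sum>j<k. 1)" by (rule sum.group) auto
  finally have deg: "(\<Sum>i\<in>UNIV. \<beta> i) = k" by simp
  have mono: "(\<Prod>j<k. x $ f j) = (\<Prod>i\<in>UNIV. (x $ i) ^ \<beta> i)" for x :: "real ^ 'n"
  proof -
    have "(\<Prod>i\<in>UNIV. (x $ i) ^ \<beta> i) = (\<Prod>i\<in>UNIV. \<Prod>j | j \<in> {..<k} \<and> f j = i. x $ f j)"
      unfolding \<beta>_def by (intro prod.cong refl) simp
    also have "\<dots> = (\<Prod>j<k. x $ f j)" by (rule prod.group) auto
    finally show ?thesis ..
  qed
  have eq: "(\<Prod>i\<in>UNIV. (x $ i) ^ \<beta> i) = (\<Sum>\<alpha> | (\<Sum>i\<in>UNIV. \<alpha> i) \<le> d. of_bool (\<alpha> = \<beta>) * (\<Prod>i\<in>UNIV. (x $ i) ^ \<alpha> i))"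
    for x :: "real ^ 'n"
  proof -
    have "(\<Sum>\<alpha> | (\<Sum>i\<in>UNIV. \<alpha> i) \<le> d. of_bool (\<alpha> = \<beta>) * (\<Prod>i\<in>UNIV. (x $ i) ^ \<alpha> i)) =
        (\<Sum>\<alpha>\<in>{\<beta>}. of_bool (\<alpha> = \<beta>) * (\<Prod>i\<in>UNIV. (x $ i) ^ \<alpha> i))"
      using deg assms by (intro sum.mono_neutral_right finite_exponents) auto
    then show ?thesis by simp
  qed
  show ?thesis unfolding poly_fun_le_def mono by (intro exI[of _ "\<lambda>\<alpha>. of_bool (\<alpha> = \<beta>)"] ext eq)
qed

lemma poly_fun_le_sum:
  fixes p :: "'a \<Rightarrow> real ^ 'n::finite \<Rightarrow> real"
  assumes "\<And>i. i \<in> I \<Longrightarrow> poly_fun_le d (p i)"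
  shows "poly_fun_le d (\<lambda>x. \<Sum>i\<in>I. a i * p i x)"
proof -
  obtain c where c: "\<forall>i\<in>I. p i = (\<lambda>x. \<Sum>\<alpha> | (\<Sum>i\<in>UNIV. \<alpha> i) \<le> d. c i \<alpha> * (\<Prod>i\<in>UNIV. (x $ i) ^ \<alpha> i))"
    using bchoice[of I "\<lambda>i c. p i = (\<lambda>x. \<Sum>\<alpha> | (\<Sum>i\<in>UNIV. \<alpha> i) \<le> d. c \<alpha> * (\<Prod>i\<in>UNIV. (x $ i) ^ \<alpha> i))"] assms
    unfolding poly_fun_le_def by blast
  have eq: "(\<Sum>i\<in>I. a i * p i x) = (\<Sum>\<alpha> | (\<Sum>i\<in>UNIV. \<alpha> i) \<le> d. (\<Sum>i\<in>I. a i * c i \<alpha>) * (\<Prod>i\<in>UNIV. (x $ i) ^ \<alpha> i))" for x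
  proof -
    have "(\<Sum>i\<in>I. a i * p i x) = (\<Sum>i\<in>I. \<Sum>\<alpha> | (\<Sum>i\<in>UNIV. \<alpha> i) \<le> d. a i * c i \<alpha> * (\<Prod>i\<in>UNIV. (x $ i) ^ \<alpha> i))"
      by (intro sum.cong refl) (simp add: c sum_distrib_left mult.assoc)
    also have "\<dots> = (\<Sum>\<alpha> | (\<Sum>i\<in>UNIV. \<alpha> i) \<le> d. \<Sum>i\<in>I. a i * c i \<alpha> * (\<Prod>i\<in>UNIV. (x $ i) ^ \<alpha> i))"
      by (rule sum.swap)
    finally show ?thesis by (simp only: sum_distrib_right)
  qed
  show ?thesis unfolding poly_fun_le_def by (intro exI[of _ "\<lambda>\<alpha>. \<Sum>i\<in>I. a i * c i \<alpha>"] ext eq)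
qed

lemma poly_fun_le_inner_power:
  fixes u :: "real ^ 'n::finite"
  assumes "k \<le> d"
  shows "poly_fun_le d (\<lambda>x. (u \<bullet> x) ^ k)"
  unfolding inner_power_expand by (intro poly_fun_le_sum poly_fun_le_monomial assms)

lemma design_inner_power_average:
  fixes C :: "(real ^ 'n::{finite,wellorder}) set"
  assumes "spherical_design \<tau> C" "k \<le> \<tau>"
  shows "(\<Sum>y\<in>C. (u \<bullet> y) ^ k) = real (card C) * (sphere_moment TYPE('n) k * norm u ^ k)"
proof -
  have "card C \<noteq> 0" using assms by (simp add: spherical_design_def spherical_code_def)
  moreover have "(\<Sum>y\<in>C. (u \<bullet> y) ^ k) / real (card C) = sphere_moment TYPE('n) k * norm u ^ k"
    using assms poly_fun_le_inner_power[OF assms(2), of u]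
    unfolding spherical_design_def sphere_moment_inner[symmetric] by blast
  ultimately show ?thesis by (simp add: field_simps)
qed

text \<open>Translates exponent vectors, which define \<open>poly_fun_le\<close>, into the words
  used by \<open>sidelnikov_equality\<close>.\<close>

lemma monomial_as_product:
  fixes \<alpha> :: "'n::finite \<Rightarrow> nat"
  assumes "(\<Sum>i\<in>UNIV. \<alpha> i) = k"
  shows "\<exists>f\<in>{..<k} \<rightarrow>\<^sub>E UNIV. \<forall>x :: real ^ 'n. (\<Prod>i\<in>UNIV. (x $ i) ^ \<alpha> i) = (\<Prod>j<k. x $ f j)"
  using assms
proof (induction k arbitrary: \<alpha>)
  case 0
  then show ?case by simp
next
  case (Suc k)
  have "\<exists>i. \<alpha> i \<noteq> 0"
  proof (rule ccontr)
    assume "\<nexists>i. \<alpha> i \<noteq> 0"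
    then show False using Suc.prems by simp
  qed
  then obtain i where i: "\<alpha> i \<noteq> 0" ..
  define \<beta> where "\<beta> = \<alpha>(i := \<alpha> i - 1)"
  have off: "\<beta> j = \<alpha> j" if "j \<noteq> i" for j using that by (simp add: \<beta>_def)
  have on: "\<alpha> i = Suc (\<beta> i)" using i by (simp add: \<beta>_def)
  have "(\<Sum>j\<in>UNIV. \<alpha> j) = Suc (\<Sum>j\<in>UNIV. \<beta> j)"
    using sum.remove[of UNIV i \<alpha>] sum.remove[of UNIV i \<beta>] on off by simp
  then obtain f where f: "f \<in> {..<k} \<rightarrow>\<^sub>E UNIV" "\<And>x :: real ^ 'n. (\<Prod>i\<in>UNIV. (x $ i) ^ \<beta> i) = (\<Prod>j<k. x $ f j)"
    using Suc.IH[of \<beta>] Suc.prems by auto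
  have "(\<Prod>j\<in>UNIV. (x $ j) ^ \<alpha> j) = (\<Prod>j<Suc k. x $ (f(k := i)) j)" for x :: "real ^ 'n"
  proof -
    have "(\<Prod>j\<in>UNIV. (x $ j) ^ \<alpha> j) = x $ i * (\<Prod>j\<in>UNIV. (x $ j) ^ \<beta> j)"
      using prod.remove[of UNIV i "\<lambda>j. (x $ j) ^ \<alpha> j"] prod.remove[of UNIV i "\<lambda>j. (x $ j) ^ \<beta> j"] on off
      by (simp add: mult.assoc)
    also have "\<dots> = (\<Prod>j<k. x $ (f(k := i)) j) * x $ i"
      unfolding f(2) by (simp add: mult.commute)
    finally show ?thesis by simp
  qed
  moreover have "f(k := i) \<in> {..<Suc k} \<rightarrow>\<^sub>E UNIV"
    using f(1) by (auto simp: PiE_iff extensional_def)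
  ultimately show ?case by blast
qed

lemma spherical_designI:
  fixes C :: "(real ^ 'n::{finite,wellorder}) set"
  assumes C: "finite C" "C \<subseteq> sphere 0 1" "C \<noteq> {}"
    and eq: "\<And>k. k \<le> \<tau> \<Longrightarrow> (\<Sum>x\<in>C. \<Sum>y\<in>C. (x \<bullet> y) ^ k) = (real (card C))\<^sup>2 * sphere_moment TYPE('n) k"
  shows "spherical_design \<tau> C"
  unfolding spherical_design_def spherical_code_def
proof (intro conjI C allI impI)
  fix p :: "real ^ 'n::_ \<Rightarrow> real" assume "poly_fun_le \<tau> p"
  then obtain c where p: "p = (\<lambda>x. \<Sum>\<alpha> | (\<Sum>i\<in>UNIV. \<alpha> i) \<le> \<tau>. c \<alpha> * (\<Prod>i\<in>UNIV. (x $ i) ^ \<alpha> i))"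
    unfolding poly_fun_le_def by blast
  have mono: "(\<Sum>y\<in>C. \<Prod>i\<in>UNIV. (y $ i) ^ \<alpha> i) = real (card C) * (LINT w|sphere_measure. (\<Prod>i\<in>UNIV. (w $ i) ^ \<alpha> i))"
    if le: "(\<Sum>i\<in>UNIV. \<alpha> i) \<le> \<tau>" for \<alpha> :: "'n::_ \<Rightarrow> nat"
  proof -
    obtain f where f: "f \<in> {..<(\<Sum>i\<in>UNIV. \<alpha> i)} \<rightarrow>\<^sub>E UNIV"
      "\<And>x :: real ^ 'n::_. (\<Prod>i\<in>UNIV. (x $ i) ^ \<alpha> i) = (\<Prod>j<(\<Sum>i\<in>UNIV. \<alpha> i). x $ f j)"
      using monomial_as_product[OF refl, of \<alpha>] by blast
    show ?thesis unfolding f(2) by (rule sidelnikov_equality[OF C(2) eq[OF le] f(1)])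
  qed
  have "(\<Sum>y\<in>C. p y) = (\<Sum>\<alpha> | (\<Sum>i\<in>UNIV. \<alpha> i) \<le> \<tau>. c \<alpha> * (\<Sum>y\<in>C. \<Prod>i\<in>UNIV. (y $ i) ^ \<alpha> i))"
    unfolding p sum_distrib_left by (rule sum.swap)
  also have "\<dots> = (\<Sum>\<alpha> | (\<Sum>i\<in>UNIV. \<alpha> i) \<le> \<tau>. real (card C) * (c \<alpha> * (LINT w|sphere_measure. (\<Prod>i\<in>UNIV. (w $ i) ^ \<alpha> i))))"
    by (intro sum.cong refl) (simp add: mono)
  also have "\<dots> = real (card C) * (LINT w|sphere_measure. p w)"
    unfolding p sum_distrib_left[symmetric]
    by (subst Bochner_Integration.integral_sum) (auto intro!: integrable_sphere_measure continuous_intros)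
  finally show "(\<Sum>x\<in>C. p x) / real (card C) = (LINT w|sphere_measure. p w)"
    using C by simp
qed

section \<open>The linear programming bound in dimension 22\<close>

lemma sphere_moments_22:
  "sphere_moment TYPE(22) 1 = 0" "sphere_moment TYPE(22) 2 = 1 / 22" "sphere_moment TYPE(22) 3 = 0"
  "sphere_moment TYPE(22) 4 = 1 / 176" "sphere_moment TYPE(22) 5 = 0"
proof -
  show "sphere_moment TYPE(22) 1 = 0" "sphere_moment TYPE(22) 3 = 0" "sphere_moment TYPE(22) 5 = 0"
    by (simp_all add: sphere_moment_odd)
  show 2: "sphere_moment TYPE(22) 2 = 1 / 22"
    using sphere_moment_Suc_Suc[where 'n=22, of 0] by (simp add: numeral_2_eq_2)
  show "sphere_moment TYPE(22) 4 = 1 / 176"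
    using sphere_moment_Suc_Suc[where 'n=22, of 1] 2 by simp
qed

lemma design_22_lower_bound:
  fixes C :: "(real ^ 22) set"
  assumes C: "spherical_design 5 C" "avoiding T C"
    and f: "f = [:a0, a1, a2, a3, a4, a5:]" and nonneg: "\<forall>t\<in>{-1..1} - T. 0 \<le> poly f t"
  shows "poly f 1 \<le> real (card C) * (a0 + a2 / 22 + a4 / 176)"
proof -
  have fin: "finite C" and sph: "C \<subseteq> sphere 0 1" and "C \<noteq> {}"
    using C(1) by (auto simp: spherical_design_def spherical_code_def)
  then obtain x where x: "x \<in> C" by blast
  have nx: "norm x = 1" using x sph by auto
  have p: "poly f t = a0 * t ^ 0 + a1 * t ^ 1 + a2 * t ^ 2 + a3 * t ^ 3 + a4 * t ^ 4 + a5 * t ^ 5" for t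
    unfolding f by (simp add: eval_nat_numeral algebra_simps)
  have "poly f 1 = poly f (x \<bullet> x)" using nx by (simp add: norm_eq_1)
  also have "\<dots> \<le> (\<Sum>y\<in>C. poly f (x \<bullet> y))"
  proof (rule member_le_sum[OF x _ fin])
    fix y assume y: "y \<in> C - {x}"
    have "x \<bullet> y \<in> inner_products C" using x y by (auto simp: inner_products_def)
    then have "x \<bullet> y \<notin> T" using C(2) by (auto simp: avoiding_def)
    moreover have "\<bar>x \<bullet> y\<bar> \<le> 1" using Cauchy_Schwarz_ineq2[of x y] nx y sph by auto
    ultimately show "0 \<le> poly f (x \<bullet> y)" using nonneg by (auto simp: abs_le_iff)
  qed
  also have "\<dots> = real (card C) * (a0 + a2 / 22 + a4 / 176)"
  proof -
    have S: "(\<Sum>y\<in>C. (x \<bullet> y) ^ k) = real (card C) * sphere_moment TYPE(22) k" if "k \<le> 5" for k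
      using design_inner_power_average[OF C(1) that, of x] nx by simp
    have le: "0 \<le> (5::nat)" "1 \<le> (5::nat)" "2 \<le> (5::nat)" "3 \<le> (5::nat)" "4 \<le> (5::nat)" "5 \<le> (5::nat)"
      by simp_all
    show ?thesis
      unfolding p sum.distrib sum_distrib_left[symmetric] S[OF le(1)] S[OF le(2)] S[OF le(3)] S[OF le(4)]
        S[OF le(5)] S[OF le(6)] sphere_moments_22 sphere_moment_0
      by (simp add: algebra_simps)
  qed
  finally show ?thesis .
qed

text \<open>
  The zeros of both quintics are the inner products \<open>-1, \<plusminus>1/3, 0\<close> of the code: simple ones at \<open>-1\<close> and at
  the ends of the forbidden interval, a double one at the fourth.
\<close>

definition lp_right :: "real poly" where
  "lp_right = [:0, - 1 / 27, - 4 / 27, 2 / 9, 4 / 3, 1:]"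

definition lp_left :: "real poly" where
  "lp_left = [:0, 1 / 27, - 2 / 27, - 4 / 9, 2 / 3, 1:]"

lemma lp_right_nonneg: "\<forall>t\<in>{-1..1} - {0<..<1/3}. 0 \<le> poly lp_right t"
proof
  fix t :: real assume t: "t \<in> {-1..1} - {0<..<1/3}"
  have "poly lp_right t = (t + 1) * (t + 1 / 3)\<^sup>2 * (t * (t - 1 / 3))"
    by (simp add: lp_right_def power2_eq_square field_simps)
  moreover have "0 \<le> t * (t - 1 / 3)" using t by (auto simp: zero_le_mult_iff)
  ultimately show "0 \<le> poly lp_right t" using t by simp
qed

lemma lp_left_nonneg: "\<forall>t\<in>{-1..1} - {-1/3<..<0}. 0 \<le> poly lp_left t"
proof
  fix t :: real assume t: "t \<in> {-1..1} - {-1/3<..<0}"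
  have "poly lp_left t = (t + 1) * (t - 1 / 3)\<^sup>2 * (t * (t + 1 / 3))"
    by (simp add: lp_left_def power2_eq_square field_simps)
  moreover have "0 \<le> t * (t + 1 / 3)" using t by (auto simp: zero_le_mult_iff)
  ultimately show "0 \<le> poly lp_left t" using t by simp
qed

lemma design_22_card_ge:
  fixes C :: "(real ^ 22) set"
  assumes "spherical_design 5 C" "avoiding {0<..<1/3} C \<or> avoiding {-1/3<..<0} C"
  shows "2816 \<le> card C"
  using assms(2)
proof
  assume "avoiding {0<..<1/3} C"
  \<comment> \<open>The value at 1 is 64/27 and the mean is 1/1188; the quotient is 64 * 44.\<close>
  from design_22_lower_bound[OF assms(1) this lp_right_def lp_right_nonneg]
  have "2816 \<le> real (card C)" by (simp add: lp_right_def)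
  then show ?thesis by simp
next
  assume "avoiding {-1/3<..<0} C"
  \<comment> \<open>The value at 1 is 32/27 and the mean is 1/2376; the quotient is 32 * 88.\<close>
  from design_22_lower_bound[OF assms(1) this lp_left_def lp_left_nonneg]
  have "2816 \<le> real (card C)" by (simp add: lp_left_def)
  then show ?thesis by simp
qed

section \<open>The 2816-point code in dimension 22\<close>

lemma code_2816_subset: "code_2816 x z \<subseteq> code_half x"
  by (auto simp: code_2816_def)

text \<open>An isometry preserves inner products, and its values are orthogonal to \<open>x\<close>
  and \<open>z\<close>, which is the range of \<open>code_2816_moments\<close>. Odd power sums
  vanish by antipodality; in degrees 2 and 4 the values 128 = 2816/22 and 16 = 2816/176 match the
  sphere.\<close>

lemma code_2816_pullback:
  fixes \<phi> :: "real ^ 22 \<Rightarrow> real ^ point"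
  assumes x: "x \<in> leech_code" and z: "z \<in> code_half x"
    and \<phi>: "isometry_onto \<phi> {v. v \<bullet> x = 0 \<and> v \<bullet> z = 0}"
  defines "D \<equiv> \<phi> -` code_2816 x z"
  shows "spherical_design 5 D" "card D = 2816" "inner_products D \<subseteq> {- 1, - 1 / 3, 0, 1 / 3}"
proof -
  let ?C = "code_2816 x z"
  have lin: "linear \<phi>" and nrm: "\<And>u. norm (\<phi> u) = norm u" and ran: "range \<phi> = {v. v \<bullet> x = 0 \<and> v \<bullet> z = 0}"
    using \<phi> by (auto simp: isometry_onto_def)
  have inner: "\<phi> u \<bullet> \<phi> v = u \<bullet> v" for u v
    using nrm[of "u + v"] nrm[of u] nrm[of v] by (simp add: dot_norm linear_add[OF lin])
  have inj: "inj \<phi>"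
  proof (rule injI)
    fix u v assume "\<phi> u = \<phi> v"
    then have "norm (\<phi> (u - v)) = 0" by (simp add: linear_diff[OF lin])
    then show "u = v" unfolding nrm by simp
  qed
  have "?C \<subseteq> range \<phi>"
    unfolding ran code_2816_def using code_half_orthogonal(1)[OF x] by (auto simp: inner_commute)
  then have img: "\<phi> ` D = ?C" by (auto simp: D_def)
  have finC: "finite ?C" by (rule finite_subset[OF code_2816_subset finite_code_half])
  have fin: "finite D" unfolding D_def using finC inj by (rule finite_vimageI)
  have inj_D: "inj_on \<phi> D" by (rule inj_on_subset[OF inj subset_UNIV])
  show card: "card D = 2816"
    using card_image[OF inj_D] card_code_2816[OF x z] unfolding img by simp
  have norm_C: "norm w = 1" if "w \<in> ?C" for w
    using that code_half_orthogonal(3)[OF x] code_2816_subset by blast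
  have norm_D: "norm u = 1" if "u \<in> D" for u
    using norm_C[of "\<phi> u"] that nrm by (simp add: D_def)
  have sum_D: "(\<Sum>y\<in>D. (u \<bullet> y) ^ k) = (\<Sum>w\<in>?C. (\<phi> u \<bullet> w) ^ k)" for u k
  proof -
    have "(\<Sum>w\<in>?C. (\<phi> u \<bullet> w) ^ k) = (\<Sum>y\<in>D. (\<phi> u \<bullet> \<phi> y) ^ k)"
      unfolding img[symmetric] by (simp add: sum.reindex[OF inj_D])
    then show ?thesis by (simp add: inner)
  qed
  have ortho: "\<phi> u \<bullet> x = 0" "\<phi> u \<bullet> z = 0" for u using ran by auto
  have odd: "(\<Sum>w\<in>?C. (v \<bullet> w) ^ k) = 0" if "odd k" for v k
  proof -
    have "(\<Sum>w\<in>?C. (v \<bullet> w) ^ k) = (\<Sum>w\<in>?C. (v \<bullet> (- w)) ^ k)"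
      by (rule sum.reindex_bij_witness[of _ uminus uminus])
         (auto simp: code_2816_def code_half_uminus[OF x])
    also have "\<dots> = - (\<Sum>w\<in>?C. (v \<bullet> w) ^ k)" using that by (simp add: power_minus_odd sum_negf)
    finally show ?thesis by simp
  qed
  show "spherical_design 5 D"
  proof (rule spherical_designI[OF fin])
    show "D \<subseteq> sphere 0 1" using norm_D by auto
    show "D \<noteq> {}" using card by auto
    have s: "(\<Sum>x\<in>D. \<Sum>y\<in>D. (x \<bullet> y) ^ k) = (real (card D))\<^sup>2 * sphere_moment TYPE(22) k"
      if "\<And>u. u \<in> D \<Longrightarrow> (\<Sum>y\<in>D. (u \<bullet> y) ^ k) = 2816 * sphere_moment TYPE(22) k" for k
      using that by (simp add: card power2_eq_square)
    fix k :: nat assume "k \<le> 5"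
    then have "k = 0 \<or> odd k \<or> k = 2 \<or> k = 4" by presburger
    then consider "k = 0" | "odd k" | "k = 2" | "k = 4" by blast
    then show "(\<Sum>x\<in>D. \<Sum>y\<in>D. (x \<bullet> y) ^ k) = (real (card D))\<^sup>2 * sphere_moment TYPE(22) k"
    proof cases
      case 1
      then show ?thesis by (intro s) (simp add: card)
    next
      case 2
      then show ?thesis by (intro s) (simp add: sum_D odd sphere_moment_odd)
    next
      case 3
      then show ?thesis
        by (intro s) (simp add: sum_D code_2816_moments(1)[OF x z ortho] sphere_moments_22 nrm norm_D)
    next
      case 4
      then show ?thesis
        by (intro s) (simp add: sum_D code_2816_moments(2)[OF x z ortho] sphere_moments_22 nrm norm_D)
    qed
  qed
  show "inner_products D \<subseteq> {- 1, - 1 / 3, 0, 1 / 3}"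
  proof
    fix t assume "t \<in> inner_products D"
    then obtain u v where uv: "u \<in> D" "v \<in> D" "u \<noteq> v" "t = u \<bullet> v" by (auto simp: inner_products_def)
    have H: "\<phi> u \<in> code_half x" "\<phi> v \<in> code_half x"
      using uv code_2816_subset by (auto simp: D_def)
    have "\<phi> u \<noteq> \<phi> v" using uv(3) inj by (auto dest: injD)
    then have "\<phi> u \<bullet> \<phi> v \<noteq> 1" using code_half_inner(2)[OF x H] by simp
    then show "t \<in> {- 1, - 1 / 3, 0, 1 / 3}"
      using code_half_inner(1)[OF x H] uv(4) unfolding inner by blast
  qed
qed

lemma code_2816_tight:
  fixes \<phi> :: "real ^ 22 \<Rightarrow> real ^ point"
  assumes x: "x \<in> leech_code" and z: "z \<in> code_half x"
    and \<phi>: "isometry_onto \<phi> {v. v \<bullet> x = 0 \<and> v \<bullet> z = 0}"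
  shows "tight 5 {0<..<1/3} (\<phi> -` code_2816 x z)" "tight 5 {-1/3<..<0} (\<phi> -` code_2816 x z)"
proof -
  let ?D = "\<phi> -` code_2816 x z"
  note D = code_2816_pullback[OF x z \<phi>]
  have tightI: "tight 5 T ?D"
    if T: "{- 1, - 1 / 3, 0, 1 / 3} \<inter> T = {}" and f: "f = [:a0, a1, a2, a3, a4, a5:]" and pos: "\<forall>t\<in>{-1..1} - T. 0 \<le> poly f t"
      "0 < a0 + a2 / 22 + a4 / 176" "2816 = poly f 1 / (a0 + a2 / 22 + a4 / 176)"
    for T :: "real set" and f a0 a1 a2 a3 a4 a5
  proof -
    \<comment> \<open>The quintic of the lower bound is the witness: its coefficients from index 6
      on are zero, and \<open>c 0\<close> is its mean.\<close>
    obtain c where c: "gegenbauer_expansion 22 f c" "\<forall>i\<ge>6. c i = 0" "c 0 = a0 + a2 / 22 + a4 / 176"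
      using ex_gegenbauer_expansion_22_quintic f by blast
    have "avoiding T ?D" using D(3) T by (auto simp: avoiding_def)
    then show ?thesis
      unfolding tight_def using D(1,2) c pos
      by (intro conjI exI[of _ f] exI[of _ c]) auto
  qed
  show "tight 5 {0<..<1/3} ?D"
    by (rule tightI[OF _ lp_right_def lp_right_nonneg]) (auto simp: lp_right_def)
  show "tight 5 {-1/3<..<0} ?D"
    by (rule tightI[OF _ lp_left_def lp_left_nonneg]) (auto simp: lp_left_def)
qed

theorem theorem6p5:
  shows "design_min TYPE(22) 5 {0<..<1/3} = 2816 \<and>
         design_min TYPE(22) 5 {-1/3<..<0} = 2816 \<and>
         (\<forall>x \<in> leech_code. \<forall>z \<in> code_half x. \<forall>\<phi> :: real ^ 22 \<Rightarrow> real ^ point.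
            isometry_onto \<phi> {v. v \<bullet> x = 0 \<and> v \<bullet> z = 0} \<longrightarrow>
              tight 5 {0<..<1/3} (\<phi> -` code_2816 x z) \<and>
              tight 5 {-1/3<..<0} (\<phi> -` code_2816 x z))"
proof -
  obtain x where x: "x \<in> leech_code" using card_leech_code by fastforce
  obtain z where z: "z \<in> code_half x" using card_code_half[OF x] by fastforce
  obtain \<phi> :: "real ^ 22 \<Rightarrow> real ^ point" where \<phi>: "isometry_onto \<phi> {v. v \<bullet> x = 0 \<and> v \<bullet> z = 0}"
    using ex_isometry_onto_complement[OF x z] by blast
  have min: "design_min TYPE(22) 5 T = 2816"
    if T: "tight 5 T (\<phi> -` code_2816 x z)" "T = {0<..<1/3} \<or> T = {-1/3<..<0}" for T
    unfolding design_min_def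
  proof (rule cInf_eq_minimum)
    show "2816 \<in> {card C |C. spherical_design 5 (C :: (real ^ 22) set) \<and> avoiding T C}"
      using T(1) code_2816_pullback(2)[OF x z \<phi>] unfolding tight_def by (metis (mono_tags, lifting) mem_Collect_eq)
    show "2816 \<le> n" if "n \<in> {card C |C. spherical_design 5 (C :: (real ^ 22) set) \<and> avoiding T C}" for n
      using that design_22_card_ge T(2) by blast
  qed
  show ?thesis
    using min[OF code_2816_tight(1)[OF x z \<phi>]] min[OF code_2816_tight(2)[OF x z \<phi>]] code_2816_tight by blast
qed

end
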